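(* Let $p\in(1,\infty]$ and let $X$ and $Y$ be asymptotically coarse Lipschitz equivalent Banach spaces. If $X$ has property $\mathsf{A}_p$, then $Y$ has property $\mathsf{A}_p$; and if $X$ has property $\mathsf{N}_p$, then $Y$ has property $\mathsf{N}_p$.
   Context: Trees. For a set $\mathcal D$ and $k\in\mathbb N$, write $\mathcal D^{\le k}=\bigcup_{i=1}^k\mathcal D^i$. Let $X$ be a Banach space with closed unit ball $B_X$ and let $\mathcal D$ be a weak neighborhood basis of $0\in X$, directed by reverse inclusion. A family $(x_{\bar n})_{\bar n\in\mathcal D^{\le k}}$ in $X$ is a weakly null tree if for each $\bar n\in\{\emptyset\}\cup\mathcal D^{\le k-1}$ the net $(x_{(\bar n,m)})_{m\in\mathcal D}$ is weakly null (where $(\emptyset,m)=(m)$). Property $\mathsf A_p$ ($p\in(1,\infty]$): there is $c>0$ such that for every weak neighborhood basis $\mathcal D$ of $0\in X$, every $k\in\mathbb N$, and every weakly null tree $(x_{\bar n})_{\bar n\in\mathcal D^{\le k}}$ in $B_X$, there is $\bar m=(m_1,\ldots,m_k)\in\mathcal D^k$ such that $\big\|\sum_{i=1}^k a_i x_{(m_1,\ldots,m_i)}\big\|\le c\|a\|_p$ for all $a=(a_1,\ldots,a_k)\in\ell_p^k$. Property $\mathsf N_p$ ($p\in(1,\infty]$): there is $c>0$ such that for every weak neighborhood basis $\mathcal D$ of $0\in X$, every $k\in\mathbb N$, and every weakly null tree $(x_{\bar n})_{\bar n\in\mathcal D^{\le k}}$ in $B_X$, there is $\bar m=(m_1,\ldots,m_k)\in\mathcal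 D^k$ such that $\big\|\sum_{i=1}^k x_{(m_1,\ldots,m_i)}\big\|\le c\,k^{1/p}$, with the convention $1/\infty=0$. Banach spaces are regarded as metric spaces with the metric $d(x,x')=\|x-x'\|$. Let $(X,d)$ and $(Y,\partial)$ be metric spaces. A map $f:X\to Y$ is coarse Lipschitz if there is $L>0$ such that $\partial(f(x),f(x'))\le L\,d(x,x')+L$ for all $x,x'\in X$. Two maps $f,g:X\to Y$ are asymptotically close, written $f\sim_\infty g$, if for some $x_0\in X$ one has $\lim_{x\to\infty}\frac{\partial(f(x),g(x))}{d(x,x_0)}=0$, where $x\to\infty$ means $d(x,x_0)\to\infty$; if $X$ is bounded, any two maps $X\to Y$ are by convention asymptotically close. $X$ and $Y$ are asymptotically coarse Lipschitz equivalent if there are coarse Lipschitz maps $f:X\to Y$ and $g:Y\to X$ with $g\circ f\sim_\infty \mathrm{Id}_X$ and $f\circ g\sim_\infty \mathrm{Id}_Y$. *)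

theory Defs
  imports "HOL-Analysis.Analysis"
begin

definition weak_topology :: "'a::real_normed_vector topology" where
  "weak_topology = topology_generated_by {f -` U |(f :: 'a \<Rightarrow> real) U. bounded_linear f \<and> open U}"

definition weak_nbhd_of_0 :: "'a::real_normed_vector set \<Rightarrow> bool" where
  "weak_nbhd_of_0 V \<longleftrightarrow> (\<exists>U. openin weak_topology U \<and> 0 \<in> U \<and> U \<subseteq> V)"

(* Neighbourhoods need not be open. *)
definition weak_nbhd_basis :: "'a::real_normed_vector set set \<Rightarrow> bool" where
  "weak_nbhd_basis D \<longleftrightarrow>
     (\<forall>V\<in>D. weak_nbhd_of_0 V) \<and> (\<forall>V. weak_nbhd_of_0 V \<longrightarrow> (\<exists>W\<in>D. W \<subseteq> V))"

(* The filter of tails of D directed by reverse inclusion; a net indexed by D converges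
   iff it converges along this filter (see eventually_tails). *)
definition tails :: "'a set set \<Rightarrow> 'a set filter" where
  "tails D = (INF m0\<in>D. principal {m \<in> D. m \<subseteq> m0})"

lemma weak_nbhd_basis_directed:
  assumes "weak_nbhd_basis D" "V \<in> D" "W \<in> D"
  shows "\<exists>U\<in>D. U \<subseteq> V \<and> U \<subseteq> W"
proof -
  from assms obtain V' W' where "openin weak_topology V'" "0 \<in> V'" "V' \<subseteq> V"
      "openin weak_topology W'" "0 \<in> W'" "W' \<subseteq> W"
    unfolding weak_nbhd_basis_def weak_nbhd_of_0_def by meson
  then have "weak_nbhd_of_0 (V \<inter> W)"
    unfolding weak_nbhd_of_0_def by (intro exI[of _ "V' \<inter> W'"]) (auto intro: openin_Int)
  then show ?thesis
    using assms(1) unfolding weak_nbhd_basis_def by (metis le_inf_iff)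
qed

lemma weak_nbhd_basis_nonempty:
  assumes "weak_nbhd_basis (D :: 'a::real_normed_vector set set)"
  shows "D \<noteq> {}"
proof -
  have "openin weak_topology (UNIV :: 'a set)"
    unfolding weak_topology_def
  proof (rule topology_generated_by_Basis, intro CollectI exI conjI)
    show "UNIV = (\<lambda>_::'a. 0::real) -` UNIV"
      by (rule vimage_UNIV[symmetric])
  qed (rule bounded_linear_zero, rule open_UNIV)
  then have "weak_nbhd_of_0 (UNIV :: 'a set)"
    unfolding weak_nbhd_of_0_def by blast
  then show ?thesis
    using assms unfolding weak_nbhd_basis_def by blast
qed

lemma eventually_tails:
  assumes "weak_nbhd_basis D"
  shows "eventually P (tails D) \<longleftrightarrow> (\<exists>m0\<in>D. \<forall>m\<in>D. m \<subseteq> m0 \<longrightarrow> P m)"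
  unfolding tails_def
proof (subst eventually_INF_base)
  show "D \<noteq> {}"
    by (rule weak_nbhd_basis_nonempty[OF assms])
  show "\<exists>x\<in>D. principal {m \<in> D. m \<subseteq> x}
      \<le> inf (principal {m \<in> D. m \<subseteq> a}) (principal {m \<in> D. m \<subseteq> b})" if "a \<in> D" "b \<in> D" for a b
  proof -
    obtain U where "U \<in> D" "U \<subseteq> a" "U \<subseteq> b"
      using weak_nbhd_basis_directed[OF assms \<open>a \<in> D\<close> \<open>b \<in> D\<close>] by blast
    then show ?thesis
      by (intro bexI[of _ U]) auto
  qed
qed (auto simp: eventually_principal)

(* Tuples over D of length 1, ..., k; the tuple (m_1, ..., m_i) is the list take i m. *)
definition tuples_upto :: "'d set \<Rightarrow> nat \<Rightarrow> 'd list set" where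
  "tuples_upto D k = {n. set n \<subseteq> D \<and> 1 \<le> length n \<and> length n \<le> k}"

(* Only the values of x on tuples_upto D k matter. *)
definition weakly_null_tree ::
    "'a::real_normed_vector set set \<Rightarrow> nat \<Rightarrow> ('a set list \<Rightarrow> 'a) \<Rightarrow> bool" where
  "weakly_null_tree D k x \<longleftrightarrow>
     (\<forall>n \<in> {[]} \<union> tuples_upto D (k - 1). limitin weak_topology (\<lambda>m. x (n @ [m])) 0 (tails D))"

definition lp_norm :: "ereal \<Rightarrow> nat \<Rightarrow> (nat \<Rightarrow> real) \<Rightarrow> real" where
  "lp_norm p k a =
     (if p = \<infinity> then Max ((\<lambda>i. \<bar>a i\<bar>) ` {1..k})
      else (\<Sum>i=1..k. \<bar>a i\<bar> powr real_of_ereal p) powr (1 / real_of_ereal p))"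

definition property_A :: "ereal \<Rightarrow> 'a::banach itself \<Rightarrow> bool" where
  "property_A p (_ :: 'a itself) \<longleftrightarrow>
     (\<exists>c>0. \<forall>(D :: 'a set set) k x.
        weak_nbhd_basis D \<and> 1 \<le> k \<and> weakly_null_tree D k x \<and> x ` tuples_upto D k \<subseteq> cball 0 1 \<longrightarrow>
        (\<exists>m. length m = k \<and> set m \<subseteq> D \<and>
           (\<forall>a. norm (\<Sum>i=1..k. a i *\<^sub>R x (take i m)) \<le> c * lp_norm p k a)))"

(* In ereal, 1 / \<infinity> = 0. *)
definition property_N :: "ereal \<Rightarrow> 'a::banach itself \<Rightarrow> bool" where
  "property_N p (_ :: 'a itself) \<longleftrightarrow>
     (\<exists>c>0. \<forall>(D :: 'a set set) k x.
        weak_nbhd_basis D \<and> 1 \<le> k \<and> weakly_null_tree D k x \<and> x ` tuples_upto D k \<subseteq> cball 0 1 \<longrightarrow>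
        (\<exists>m. length m = k \<and> set m \<subseteq> D \<and>
           norm (\<Sum>i=1..k. x (take i m)) \<le> c * real k powr real_of_ereal (1 / p)))"

definition coarse_lipschitz :: "('a::metric_space \<Rightarrow> 'b::metric_space) \<Rightarrow> bool" where
  "coarse_lipschitz f \<longleftrightarrow> (\<exists>L>0. \<forall>x x'. dist (f x) (f x') \<le> L * dist x x' + L)"

definition asymptotically_close ::
    "('a::metric_space \<Rightarrow> 'b::metric_space) \<Rightarrow> ('a \<Rightarrow> 'b) \<Rightarrow> bool" where
  "asymptotically_close f g \<longleftrightarrow>
     bounded (UNIV :: 'a set) \<or>
     (\<exists>x0. ((\<lambda>x. dist (f x) (g x) / dist x x0) \<longlongrightarrow> 0) (filtercomap (\<lambda>x. dist x x0) at_top))"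

definition asymptotically_coarse_lipschitz_equivalent ::
    "'a::metric_space itself \<Rightarrow> 'b::metric_space itself \<Rightarrow> bool" where
  "asymptotically_coarse_lipschitz_equivalent (_ :: 'a itself) (_ :: 'b itself) \<longleftrightarrow>
     (\<exists>(f :: 'a \<Rightarrow> 'b) (g :: 'b \<Rightarrow> 'a). coarse_lipschitz f \<and> coarse_lipschitz g \<and>
        asymptotically_close (g \<circ> f) id \<and> asymptotically_close (f \<circ> g) id)"

end

theory Submission
  imports Defs
begin

text \<open>
  A weakly null tree with a good branch amounts to an upper estimate that holds for all
  \<open>u\<^sub>1\<close> close to 0 in the weak topology, then for all \<open>u\<^sub>2\<close> close to 0, and so on. On \<open>X\<close>, averaging the
  values of the corresponding game produces, for each finite set of coefficients and each length, an
  equivalent convex gauge that grows by a controlled amount under weakly small perturbations. A coarse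
  Lipschitz map \<open>f\<close> transports it to a norm on the dual of \<open>Y\<close>, the maximal slope of a functional along
  \<open>f\<close>, averaged over many dyadic scales. Cutting almost norming pairs at their midpoint and applying
  the Gorelik principle shows that adding a weak* null perturbation to a functional raises this norm;
  by duality, a weakly small step in \<open>Y\<close> raises the predual norm by at most a constant times its
  cost on \<open>X\<close>.
\<close>

section \<open>Brouwer's fixed point theorem in normed spaces\<close>

text \<open>Only charges that add up step by step can be followed through a renorming, so both
  hypotheses are put in the form \<open>c\<close> plus a sum of weights. For coefficients in [-1, 1]
  and finite p, the l_p norm is at most 1 plus the sum of their p-th powers; sums of k vectors,
  scaled by k to the power -1/p, need no weights. A step then costs w s / c + 2 / k, and the terms 2
  / k add up to 2 over k steps: the final constant sees only \<open>c\<close> and \<open>L\<close>,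
  although the renorming depends on k.

  The obstacle is that \<open>f\<close> and \<open>g\<close> invert each other only up to an error
  sublinear in the norm of the point. Increments of \<open>f\<close> are therefore compared only at
  scales at least proportional to the norms of the points, and a pair cut at its midpoint survives
  only at half its scale. The loss, twice the drop of the slope from one scale to the next,
  telescopes over the scales.

  A dual functional of mean slope T leaves room 1 - T for a perturbation of itself. Up to its cost,
  a step from z thus stays below T times the norm of z plus (1 - T) 8 L; this is why the maximum of
  the predual norm and 8 L is the quantity that is followed.\<close>

lemma compact_unit_cube_fun: "compact {t::nat \<Rightarrow> real. \<forall>i. t i \<in> {0..1}}"
proof -
  have "compactin (product_topology (\<lambda>_. euclidean) UNIV) (PiE (UNIV::nat set) (\<lambda>_. {0..1::real}))"
    by (subst compactin_PiE) auto
  moreover have "PiE (UNIV::nat set) (\<lambda>_. {0..1::real}) = {t. \<forall>i. t i \<in> {0..1}}"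
    by (auto simp: PiE_def Pi_def)
  ultimately show ?thesis
    by (simp add: euclidean_product_topology)
qed

lemma tendsto_fun_iff:
  fixes l :: "'i \<Rightarrow> 'b::topological_space"
  shows "(f \<longlongrightarrow> l) F \<longleftrightarrow> (\<forall>i. ((\<lambda>x. f x i) \<longlongrightarrow> l i) F)"
  using limitin_componentwise[of "\<lambda>_. euclidean" UNIV f l F]
  by (simp add: euclidean_product_topology)

text \<open>The dimension \<open>n\<close> is a variable, so the cube sits in
  \<open>nat \<Rightarrow> real\<close> with the product topology and only the first
  \<open>n\<close> coordinates are fixed. Kuhn's combinatorial lemma on the grid of mesh 1 / (m + 1)
  yields cells in which each coordinate is moved weakly up at one vertex and weakly down at another;
  compactness and continuity turn a limit of these cells into a fixed point.\<close>

lemma brouwer_cube_fun: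
  fixes F :: "(nat \<Rightarrow> real) \<Rightarrow> (nat \<Rightarrow> real)" and n :: nat
  defines "Q \<equiv> {t::nat \<Rightarrow> real. \<forall>i. t i \<in> {0..1}}"
  assumes cont: "continuous_on Q F" and FQ: "F ` Q \<subseteq> Q"
  shows "\<exists>t\<in>Q. \<forall>i<n. F t i = t i"
proof -
  define R where "R m z i a b \<longleftrightarrow> a \<in> Q \<and> b \<in> Q \<and> (\<forall>j. \<bar>a j - z j\<bar> \<le> 1 / real (Suc m))
      \<and> (\<forall>j. \<bar>b j - z j\<bar> \<le> 1 / real (Suc m)) \<and> F a i \<ge> a i \<and> F b i \<le> b i" for m z i a b
  have key: "\<exists>z\<in>Q. \<forall>i<n. \<exists>a b. R m z i a b" for m
  proof -
    define p where "p = Suc m"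
    define pt where "pt x = (\<lambda>i. if i < n then min (real (x i) / real p) 1 else 0)" for x :: "nat \<Rightarrow> nat"
    \<comment> \<open>Label 1 says that \<open>F\<close> does not increase coordinate
      \<open>i\<close>, label 0 that it does not decrease it. On the faces \<open>x i = p\<close>
      and \<open>x i = 0\<close> this is automatic, as \<open>F\<close> maps into the cube; hence
      the boundary conditions of \<open>kuhn_lemma\<close>.\<close>
    define label where "label x i =
      (if x i = p then 1 else if x i \<noteq> 0 \<and> F (pt x) i \<le> pt x i then 1 else (0::nat))" for x i
    have ptQ: "pt x \<in> Q" for x
      by (auto simp: Q_def pt_def)
    have FptQ: "F (pt x) i \<in> {0..1}" for x i
      using FQ ptQ[of x] by (auto simp: Q_def)
    have l1: "F (pt x) i \<le> pt x i" if "label x i = 1" "i < n" for x i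
      using that FptQ[of x i] by (auto simp: label_def pt_def p_def split: if_splits)
    have l0: "F (pt x) i \<ge> pt x i" if "label x i \<noteq> 1" "i < n" for x i
      using that FptQ[of x i] by (auto simp: label_def pt_def p_def split: if_splits)
    obtain q where q: "\<forall>i<n. q i < p"
      and rs: "\<forall>i<n. \<exists>r s. (\<forall>j<n. q j \<le> r j \<and> r j \<le> q j + 1) \<and>
          (\<forall>j<n. q j \<le> s j \<and> s j \<le> q j + 1) \<and> label r i \<noteq> label s i"
      by (rule kuhn_lemma[of p n label]) (auto simp: label_def p_def)
    have near: "\<bar>pt r j - pt q j\<bar> \<le> 1 / real (Suc m)"
      if "\<forall>j<n. q j \<le> r j \<and> r j \<le> q j + 1" for r j
    proof (cases "j < n")
      case True
      then have "q j \<le> r j" "r j \<le> q j + 1" "q j < p" using that q by auto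
      then have "real (r j) / p \<le> 1" "real (q j) / p \<le> 1" by (auto simp: p_def field_simps)
      moreover have "\<bar>real (r j) / p - real (q j) / p\<bar> = \<bar>real (r j) - real (q j)\<bar> / p"
        by (simp add: diff_divide_distrib[symmetric])
      moreover have "\<dots> \<le> 1 / p"
        using \<open>q j \<le> r j\<close> \<open>r j \<le> q j + 1\<close> by (intro divide_right_mono) auto
      ultimately show ?thesis using True by (simp add: pt_def p_def)
    qed (simp add: pt_def)
    show ?thesis
    proof (intro bexI[of _ "pt q"] ptQ allI impI)
      fix i assume i: "i < n"
      then obtain r s where r: "\<forall>j<n. q j \<le> r j \<and> r j \<le> q j + 1"
        and s: "\<forall>j<n. q j \<le> s j \<and> s j \<le> q j + 1" and ne: "label r i \<noteq> label s i"
        using rs by blast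
      have "label r i = 1 \<or> label s i = 1" "\<not> (label r i = 1 \<and> label s i = 1)"
        using ne by (auto simp: label_def split: if_splits)
      then consider "label r i = 1" "label s i \<noteq> 1" | "label s i = 1" "label r i \<noteq> 1" by blast
      then show "\<exists>a b. R m (pt q) i a b"
      proof cases
        case 1
        show ?thesis
          unfolding R_def using near[OF r] near[OF s] l1[OF 1(1) i] l0[OF 1(2) i] ptQ
          by (intro exI[of _ "pt s"] exI[of _ "pt r"]) simp
      next
        case 2
        show ?thesis
          unfolding R_def using near[OF r] near[OF s] l1[OF 2(1) i] l0[OF 2(2) i] ptQ
          by (intro exI[of _ "pt r"] exI[of _ "pt s"]) simp
      qed
    qed
  qed
  obtain z where zQ: "\<And>m. z m \<in> Q" and z: "\<And>m i. i < n \<Longrightarrow> \<exists>a b. R m (z m) i a b"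
    using key by metis
  have "seq_compact Q"
    unfolding Q_def by (intro compact_imp_seq_compact compact_unit_cube_fun)
  then obtain l \<rho> where l: "l \<in> Q" "strict_mono \<rho>" "(z \<circ> \<rho>) \<longlonglongrightarrow> l"
    using zQ unfolding seq_compact_def by metis
  have zl: "(\<lambda>m. z (\<rho> m) j) \<longlonglongrightarrow> l j" for j
    using l(3) by (simp add: tendsto_fun_iff o_def)
  have inv0: "(\<lambda>m. 1 / real (Suc (\<rho> m))) \<longlonglongrightarrow> 0"
    using LIMSEQ_subseq_LIMSEQ[OF LIMSEQ_inverse_real_of_nat l(2)] by (simp add: o_def inverse_eq_divide)
  have lim: "(\<lambda>m. F (a m) i - a m i) \<longlonglongrightarrow> F l i - l i"
    if aQ: "\<And>m. a m \<in> Q" and a: "\<And>m j. \<bar>a m j - z (\<rho> m) j\<bar> \<le> 1 / real (Suc (\<rho> m))" for a i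
  proof -
    have al: "(\<lambda>m. a m j) \<longlonglongrightarrow> l j" for j
    proof -
      have "(\<lambda>m. a m j - z (\<rho> m) j) \<longlonglongrightarrow> 0"
        by (rule Lim_null_comparison[OF _ inv0]) (use a in auto)
      from tendsto_add[OF this zl[of j]] show ?thesis by simp
    qed
    then have "a \<longlonglongrightarrow> l"
      by (simp add: tendsto_fun_iff)
    then have "(\<lambda>m. F (a m)) \<longlonglongrightarrow> F l"
      by (rule continuous_on_tendsto_compose[OF cont _ l(1)]) (simp add: aQ)
    then have "(\<lambda>m. F (a m) i) \<longlonglongrightarrow> F l i"
      by (simp add: tendsto_fun_iff)
    with al show ?thesis by (intro tendsto_diff)
  qed
  have "F l i = l i" if i: "i < n" for i
  proof -
    have "\<forall>m. \<exists>a. \<exists>b. R (\<rho> m) (z (\<rho> m)) i a b"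
      using z[OF i] by blast
    from choice[OF this] obtain a where "\<forall>m. \<exists>b. R (\<rho> m) (z (\<rho> m)) i (a m) b" by blast
    from choice[OF this] obtain b where "\<And>m. R (\<rho> m) (z (\<rho> m)) i (a m) (b m)" by blast
    then have a: "\<And>m. a m \<in> Q" "\<And>m j. \<bar>a m j - z (\<rho> m) j\<bar> \<le> 1 / real (Suc (\<rho> m))"
        "\<And>m. F (a m) i - a m i \<ge> 0"
      and b: "\<And>m. b m \<in> Q" "\<And>m j. \<bar>b m j - z (\<rho> m) j\<bar> \<le> 1 / real (Suc (\<rho> m))"
        "\<And>m. F (b m) i - b m i \<le> 0"
      by (simp_all add: R_def)
    have "F l i - l i \<ge> 0"
      by (rule LIMSEQ_le_const[OF lim[OF a(1,2)]]) (use a(3) in auto)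
    moreover have "F l i - l i \<le> 0"
      by (rule LIMSEQ_le_const2[OF lim[OF b(1,2)]]) (use b(3) in auto)
    ultimately show ?thesis by simp
  qed
  then show ?thesis using l(1) by blast
qed

text \<open>The weights of the fixed point are the coordinates of a fixed point of a self-map of the cube,
  in which the simplex is parametrised by \<open>t \<mapsto> t / max 1 (\<Sum>t)\<close>.\<close>

lemma convex_weights_fixed_point:
  fixes v :: "nat \<Rightarrow> 'a::real_normed_vector" and w :: "nat \<Rightarrow> 'a \<Rightarrow> real"
  assumes A: "convex A" "0 \<in> A"
    and v: "\<And>l. l < N \<Longrightarrow> v l \<in> A"
    and cont: "\<And>l. l < N \<Longrightarrow> continuous_on A (w l)"
    and pos: "\<And>l a. l < N \<Longrightarrow> a \<in> A \<Longrightarrow> 0 \<le> w l a"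
    and sum1: "\<And>a. a \<in> A \<Longrightarrow> (\<Sum>l<N. w l a) = 1"
  shows "\<exists>a\<in>A. a = (\<Sum>l<N. w l a *\<^sub>R v l)"
proof -
  define Q where "Q = {t::nat \<Rightarrow> real. \<forall>i. t i \<in> {0..1}}"
  define a where "a t = (1 / max 1 (\<Sum>l<N. t l)) *\<^sub>R (\<Sum>l<N. t l *\<^sub>R v l)" for t :: "nat \<Rightarrow> real"
  define F where "F t = (\<lambda>l. if l < N then w l (a t) else 0)" for t
  have a_in: "a t \<in> A" if "t \<in> Q" for t
  proof -
    define s where "s = (\<Sum>l<N. t l)"
    have t0: "0 \<le> t l" for l using that by (auto simp: Q_def)
    show ?thesis
    proof (cases "s = 0")
      case True
      then have "t l = 0" if "l < N" for l
        using that t0 sum_nonneg_eq_0_iff[of "{..<N}" t] by (auto simp: s_def)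
      then show ?thesis using A(2) by (simp add: a_def)
    next
      case False
      then have s: "s > 0" using sum_nonneg[of "{..<N}" t] t0 by (simp add: s_def less_le)
      have "(\<Sum>l<N. (t l / s) *\<^sub>R v l) \<in> A"
        by (rule convex_sum) (use A v t0 s in \<open>auto simp: sum_divide_distrib[symmetric] s_def\<close>)
      then have "(s / max 1 s) *\<^sub>R (\<Sum>l<N. (t l / s) *\<^sub>R v l) + (1 - s / max 1 s) *\<^sub>R 0 \<in> A"
        using A s by (intro convexD) (auto simp: field_simps)
      moreover have "(s / max 1 s) *\<^sub>R (\<Sum>l<N. (t l / s) *\<^sub>R v l) = a t"
        using s by (simp add: a_def s_def[symmetric] scaleR_sum_right)
      ultimately show ?thesis by simp
    qed
  qed
  have cont_a: "continuous_on Q a"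
    unfolding a_def by (intro continuous_intros continuous_on_product_then_coordinatewise) auto
  have "continuous_on Q F"
  proof (rule continuous_on_coordinatewise_then_product)
    fix l show "continuous_on Q (\<lambda>t. F t l)"
    proof (cases "l < N")
      case True
      then show ?thesis
        unfolding F_def using continuous_on_compose2[OF cont[OF True] cont_a] a_in True by (auto simp: image_subset_iff)
    qed (simp add: F_def)
  qed
  moreover have "F ` Q \<subseteq> Q"
  proof -
    have "w l (a t) \<le> 1" if "t \<in> Q" "l < N" for t l
      using member_le_sum[of l "{..<N}" "\<lambda>l. w l (a t)"] pos[OF _ a_in] sum1[OF a_in] that by auto
    then show ?thesis
      using pos a_in by (auto simp: F_def Q_def)
  qed
  ultimately obtain t where t: "t \<in> Q" "\<forall>i<N. F t i = t i"
    using brouwer_cube_fun[of F N] unfolding Q_def by blast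
  then have tw: "t l = w l (a t)" if "l < N" for l
    using that by (simp add: F_def)
  have "(\<Sum>l<N. t l) = (\<Sum>l<N. w l (a t))"
    by (rule sum.cong) (simp_all add: tw)
  then have "a t = (\<Sum>l<N. t l *\<^sub>R v l)"
    using sum1[OF a_in[OF t(1)]] by (simp add: a_def)
  also have "\<dots> = (\<Sum>l<N. w l (a t) *\<^sub>R v l)"
    by (rule sum.cong) (simp_all add: tw)
  finally have "a t = (\<Sum>l<N. w l (a t) *\<^sub>R v l)" .
  then show ?thesis using a_in[OF t(1)] by blast
qed

section \<open>Functionals\<close>

text \<open>Hahn-Banach, with partial functionals encoded as graphs: subspaces of
  \<open>'a \<times> real\<close> on which the second component is at most the norm of the first.
  This bound alone makes a graph single-valued, since the difference of two values, with either
  sign, lies over 0; a maximal graph is total.\<close>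

lemma norming_functional:
  fixes y :: "'a::real_normed_vector"
  shows "\<exists>\<phi>::'a \<Rightarrow> real. linear \<phi> \<and> (\<forall>x. \<bar>\<phi> x\<bar> \<le> norm x) \<and> \<phi> y = norm y"
proof -
  define A where "A = {G :: ('a \<times> real) set. subspace G \<and> (y, norm y) \<in> G \<and> (\<forall>(x, r) \<in> G. r \<le> norm x)}"
  have "span {(y, norm y)} \<in> A"
  proof -
    have "t * norm y \<le> norm (t *\<^sub>R y)" for t :: real
      by (simp add: mult_right_mono)
    then have "r \<le> norm x" if "(x, r) \<in> span {(y, norm y)}" for x r
      using that unfolding span_singleton by auto
    then show ?thesis
      using span_base[of "(y, norm y)" "{(y, norm y)}"] by (auto simp: A_def subspace_span)
  qed
  then have "A \<noteq> {}" by blast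
  moreover have "\<Union>C \<in> A" if "C \<noteq> {}" "subset.chain A C" for C
  proof -
    have CA: "C \<subseteq> A" and lin: "\<And>G H. G \<in> C \<Longrightarrow> H \<in> C \<Longrightarrow> G \<subseteq> H \<or> H \<subseteq> G"
      using that(2) by (auto simp: subset.chain_def)
    have subC: "subspace G" if "G \<in> C" for G using CA that by (auto simp: A_def)
    have "subspace (\<Union>C)"
      unfolding subspace_def
    proof (intro conjI ballI allI)
      show "0 \<in> \<Union>C" using subC that(1) subspace_0 by blast
    next
      fix u v assume "u \<in> \<Union>C" "v \<in> \<Union>C"
      then obtain G H where "G \<in> C" "H \<in> C" "u \<in> G" "v \<in> H" by blast
      then obtain M where "M \<in> C" "u \<in> M" "v \<in> M" using lin by blast
      then show "u + v \<in> \<Union>C" using subC subspace_add by blast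
    next
      fix c :: real and u assume "u \<in> \<Union>C"
      then show "c *\<^sub>R u \<in> \<Union>C" using subC subspace_scale by blast
    qed
    then show ?thesis using CA that(1) by (auto simp: A_def)
  qed
  ultimately obtain G where G: "G \<in> A" and max: "\<And>H. H \<in> A \<Longrightarrow> G \<subseteq> H \<Longrightarrow> H = G"
    using subset_Zorn_nonempty[of A] by metis
  have sub: "subspace G" and yG: "(y, norm y) \<in> G" and dom: "\<And>x r. (x, r) \<in> G \<Longrightarrow> r \<le> norm x"
    using G by (auto simp: A_def)
  have add: "(x + x', r + r') \<in> G" if "(x, r) \<in> G" "(x', r') \<in> G" for x x' r r'
    using subspace_add[OF sub that] by simp
  have scale: "(t *\<^sub>R x, t * r) \<in> G" if "(x, r) \<in> G" for t x r
    using subspace_scale[OF sub that, of t] by simp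
  have uniq: "r = r'" if "(x, r) \<in> G" "(x, r') \<in> G" for x r r'
    using dom[OF add[OF that(1) scale[OF that(2), of "-1"]]]
      dom[OF add[OF that(2) scale[OF that(1), of "-1"]]] by simp
  have total: "\<exists>r. (x0, r) \<in> G" for x0
  proof -
    \<comment> \<open>By the triangle inequality every element of \<open>T\<close> is at most every
      \<open>norm (x' + x0) - r'\<close>. Any number in between, here the supremum, is a value at
      \<open>x0\<close> that keeps the extended graph below the norm.\<close>
    define T where "T = (\<lambda>(x, r). r - norm (x - x0)) ` G"
    have le: "r - norm (x - x0) \<le> norm (x' + x0) - r'" if "(x, r) \<in> G" "(x', r') \<in> G" for x r x' r'
      using dom[OF add[OF that]] norm_triangle_ineq[of "x - x0" "x' + x0"] by simp
    have T: "T \<noteq> {}" "bdd_above T"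
      using yG le[OF _ yG]
      by (auto simp: T_def bdd_above_def intro!: exI[of _ "norm (y + x0) - norm y"])
    define c where "c = Sup T"
    have c1: "r - norm (x - x0) \<le> c" if "(x, r) \<in> G" for x r
      unfolding c_def by (rule cSup_upper[OF _ T(2)]) (use that in \<open>force simp: T_def\<close>)
    have c2: "c \<le> norm (x + x0) - r" if "(x, r) \<in> G" for x r
      unfolding c_def by (rule cSup_least[OF T(1)]) (use le that in \<open>auto simp: T_def\<close>)
    have "s \<le> norm x" if xs: "(x, s) \<in> span (insert (x0, c) G)" for x s
    proof -
      obtain t where t: "(x - t *\<^sub>R x0, s - t * c) \<in> G"
        using xs span_eq_iff[THEN iffD2, OF sub] span_insert[of "(x0, c)" G] by force
      consider "t = 0" | "t > 0" | "t < 0" by linarith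
      then show ?thesis
      proof cases
        case 1
        then show ?thesis using dom[OF t] by simp
      next
        case 2
        have "c \<le> norm ((1/t) *\<^sub>R (x - t *\<^sub>R x0) + x0) - (1/t) * (s - t * c)"
          by (rule c2[OF scale[OF t]])
        also have "(1/t) *\<^sub>R (x - t *\<^sub>R x0) + x0 = (1/t) *\<^sub>R x"
          using 2 by (simp add: scaleR_diff_right)
        finally show ?thesis using 2 by (simp add: field_simps)
      next
        case 3
        have "(-1/t) * (s - t * c) - norm ((-1/t) *\<^sub>R (x - t *\<^sub>R x0) - x0) \<le> c"
          by (rule c1[OF scale[OF t]])
        also have "(-1/t) *\<^sub>R (x - t *\<^sub>R x0) - x0 = (-1/t) *\<^sub>R x"
          using 3 by (simp add: scaleR_diff_right)
        finally show ?thesis using 3 by (simp add: field_simps)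
      qed
    qed
    moreover have "G \<subseteq> span (insert (x0, c) G)"
      using span_superset[of "insert (x0, c) G"] by blast
    ultimately have "span (insert (x0, c) G) = G"
      using yG by (intro max) (auto simp: A_def)
    then show ?thesis
      using span_superset[of "insert (x0, c) G"] by blast
  qed
  define \<phi> where "\<phi> x = (THE r. (x, r) \<in> G)" for x
  have \<phi>G: "(x, \<phi> x) \<in> G" for x
    unfolding \<phi>_def using total[of x] uniq by (metis theI)
  have \<phi>: "\<phi> x = r" if "(x, r) \<in> G" for x r
    using uniq[OF \<phi>G that] .
  have "linear \<phi>"
    by (intro linearI \<phi>) (use add scale \<phi>G in auto)
  moreover have "\<bar>\<phi> x\<bar> \<le> norm x" for x
    using dom[OF \<phi>G[of x]] dom[OF scale[OF \<phi>G[of x], of "-1"]] by simp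
  ultimately show ?thesis using \<phi>[OF yG] by blast
qed

text \<open>Banach-Alaoglu: the functionals lie in a product of compact intervals, so their image
  filter clusters there. Each instance of linearity involves at most three vectors, on which some
  \<open>\<Phi> y\<close> is arbitrarily close to the limit.\<close>

lemma functionals_cluster_point:
  fixes \<Phi> :: "'c \<Rightarrow> 'b::real_normed_vector \<Rightarrow> real"
  assumes F: "F \<noteq> bot"
    and \<Phi>: "eventually (\<lambda>y. linear (\<Phi> y) \<and> (\<forall>v. \<bar>\<Phi> y v\<bar> \<le> K * norm v)) F"
  shows "\<exists>\<phi>. linear \<phi> \<and> (\<forall>v. \<bar>\<phi> v\<bar> \<le> K * norm v) \<and>
    (\<forall>Z e. finite Z \<longrightarrow> e > 0 \<longrightarrow> frequently (\<lambda>y. \<forall>v\<in>Z. \<bar>\<Phi> y v - \<phi> v\<bar> < e) F)"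
proof -
  define U where "U = PiE (UNIV::'b set) (\<lambda>v. {-(K * norm v)..K * norm v})"
  have "compactin (product_topology (\<lambda>_. euclidean) UNIV) U"
    unfolding U_def by (subst compactin_PiE) auto
  then have "compact U"
    by (simp add: euclidean_product_topology)
  moreover have "filtermap \<Phi> F \<noteq> bot"
    using F by (simp add: filtermap_bot_iff)
  moreover have "eventually (\<lambda>\<psi>. \<psi> \<in> U) (filtermap \<Phi> F)"
    unfolding eventually_filtermap using \<Phi>
    by (rule eventually_mono) (auto simp: U_def PiE_def Pi_def abs_le_iff minus_le_iff)
  ultimately obtain \<phi> where \<phi>: "\<phi> \<in> U" "inf (nhds \<phi>) (filtermap \<Phi> F) \<noteq> bot"
    unfolding compact_filter by blast
  have near: "frequently (\<lambda>y. \<forall>v\<in>Z. \<bar>\<Phi> y v - \<phi> v\<bar> < e) F" if "finite Z" "e > 0" for Z e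
  proof (rule ccontr)
    assume "\<not> ?thesis"
    then have "eventually (\<lambda>\<psi>. \<not> (\<forall>v\<in>Z. \<bar>\<psi> v - \<phi> v\<bar> < e)) (filtermap \<Phi> F)"
      by (simp add: frequently_def eventually_filtermap)
    moreover have "open {\<psi>. \<forall>v\<in>Z. \<psi> v \<in> ball (\<phi> v) e}"
      using product_topology_basis'[of Z "\<lambda>v. ball (\<phi> v) e" "\<lambda>v. v"] that(1) by simp
    then have "eventually (\<lambda>\<psi>. \<forall>v\<in>Z. \<psi> v \<in> ball (\<phi> v) e) (nhds \<phi>)"
      using that(2) by (auto simp: eventually_nhds intro!: exI[of _ "{\<psi>. \<forall>v\<in>Z. \<psi> v \<in> ball (\<phi> v) e}"])
    then have "eventually (\<lambda>\<psi>. \<forall>v\<in>Z. \<bar>\<psi> v - \<phi> v\<bar> < e) (nhds \<phi>)"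
      by (rule eventually_mono) (auto simp: dist_real_def abs_minus_commute)
    ultimately have "eventually (\<lambda>_. False) (inf (nhds \<phi>) (filtermap \<Phi> F))"
      unfolding eventually_inf by blast
    then show False using \<phi>(2) by (simp add: eventually_False)
  qed
  have near': "\<exists>\<psi>. linear \<psi> \<and> (\<forall>v\<in>Z. \<bar>\<psi> v - \<phi> v\<bar> < e)" if "finite Z" "e > 0" for Z and e :: real
    using frequently_ex[OF frequently_eventually_conj[OF near[OF that] \<Phi>]] by blast
  have "linear \<phi>"
  proof (intro linearI)
    fix u v
    have "\<bar>\<phi> (u + v) - (\<phi> u + \<phi> v)\<bar> \<le> 0 + e" if "e > 0" for e
    proof -
      obtain \<psi> where "linear \<psi>" and n: "\<forall>w\<in>{u, v, u + v}. \<bar>\<psi> w - \<phi> w\<bar> < e / 3"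
        using near'[of "{u, v, u + v}" "e / 3"] \<open>e > 0\<close> by fastforce
      then have "\<psi> (u + v) = \<psi> u + \<psi> v" by (simp add: linear_add)
      moreover have "\<bar>\<psi> u - \<phi> u\<bar> < e / 3" "\<bar>\<psi> v - \<phi> v\<bar> < e / 3" "\<bar>\<psi> (u + v) - \<phi> (u + v)\<bar> < e / 3"
        using n by auto
      ultimately show ?thesis by linarith
    qed
    then show "\<phi> (u + v) = \<phi> u + \<phi> v"
      using field_le_epsilon[of "\<bar>\<phi> (u + v) - (\<phi> u + \<phi> v)\<bar>" 0] by auto
  next
    fix c v
    have "\<bar>\<phi> (c *\<^sub>R v) - c * \<phi> v\<bar> \<le> 0 + e" if "e > 0" for e
    proof -
      define d where "d = e / (1 + \<bar>c\<bar>)"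
      have c: "1 + \<bar>c\<bar> > 0" by simp
      then have "d * (1 + \<bar>c\<bar>) = e" unfolding d_def by (intro nonzero_eq_divide_eq[THEN iffD1]) auto
      then have d: "d + \<bar>c\<bar> * d = e" "d > 0"
        using that c by (simp add: algebra_simps) (simp add: d_def that)
      obtain \<psi> where "linear \<psi>" and n: "\<forall>w\<in>{v, c *\<^sub>R v}. \<bar>\<psi> w - \<phi> w\<bar> < d"
        using near'[of "{v, c *\<^sub>R v}" d] d by auto
      then have "\<psi> (c *\<^sub>R v) = c * \<psi> v" by (simp add: linear_cmul)
      moreover have "\<bar>c * \<psi> v - c * \<phi> v\<bar> \<le> \<bar>c\<bar> * d"
        using n by (simp add: right_diff_distrib[symmetric] abs_mult mult_left_mono)
      ultimately show ?thesis using n d by auto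
    qed
    then show "\<phi> (c *\<^sub>R v) = c *\<^sub>R \<phi> v"
      using field_le_epsilon[of "\<bar>\<phi> (c *\<^sub>R v) - c * \<phi> v\<bar>" 0] by auto
  qed
  moreover have "\<bar>\<phi> v\<bar> \<le> K * norm v" for v
    using \<phi>(1) by (force simp: U_def PiE_def Pi_def abs_le_iff minus_le_iff)
  ultimately show ?thesis using near by blast
qed

section \<open>Weakly null trees as nested weak limits\<close>

text \<open>The trace of the weak neighbourhoods of 0 on the closed unit ball, where all trees take
  their values. The bound 1 on the functionals covers every other bound by scaling
  \<open>h\<close>.\<close>

definition weak0 :: "'a::real_normed_vector filter" where
  "weak0 = (INF H\<in>{H. finite H \<and> (\<forall>h\<in>H. bounded_linear h)}.
     principal {u. norm u \<le> 1 \<and> (\<forall>h\<in>H. \<bar>h u :: real\<bar> < 1)})"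

lemma eventually_weak0:
  "eventually P (weak0 :: 'a::real_normed_vector filter) \<longleftrightarrow>
    (\<exists>H. finite H \<and> (\<forall>h\<in>H. bounded_linear h) \<and>
      (\<forall>u. norm u \<le> 1 \<longrightarrow> (\<forall>h\<in>H. \<bar>h u :: real\<bar> < 1) \<longrightarrow> P u))"
proof -
  let ?A = "{H. finite H \<and> (\<forall>h\<in>H. bounded_linear (h :: 'a \<Rightarrow> real))}"
  have "eventually P weak0 \<longleftrightarrow>
      (\<exists>H\<in>?A. eventually P (principal {u. norm u \<le> 1 \<and> (\<forall>h\<in>H. \<bar>h u\<bar> < 1)}))"
    unfolding weak0_def
  proof (rule eventually_INF_base)
    show "?A \<noteq> {}" by auto
    fix G H assume "G \<in> ?A" "H \<in> ?A"
    then show "\<exists>K\<in>?A. principal {u. norm u \<le> 1 \<and> (\<forall>h\<in>K. \<bar>h u\<bar> < 1)} \<le>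
        inf (principal {u. norm u \<le> 1 \<and> (\<forall>h\<in>G. \<bar>h u\<bar> < 1)})
          (principal {u. norm u \<le> 1 \<and> (\<forall>h\<in>H. \<bar>h u\<bar> < 1)})"
      by (intro bexI[of _ "G \<union> H"]) auto
  qed
  then show ?thesis by (auto simp: eventually_principal)
qed

lemma eventually_weak0_norm: "eventually (\<lambda>u. norm u \<le> 1) weak0"
  unfolding eventually_weak0 by (intro exI[of _ "{}"]) auto

lemma eventually_weak0_functional:
  assumes "bounded_linear h" "e > 0"
  shows "eventually (\<lambda>u. \<bar>h u :: real\<bar> < e) weak0"
  unfolding eventually_weak0
proof (intro exI[of _ "{\<lambda>u. h u / e}"] conjI)
  show "\<forall>g\<in>{\<lambda>u. h u / e}. bounded_linear g"
    using bounded_linear_divide[THEN bounded_linear_compose, OF assms(1)] by simp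
qed (use assms in \<open>auto simp: abs_divide\<close>)

lemma eventually_weak0_uminus:
  assumes "eventually P weak0"
  shows "eventually (\<lambda>u. P (- u)) weak0"
proof -
  obtain H where H: "finite H" "\<forall>h\<in>H. bounded_linear h"
      "\<forall>u. norm u \<le> 1 \<longrightarrow> (\<forall>h\<in>H. \<bar>h u :: real\<bar> < 1) \<longrightarrow> P u"
    using assms unfolding eventually_weak0 by blast
  have "h (- u) = - h u" if "h \<in> H" for h u
    using linear_neg[OF bounded_linear.linear, of h u] H(2) that by simp
  then have "P (- u)" if "norm u \<le> 1" "\<forall>h\<in>H. \<bar>h u\<bar> < 1" for u
    using H(3)[THEN spec, of "- u"] that by (metis abs_minus_cancel norm_minus_cancel)
  with H(1,2) show ?thesis
    unfolding eventually_weak0 by blast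
qed

section \<open>Basic weak neighbourhoods of 0\<close>

definition weak_basic :: "('a::real_normed_vector \<Rightarrow> real) set \<Rightarrow> 'a set" where
  "weak_basic H = {u. \<forall>h\<in>H. \<bar>h u\<bar> < 1}"

lemma weak_basic_Un: "weak_basic (G \<union> H) = weak_basic G \<inter> weak_basic H"
  by (auto simp: weak_basic_def)

lemma openin_weak_basic:
  assumes "finite H" "\<forall>h\<in>H. bounded_linear h"
  shows "openin weak_topology (weak_basic H)"
proof -
  have sub: "openin weak_topology (h -` W)" if "bounded_linear h" "open W" for h :: "'a \<Rightarrow> real" and W
    unfolding weak_topology_def by (rule topology_generated_by_Basis) (use that in blast)
  show ?thesis
    using assms
  proof (induction H rule: finite_induct)
    case empty
    show ?case using sub[OF bounded_linear_zero open_UNIV] by (simp add: weak_basic_def)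
  next
    case (insert h H)
    have "weak_basic {h} = h -` {-1<..<1}"
      by (auto simp: weak_basic_def abs_less_iff)
    then show ?case
      using insert sub[of h "{-1<..<1}"] weak_basic_Un[of "{h}" H] by (simp add: openin_Int)
  qed
qed

lemma zero_in_weak_basic:
  assumes "\<forall>h\<in>H. bounded_linear h"
  shows "0 \<in> weak_basic H"
  unfolding weak_basic_def using assms linear_0[OF bounded_linear.linear] by fastforce

lemma weak_nbhd_of_0_iff:
  "weak_nbhd_of_0 (V :: 'a::real_normed_vector set) \<longleftrightarrow>
    (\<exists>H. finite H \<and> (\<forall>h\<in>H. bounded_linear h) \<and> weak_basic H \<subseteq> V)"
proof
  assume "weak_nbhd_of_0 V"
  then obtain U where U: "openin weak_topology U" "0 \<in> U" "U \<subseteq> V"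
    unfolding weak_nbhd_of_0_def by blast
  have "generate_topology_on {f -` U |(f :: 'a \<Rightarrow> real) U. bounded_linear f \<and> open U} U"
    using U(1) unfolding weak_topology_def by (rule openin_topology_generated_by)
  then have "\<exists>H. finite H \<and> (\<forall>h\<in>H. bounded_linear h) \<and> weak_basic H \<subseteq> U"
    using U(2)
  proof induction
    case (Int A B)
    then obtain G H where "finite G" "\<forall>h\<in>G. bounded_linear h" "weak_basic G \<subseteq> A"
      "finite H" "\<forall>h\<in>H. bounded_linear h" "weak_basic H \<subseteq> B"
      by blast
    then show ?case by (intro exI[of _ "G \<union> H"]) (auto simp: weak_basic_Un)
  next
    case (UN K)
    then obtain A where A: "A \<in> K" "0 \<in> A" by blast
    then obtain H where "finite H" "\<forall>h\<in>H. bounded_linear h" "weak_basic H \<subseteq> A"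
      using UN.IH[OF A] by blast
    then show ?case using A by (intro exI[of _ H]) auto
  next
    case (Basis s)
    then obtain f W where f: "s = f -` W" "bounded_linear (f :: 'a \<Rightarrow> real)" "open W" by blast
    then have "0 \<in> W"
      using Basis.prems linear_0[OF bounded_linear.linear[OF f(2)]] by simp
    then obtain e where e: "e > 0" "ball 0 e \<subseteq> W"
      using f(3) open_contains_ball by blast
    have "bounded_linear (\<lambda>u. f u / e)"
      using bounded_linear_divide[THEN bounded_linear_compose, OF f(2)] .
    moreover have "weak_basic {\<lambda>u. f u / e} \<subseteq> s"
    proof
      fix u assume "u \<in> weak_basic {\<lambda>u. f u / e}"
      then have "f u \<in> ball 0 e" using e(1) by (simp add: weak_basic_def abs_divide)
      then show "u \<in> s" using e(2) f(1) by auto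
    qed
    ultimately show ?case by (intro exI[of _ "{\<lambda>u. f u / e}"]) auto
  qed simp
  then show "\<exists>H. finite H \<and> (\<forall>h\<in>H. bounded_linear h) \<and> weak_basic H \<subseteq> V"
    using U(3) by (meson order_trans)
next
  assume "\<exists>H. finite H \<and> (\<forall>h\<in>H. bounded_linear h) \<and> weak_basic H \<subseteq> V"
  then show "weak_nbhd_of_0 V"
    unfolding weak_nbhd_of_0_def using openin_weak_basic zero_in_weak_basic by meson
qed

text \<open>The order of the quantifiers is that of a tree: the neighbourhood from which a vector is
  taken may depend on all the vectors before it.\<close>

primrec nested_eventually :: "'a filter \<Rightarrow> nat \<Rightarrow> ('a list \<Rightarrow> bool) \<Rightarrow> bool" where
  "nested_eventually F 0 P = P []"
| "nested_eventually F (Suc k) P = eventually (\<lambda>u. nested_eventually F k (\<lambda>us. P (u # us))) F"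

lemma nested_eventually_mono:
  assumes "nested_eventually F k P" "\<And>us. length us = k \<Longrightarrow> P us \<Longrightarrow> Q us"
  shows "nested_eventually F k Q"
  using assms
proof (induction k arbitrary: P Q)
  case (Suc k)
  from Suc.prems(1) have "eventually (\<lambda>u. nested_eventually F k (\<lambda>us. P (u # us))) F" by simp
  then have "eventually (\<lambda>u. nested_eventually F k (\<lambda>us. Q (u # us))) F"
    by (rule eventually_mono) (use Suc.prems(2) in \<open>auto intro: Suc.IH\<close>)
  then show ?case by simp
qed simp

lemma nested_eventually_Ball:
  assumes "finite I" "\<And>i. i \<in> I \<Longrightarrow> nested_eventually F k (P i)"
  shows "nested_eventually F k (\<lambda>us. \<forall>i\<in>I. P i us)"
  using assms(2)
proof (induction k arbitrary: P)
  case (Suc k)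
  then have "eventually (\<lambda>u. \<forall>i\<in>I. nested_eventually F k (\<lambda>us. P i (u # us))) F"
    using assms(1) by (intro eventually_ball_finite) auto
  then show ?case
    by (auto elim!: eventually_mono intro: Suc.IH)
qed simp

lemma nested_eventually_conj:
  assumes "nested_eventually F k P" "nested_eventually F k Q"
  shows "nested_eventually F k (\<lambda>us. P us \<and> Q us)"
proof -
  have "nested_eventually F k (\<lambda>us. \<forall>b\<in>UNIV. (if b then P else Q) us)"
    by (rule nested_eventually_Ball) (use assms in auto)
  then show ?thesis
    by (rule nested_eventually_mono) (metis UNIV_I)
qed

lemma nested_eventually_all_elements:
  assumes "eventually P F"
  shows "nested_eventually F k (\<lambda>us. \<forall>u\<in>set us. P u)"
proof (induction k)
  case (Suc k)
  have "eventually (\<lambda>u. nested_eventually F k (\<lambda>us. \<forall>v\<in>set (u # us). P v)) F"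
    using assms by (rule eventually_mono) (auto intro: nested_eventually_mono[OF Suc])
  then show ?case by simp
qed simp

lemma map_upt_Suc: "map f [1..<Suc (Suc k)] = f 1 # map (\<lambda>i. f (Suc i)) [1..<Suc k]"
proof -
  have "[1..<Suc (Suc k)] = 1 # map Suc [1..<Suc k]"
    by (simp only: map_Suc_upt) (simp add: upt_conv_Cons)
  then show ?thesis by (simp add: o_def)
qed

text \<open>A weakly null net of children enters every weak neighbourhood, so a branch can be chosen
  node by node: each child is taken in the neighbourhood that the quantifier of its level asks
  for.\<close>

lemma nested_eventually_imp_branch:
  fixes x :: "'a::real_normed_vector set list \<Rightarrow> 'a"
  assumes D: "weak_nbhd_basis D"
    and "nested_eventually weak0 k P"
    and "\<And>n. set n \<subseteq> D \<Longrightarrow> length n < k \<Longrightarrow> limitin weak_topology (\<lambda>m. x (n @ [m])) 0 (tails D)"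
    and "\<And>n. set n \<subseteq> D \<Longrightarrow> 1 \<le> length n \<Longrightarrow> length n \<le> k \<Longrightarrow> norm (x n) \<le> 1"
  shows "\<exists>m. length m = k \<and> set m \<subseteq> D \<and> P (map (\<lambda>i. x (take i m)) [1..<Suc k])"
  using assms(2-)
proof (induction k arbitrary: P x)
  case (Suc k)
  obtain H where H: "finite H" "\<forall>h\<in>H. bounded_linear h"
      "\<forall>u. norm u \<le> 1 \<longrightarrow> (\<forall>h\<in>H. \<bar>h u :: real\<bar> < 1) \<longrightarrow> nested_eventually weak0 k (\<lambda>us. P (u # us))"
    using Suc.prems(1) unfolding nested_eventually.simps eventually_weak0 by blast
  have "eventually (\<lambda>m. x ([] @ [m]) \<in> weak_basic H) (tails D)"
    using Suc.prems(2)[of "[]"] openin_weak_basic[OF H(1,2)] zero_in_weak_basic[OF H(2)]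
    unfolding limitin_def by auto
  then obtain V where V: "V \<in> D" "x [V] \<in> weak_basic H"
    unfolding eventually_tails[OF D] by auto
  then have "nested_eventually weak0 k (\<lambda>us. P (x [V] # us))"
    using H(3) Suc.prems(3)[of "[V]"] by (auto simp: weak_basic_def)
  moreover have "limitin weak_topology (\<lambda>m. x (V # (n @ [m]))) 0 (tails D)"
    if "set n \<subseteq> D" "length n < k" for n
    using Suc.prems(2)[of "V # n"] that V by simp
  moreover have "norm (x (V # n)) \<le> 1" if "set n \<subseteq> D" "1 \<le> length n" "length n \<le> k" for n
    using Suc.prems(3)[of "V # n"] that V by simp
  ultimately obtain m where "length m = k" "set m \<subseteq> D"
      "P (x [V] # map (\<lambda>i. x (V # take i m)) [1..<Suc k])"
    using Suc.IH[of "\<lambda>us. P (x [V] # us)" "\<lambda>n. x (V # n)"] by blast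
  then show ?case
    using V(1) by (intro exI[of _ "V # m"]) (simp only: map_upt_Suc, simp)
qed simp

text \<open>The negated quantifier is a strategy: after every prefix, each neighbourhood
  \<open>V\<close> contains a bad vector. Putting that vector at the child with index
  \<open>V\<close> will make the tree weakly null by construction, while all of its branches
  fail.\<close>

lemma not_nested_eventually_imp_tree:
  fixes D :: "'a::real_normed_vector set set"
  assumes D: "\<And>V. V \<in> D \<Longrightarrow> weak_nbhd_of_0 V"
    and "\<not> nested_eventually weak0 k P"
  shows "\<exists>x. (\<forall>n V. set n \<subseteq> D \<longrightarrow> V \<in> D \<longrightarrow> length n < k \<longrightarrow> x (n @ [V]) \<in> V \<and> norm (x (n @ [V])) \<le> 1) \<and>
    (\<forall>m. length m = k \<longrightarrow> set m \<subseteq> D \<longrightarrow> \<not> P (map (\<lambda>i. x (take i m)) [1..<Suc k]))"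
  using assms(2)
proof (induction k arbitrary: P)
  case (Suc k)
  define Q where "Q V u y \<longleftrightarrow> u \<in> V \<and> norm u \<le> 1 \<and>
      (\<forall>n W. set n \<subseteq> D \<longrightarrow> W \<in> D \<longrightarrow> length n < k \<longrightarrow> y (n @ [W]) \<in> W \<and> norm (y (n @ [W])) \<le> 1) \<and>
      (\<forall>m. length m = k \<longrightarrow> set m \<subseteq> D \<longrightarrow> \<not> P (u # map (\<lambda>i. y (take i m)) [1..<Suc k]))"
    for V u y
  have "\<exists>u y. Q V u y" if V: "V \<in> D" for V
  proof -
    obtain H where H: "finite H" "\<forall>h\<in>H. bounded_linear h" "weak_basic H \<subseteq> V"
      using D[OF V] unfolding weak_nbhd_of_0_iff by blast
    obtain u where "norm u \<le> 1" "\<forall>h\<in>H. \<bar>h u\<bar> < 1" "\<not> nested_eventually weak0 k (\<lambda>us. P (u # us))"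
      using Suc.prems H(1,2) unfolding nested_eventually.simps eventually_weak0 by blast
    moreover from this have "u \<in> V" using H(3) by (auto simp: weak_basic_def)
    ultimately show ?thesis using Suc.IH[of "\<lambda>us. P (u # us)"] unfolding Q_def by blast
  qed
  then obtain u y where "\<And>V. V \<in> D \<Longrightarrow> Q V (u V) (y V)" by metis
  then have u: "\<And>V. V \<in> D \<Longrightarrow> u V \<in> V \<and> norm (u V) \<le> 1"
    and y: "\<And>V n W. V \<in> D \<Longrightarrow> set n \<subseteq> D \<Longrightarrow> W \<in> D \<Longrightarrow> length n < k \<Longrightarrow>
        y V (n @ [W]) \<in> W \<and> norm (y V (n @ [W])) \<le> 1"
    and P: "\<And>V m. V \<in> D \<Longrightarrow> length m = k \<Longrightarrow> set m \<subseteq> D \<Longrightarrow>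
        \<not> P (u V # map (\<lambda>i. y V (take i m)) [1..<Suc k])"
    unfolding Q_def by blast+
  \<comment> \<open>The first entry of an index selects the first vector and the strategy
    \<open>y (hd n)\<close> in which the remaining entries are read.\<close>
  define x where "x n = (if tl n = [] then u (hd n) else y (hd n) (tl n))" for n
  have "x (n @ [W]) \<in> W \<and> norm (x (n @ [W])) \<le> 1" if "set n \<subseteq> D" "W \<in> D" "length n < Suc k" for n W
    using that u y by (cases n) (auto simp: x_def)
  moreover have "\<not> P (map (\<lambda>i. x (take i m)) [1..<Suc (Suc k)])" if len: "length m = Suc k" "set m \<subseteq> D" for m
  proof -
    obtain V m' where m: "m = V # m'" "length m' = k" "V \<in> D" "set m' \<subseteq> D"
      using len by (cases m) auto
    have "map (\<lambda>i. x (take i m)) [1..<Suc (Suc k)] = u V # map (\<lambda>i. y V (take i m')) [1..<Suc k]"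
      unfolding map_upt_Suc using m by (auto simp: x_def simp del: upt_Suc)
    then show ?thesis using P[OF m(3,2,4)] by simp
  qed
  ultimately show ?case by blast
qed simp

text \<open>This removes bases and trees from both properties. If the nested quantifier holds, every
  basis admits a good branch; if it fails, the basis of all weak neighbourhoods already carries a
  tree without one.\<close>

lemma weakly_null_trees_iff_nested_eventually:
  assumes "1 \<le> k"
  shows "(\<forall>(D :: 'a::real_normed_vector set set) x.
      weak_nbhd_basis D \<and> weakly_null_tree D k x \<and> x ` tuples_upto D k \<subseteq> cball 0 1 \<longrightarrow>
      (\<exists>m. length m = k \<and> set m \<subseteq> D \<and> P (map (\<lambda>i. x (take i m)) [1..<Suc k])))
    \<longleftrightarrow> nested_eventually weak0 k P" (is "?L \<longleftrightarrow> ?R")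
proof
  assume L: ?L
  show ?R
  proof (rule ccontr)
    define D where "D = {V :: 'a set. weak_nbhd_of_0 V}"
    have D: "weak_nbhd_basis D"
      by (auto simp: weak_nbhd_basis_def D_def)
    assume "\<not> ?R"
    then obtain x where x: "\<And>n V. set n \<subseteq> D \<Longrightarrow> V \<in> D \<Longrightarrow> length n < k \<Longrightarrow> x (n @ [V]) \<in> V \<and> norm (x (n @ [V])) \<le> 1"
      and P: "\<And>m. length m = k \<Longrightarrow> set m \<subseteq> D \<Longrightarrow> \<not> P (map (\<lambda>i. x (take i m)) [1..<Suc k])"
      using not_nested_eventually_imp_tree[of D k P] by (auto simp: D_def)
    have "weakly_null_tree D k x"
      unfolding weakly_null_tree_def
    proof
      fix n assume "n \<in> {[]} \<union> tuples_upto D (k - 1)"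
      then have n: "set n \<subseteq> D" "length n < k"
        using assms by (auto simp: tuples_upto_def)
      show "limitin weak_topology (\<lambda>m. x (n @ [m])) 0 (tails D)"
        unfolding limitin_def
      proof (intro conjI allI impI)
        show "0 \<in> topspace (weak_topology :: 'a topology)"
        proof -
          have "weak_nbhd_of_0 (UNIV :: 'a set)"
            unfolding weak_nbhd_of_0_iff by (intro exI[of _ "{}"]) (auto simp: weak_basic_def)
          then show ?thesis
            unfolding weak_nbhd_of_0_def using openin_subset by blast
        qed
      next
        fix U :: "'a set" assume "openin weak_topology U \<and> 0 \<in> U"
        then have "U \<in> D" by (auto simp: D_def weak_nbhd_of_0_def)
        then show "eventually (\<lambda>m. x (n @ [m]) \<in> U) (tails D)"
          unfolding eventually_tails[OF D] using x[OF n(1) _ n(2)] by blast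
      qed
    qed
    moreover have "x ` tuples_upto D k \<subseteq> cball 0 1"
    proof -
      have "norm (x n) \<le> 1" if "n \<in> tuples_upto D k" for n
        using that x[of "butlast n" "last n"]
        by (cases n rule: rev_cases) (auto simp: tuples_upto_def)
      then show ?thesis by auto
    qed
    ultimately show False using L D P by blast
  qed
next
  assume R: ?R
  show ?L
  proof (intro allI impI, elim conjE)
    fix D x assume D: "weak_nbhd_basis D" and x: "weakly_null_tree D k x" "x ` tuples_upto D k \<subseteq> (cball 0 1 :: 'a set)"
    show "\<exists>m. length m = k \<and> set m \<subseteq> D \<and> P (map (\<lambda>i. x (take i m)) [1..<Suc k])"
    proof (rule nested_eventually_imp_branch[OF D R])
      fix n assume "set n \<subseteq> D" "length n < k"
      then show "limitin weak_topology (\<lambda>m. x (n @ [m])) 0 (tails D)"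
        using x(1) unfolding weakly_null_tree_def
        by (cases "n = []") (auto simp: tuples_upto_def Suc_le_eq)
    next
      fix n assume "set n \<subseteq> D" "1 \<le> length n" "length n \<le> k"
      then have "n \<in> tuples_upto D k" by (auto simp: tuples_upto_def)
      then show "norm (x n) \<le> 1" using x(2) by auto
    qed
  qed
qed

section \<open>The two properties as nested weak limits\<close>

definition lincomb :: "real list \<Rightarrow> 'a::real_vector list \<Rightarrow> 'a" where
  "lincomb ss us = sum_list (map2 scaleR ss us)"

lemma lincomb_simps [simp]:
  "lincomb [] us = 0" "lincomb ss [] = 0" "lincomb (s # ss) (u # us) = s *\<^sub>R u + lincomb ss us"
  by (simp_all add: lincomb_def)

lemma sum_list_map_upt:
  fixes f :: "nat \<Rightarrow> 'a::comm_monoid_add"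
  shows "sum_list (map f [1..<Suc k]) = (\<Sum>i=1..k. f i)"
  by (simp add: sum_set_upt_conv_sum_list_nat[symmetric] atLeastLessThanSuc_atLeastAtMost del: upt_Suc)

lemma lincomb_map_upt:
  "lincomb (map a [1..<Suc k]) (map y [1..<Suc k]) = (\<Sum>i=1..k. a i *\<^sub>R y i)"
  unfolding sum_list_map_upt[symmetric]
  by (simp add: lincomb_def zip_map_map zip_same_conv_map o_def del: upt_Suc)

lemma property_A_iff:
  "property_A p TYPE('a::banach) \<longleftrightarrow> (\<exists>c>0. \<forall>k\<ge>1. nested_eventually weak0 k
     (\<lambda>us :: 'a list. \<forall>a. norm (lincomb (map a [1..<Suc k]) us) \<le> c * lp_norm p k a))"
proof -
  have "(\<forall>(D :: 'a set set) x. weak_nbhd_basis D \<and> weakly_null_tree D k x \<and> x ` tuples_upto D k \<subseteq> cball 0 1 \<longrightarrow>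
        (\<exists>m. length m = k \<and> set m \<subseteq> D \<and>
           (\<forall>a. norm (\<Sum>i=1..k. a i *\<^sub>R x (take i m)) \<le> c * lp_norm p k a))) \<longleftrightarrow>
      nested_eventually weak0 k (\<lambda>us :: 'a list. \<forall>a. norm (lincomb (map a [1..<Suc k]) us) \<le> c * lp_norm p k a)"
    if "1 \<le> k" for c k
    using weakly_null_trees_iff_nested_eventually[OF that, where P =
      "\<lambda>us :: 'a list. \<forall>a. norm (lincomb (map a [1..<Suc k]) us) \<le> c * lp_norm p k a"]
    unfolding lincomb_map_upt .
  then show ?thesis unfolding property_A_def by blast
qed

lemma property_N_iff:
  "property_N p TYPE('a::banach) \<longleftrightarrow> (\<exists>c>0. \<forall>k\<ge>1. nested_eventually weak0 k
     (\<lambda>us :: 'a list. norm (sum_list us) \<le> c * real k powr real_of_ereal (1 / p)))"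
proof -
  have "(\<forall>(D :: 'a set set) x. weak_nbhd_basis D \<and> weakly_null_tree D k x \<and> x ` tuples_upto D k \<subseteq> cball 0 1 \<longrightarrow>
        (\<exists>m. length m = k \<and> set m \<subseteq> D \<and>
           norm (\<Sum>i=1..k. x (take i m)) \<le> c * real k powr real_of_ereal (1 / p))) \<longleftrightarrow>
      nested_eventually weak0 k (\<lambda>us :: 'a list. norm (sum_list us) \<le> c * real k powr real_of_ereal (1 / p))"
    if "1 \<le> k" for c k
    using weakly_null_trees_iff_nested_eventually[OF that, where P =
      "\<lambda>us :: 'a list. norm (sum_list us) \<le> c * real k powr real_of_ereal (1 / p)"]
    unfolding sum_list_map_upt .
  then show ?thesis unfolding property_N_def by blast
qed

section \<open>Asymptotically smooth bodies\<close>

text \<open>The value of the game in which a step \<open>s u\<close> with \<open>u\<close> weakly small is charged \<open>w s\<close>.\<close>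

primrec game_norm :: "real set \<Rightarrow> (real \<Rightarrow> real) \<Rightarrow> nat \<Rightarrow> 'a::real_normed_vector \<Rightarrow> real" where
  "game_norm S w 0 x = norm x"
| "game_norm S w (Suc j) x = Inf {r. game_norm S w j x \<le> r \<and>
     (\<forall>s\<in>S. eventually (\<lambda>u. game_norm S w j (x + s *\<^sub>R u) \<le> r + w s) weak0)}"

lemma Inf_approx:
  fixes R :: "real set"
  assumes "R \<noteq> {}" "bdd_below R" "e > 0"
  shows "\<exists>r\<in>R. r < Inf R + e"
  using cInf_less_iff[OF assms(1,2), of "Inf R + e"] assms(3) by simp

context
  fixes S :: "real set" and w :: "real \<Rightarrow> real"
  assumes finS: "finite S" and S: "S \<subseteq> {-1..1}" and w: "\<And>s. s \<in> S \<Longrightarrow> 0 \<le> w s"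
begin

abbreviation "moves j x \<equiv> {r. game_norm S w j x \<le> r \<and>
  (\<forall>s\<in>S. eventually (\<lambda>u. game_norm S w j (x + s *\<^sub>R u) \<le> r + w s) weak0)}"

lemma bdd_below_moves: "bdd_below (moves j x)"
  by (auto simp: bdd_below_def)

text \<open>Finiteness of the game values and nonemptiness of \<open>moves\<close> depend on each
  other, so the second is first derived from the bound at the same \<open>j\<close>. A step has
  length at most 1 and a nonnegative charge, hence raises a value by at most 1.\<close>

lemma moves_nonempty_aux:
  fixes x :: "'a::real_normed_vector"
  assumes le: "\<And>x :: 'a. game_norm S w j x \<le> norm x + real j"
  shows "norm x + real (Suc j) \<in> moves j x"
proof -
  have "eventually (\<lambda>u. game_norm S w j (x + s *\<^sub>R u) \<le> norm x + real (Suc j) + w s) weak0" if s: "s \<in> S" for s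
    using eventually_weak0_norm
  proof (rule eventually_mono)
    fix u :: 'a assume u: "norm u \<le> 1"
    have "s \<in> {-1..1}" using S s by blast
    then have "\<bar>s\<bar> \<le> 1" by auto
    then have "norm (s *\<^sub>R u) \<le> 1" using u by (simp add: mult_le_one)
    then show "game_norm S w j (x + s *\<^sub>R u) \<le> norm x + real (Suc j) + w s"
      using le[of "x + s *\<^sub>R u"] norm_triangle_ineq[of x "s *\<^sub>R u"] w[OF s] by simp
  qed
  then show ?thesis using le[of x] by auto
qed

lemma game_norm_le: "game_norm S w j x \<le> norm x + real j"
proof (induction j arbitrary: x)
  case (Suc j)
  show ?case
    unfolding game_norm.simps(2) by (intro cInf_lower moves_nonempty_aux Suc bdd_below_moves)
qed simp

lemma moves_nonempty: "norm x + real (Suc j) \<in> moves j x"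
  by (rule moves_nonempty_aux[OF game_norm_le])

lemma game_norm_mono: "game_norm S w j x \<le> game_norm S w (Suc j) x"
  unfolding game_norm.simps(2) by (rule cInf_greatest) (use moves_nonempty in blast, simp)

lemma game_norm_ge: "norm x \<le> game_norm S w j x"
proof (induction j)
  case (Suc j) then show ?case using game_norm_mono order_trans by blast
qed simp

lemma moves_approx: "e > 0 \<Longrightarrow> \<exists>r\<in>moves j x. r < game_norm S w (Suc j) x + e"
  unfolding game_norm.simps(2)
  by (rule Inf_approx[OF _ bdd_below_moves]) (use moves_nonempty in blast, assumption)

lemma game_norm_step:
  assumes "s \<in> S" "e > 0"
  shows "eventually (\<lambda>u. game_norm S w j (x + s *\<^sub>R u) \<le> game_norm S w (Suc j) x + w s + e) weak0"
proof -
  obtain r where r: "r \<in> moves j x" "r < game_norm S w (Suc j) x + e"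
    using moves_approx[OF assms(2)] by blast
  then have "eventually (\<lambda>u. game_norm S w j (x + s *\<^sub>R u) \<le> r + w s) weak0"
    using assms(1) by blast
  then show ?thesis by (rule eventually_mono) (use r(2) in linarith)
qed

text \<open>Estimates of all lengths up to \<open>j\<close> enter because the game may stop early.
  After a step \<open>s *\<^sub>R u\<close> from \<open>x\<close> the same estimates hold from the
  new point, with lengths shorter by one and with \<open>B\<close> raised by the charge
  \<open>w s\<close>.\<close>

lemma game_norm_upper:
  fixes x :: "'a::real_normed_vector"
  assumes "\<And>i. i \<le> j \<Longrightarrow> nested_eventually weak0 i (\<lambda>us. \<forall>ss. length ss = i \<longrightarrow> set ss \<subseteq> S \<longrightarrow>
    norm (x + lincomb ss us) \<le> B + sum_list (map w ss))"
  shows "game_norm S w j x \<le> B"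
  using assms
proof (induction j arbitrary: x B)
  case 0
  then show ?case using 0[of 0] by simp
next
  case (Suc j)
  have "B \<in> moves j x"
  proof (intro CollectI conjI ballI)
    show "game_norm S w j x \<le> B"
      by (rule Suc.IH) (use Suc.prems in simp)
    fix s assume s: "s \<in> S"
    have "eventually (\<lambda>u. \<forall>i\<in>{..j}. nested_eventually weak0 i (\<lambda>us. \<forall>ss. length ss = Suc i \<longrightarrow> set ss \<subseteq> S \<longrightarrow>
        norm (x + lincomb ss (u # us)) \<le> B + sum_list (map w ss))) weak0"
      by (rule eventually_ball_finite) (use Suc.prems[of "Suc _"] in auto)
    then show "eventually (\<lambda>u. game_norm S w j (x + s *\<^sub>R u) \<le> B + w s) weak0"
    proof (rule eventually_mono)
      fix u assume u: "\<forall>i\<in>{..j}. nested_eventually weak0 i (\<lambda>us. \<forall>ss. length ss = Suc i \<longrightarrow> set ss \<subseteq> S \<longrightarrow>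
        norm (x + lincomb ss (u # us)) \<le> B + sum_list (map w ss))"
      show "game_norm S w j (x + s *\<^sub>R u) \<le> B + w s"
      proof (rule Suc.IH)
        fix i assume "i \<le> j"
        then have "nested_eventually weak0 i (\<lambda>us. \<forall>ss. length ss = Suc i \<longrightarrow> set ss \<subseteq> S \<longrightarrow>
            norm (x + lincomb ss (u # us)) \<le> B + sum_list (map w ss))" using u by simp
        then show "nested_eventually weak0 i (\<lambda>us. \<forall>ss. length ss = i \<longrightarrow> set ss \<subseteq> S \<longrightarrow>
            norm (x + s *\<^sub>R u + lincomb ss us) \<le> B + w s + sum_list (map w ss))"
        proof (rule nested_eventually_mono, intro allI impI)
          fix us ss assume *: "\<forall>ss. length ss = Suc i \<longrightarrow> set ss \<subseteq> S \<longrightarrow>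
            norm (x + lincomb ss (u # us)) \<le> B + sum_list (map w ss)" and "length ss = i" "set ss \<subseteq> S"
          then show "norm (x + s *\<^sub>R u + lincomb ss us) \<le> B + w s + sum_list (map w ss)"
            using *[rule_format, of "s # ss"] s by (simp add: add.assoc)
        qed
      qed
    qed
  qed
  then show ?case
    unfolding game_norm.simps by (intro cInf_lower bdd_below_moves)
qed

text \<open>One direction \<open>u\<close> serves two games at once, because two eventual conditions
  hold jointly. Hence bounds that are legal at \<open>x\<close> and at \<open>y\<close> combine to a
  legal bound at the convex combination.\<close>

lemma game_norm_convex:
  assumes "0 \<le> a" "0 \<le> b" "a + b = 1"
  shows "game_norm S w j (a *\<^sub>R x + b *\<^sub>R y) \<le> a * game_norm S w j x + b * game_norm S w j y"
proof (induction j arbitrary: x y)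
  case 0
  show ?case using norm_triangle_ineq[of "a *\<^sub>R x" "b *\<^sub>R y"] assms by simp
next
  case (Suc j)
  have moves: "a * r + b * r' \<in> moves j (a *\<^sub>R x + b *\<^sub>R y)" if r: "r \<in> moves j x" and r': "r' \<in> moves j y" for r r'
  proof (intro CollectI conjI ballI)
    have "game_norm S w j (a *\<^sub>R x + b *\<^sub>R y) \<le> a * game_norm S w j x + b * game_norm S w j y"
      by (rule Suc.IH)
    also have "\<dots> \<le> a * r + b * r'"
      using r r' assms by (intro add_mono mult_left_mono) auto
    finally show "game_norm S w j (a *\<^sub>R x + b *\<^sub>R y) \<le> a * r + b * r'" .
    fix s assume s: "s \<in> S"
    have "eventually (\<lambda>u. game_norm S w j (x + s *\<^sub>R u) \<le> r + w s) weak0"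
      "eventually (\<lambda>u. game_norm S w j (y + s *\<^sub>R u) \<le> r' + w s) weak0"
      using r r' s by auto
    then show "eventually (\<lambda>u. game_norm S w j (a *\<^sub>R x + b *\<^sub>R y + s *\<^sub>R u) \<le> a * r + b * r' + w s) weak0"
    proof eventually_elim
      case (elim u)
      have b: "b = 1 - a" using assms(3) by simp
      have "a *\<^sub>R x + b *\<^sub>R y + s *\<^sub>R u = a *\<^sub>R (x + s *\<^sub>R u) + b *\<^sub>R (y + s *\<^sub>R u)"
        unfolding b by (simp add: algebra_simps)
      then have "game_norm S w j (a *\<^sub>R x + b *\<^sub>R y + s *\<^sub>R u)
          \<le> a * game_norm S w j (x + s *\<^sub>R u) + b * game_norm S w j (y + s *\<^sub>R u)"
        using Suc.IH by simp
      also have "\<dots> \<le> a * (r + w s) + b * (r' + w s)"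
        using elim assms by (intro add_mono mult_left_mono) auto
      also have "\<dots> = a * r + b * r' + w s"
        unfolding b by (simp add: algebra_simps)
      finally show ?case .
    qed
  qed
  show ?case
  proof (rule field_le_epsilon)
    fix e :: real assume e: "e > 0"
    obtain r where r: "r \<in> moves j x" "r < game_norm S w (Suc j) x + e"
      using moves_approx[OF e] by blast
    obtain r' where r': "r' \<in> moves j y" "r' < game_norm S w (Suc j) y + e"
      using moves_approx[OF e] by blast
    have "game_norm S w (Suc j) (a *\<^sub>R x + b *\<^sub>R y) \<le> a * r + b * r'"
      unfolding game_norm.simps by (intro cInf_lower bdd_below_moves moves r(1) r'(1))
    also have "\<dots> \<le> a * (game_norm S w (Suc j) x + e) + b * (game_norm S w (Suc j) y + e)"
      using r(2) r'(2) assms by (intro add_mono mult_left_mono) auto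
    also have "\<dots> = a * game_norm S w (Suc j) x + b * game_norm S w (Suc j) y + (a + b) * e"
      by (simp add: algebra_simps)
    finally show "game_norm S w (Suc j) (a *\<^sub>R x + b *\<^sub>R y)
        \<le> a * game_norm S w (Suc j) x + b * game_norm S w (Suc j) y + e"
      using assms(3) by simp
  qed
qed

text \<open>Averaging the game values over the number of remaining steps makes the cost of one more
  step telescope.\<close>

lemma asymptotically_smooth_body:
  fixes c :: real and k :: nat
  assumes c: "c > 0" and k: "1 \<le> k"
    and upper: "\<And>j. j \<le> k \<Longrightarrow> nested_eventually weak0 j (\<lambda>us :: 'a::real_normed_vector list.
      \<forall>ss. length ss = j \<longrightarrow> set ss \<subseteq> S \<longrightarrow> norm (lincomb ss us) \<le> c + sum_list (map w ss))"
  shows "\<exists>C :: 'a set. cball 0 c \<subseteq> C \<and> C \<subseteq> cball 0 (2 * c) \<and>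
    (\<forall>v\<in>C. \<forall>s\<in>S. eventually (\<lambda>u. (1 / (1 + (w s / c + 2 / k))) *\<^sub>R (v + s *\<^sub>R u) \<in> C) weak0)"
proof -
  define G where "G x = (\<Sum>j<k. game_norm S w j x) / k" for x :: 'a
  have k0: "real k > 0" using k by simp
  have top: "game_norm S w j x \<le> norm x + c" if "j \<le> k" for j and x :: 'a
  proof (rule game_norm_upper)
    fix i assume "i \<le> j"
    with that have "i \<le> k" by simp
    show "nested_eventually weak0 i (\<lambda>us. \<forall>ss. length ss = i \<longrightarrow> set ss \<subseteq> S \<longrightarrow>
        norm (x + lincomb ss us) \<le> norm x + c + sum_list (map w ss))"
      using upper[OF \<open>i \<le> k\<close>]
      by (rule nested_eventually_mono) (metis add.assoc add_left_mono norm_triangle_le)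
  qed
  have G_le: "G x \<le> norm x + c" for x
  proof -
    have "(\<Sum>j<k. game_norm S w j x) \<le> (\<Sum>j<k. norm x + c)"
      by (intro sum_mono top) auto
    then show ?thesis using k0 by (simp add: G_def field_simps)
  qed
  have G_ge: "norm x \<le> G x" for x
  proof -
    have "(\<Sum>j<k. norm x) \<le> (\<Sum>j<k. game_norm S w j x)"
      by (intro sum_mono game_norm_ge)
    then show ?thesis using k0 by (simp add: G_def field_simps)
  qed
  have G_convex: "G (a *\<^sub>R x + b *\<^sub>R y) \<le> a * G x + b * G y" if "0 \<le> a" "0 \<le> b" "a + b = 1" for a b x y
  proof -
    have "(\<Sum>j<k. game_norm S w j (a *\<^sub>R x + b *\<^sub>R y)) \<le> (\<Sum>j<k. a * game_norm S w j x + b * game_norm S w j y)"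
      by (intro sum_mono game_norm_convex that)
    then show ?thesis
      using k0 by (simp add: G_def sum.distrib sum_distrib_left[symmetric] divide_right_mono add_divide_distrib[symmetric])
  qed
  have G_step: "eventually (\<lambda>u. G (x + s *\<^sub>R u) \<le> G x + w s + 2 * c / k) weak0" if s: "s \<in> S" for s x
  proof -
    have "c / k > 0" using c k0 by simp
    then have "eventually (\<lambda>u. \<forall>j\<in>{..<k}. game_norm S w j (x + s *\<^sub>R u) \<le> game_norm S w (Suc j) x + w s + c / k) weak0"
      by (intro eventually_ball_finite ballI game_norm_step s) auto
    then show ?thesis
    proof (rule eventually_mono)
      fix u assume u: "\<forall>j\<in>{..<k}. game_norm S w j (x + s *\<^sub>R u) \<le> game_norm S w (Suc j) x + w s + c / k"
      have "(\<Sum>j<k. game_norm S w j (x + s *\<^sub>R u)) \<le> (\<Sum>j<k. game_norm S w (Suc j) x + (w s + c / k))"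
        by (intro sum_mono) (use u in \<open>auto simp: add.assoc\<close>)
      also have "\<dots> = (\<Sum>j<k. game_norm S w (Suc j) x) + real k * (w s + c / k)"
        by (simp add: sum.distrib)
      \<comment> \<open>The shift of the index leaves the boundary terms
        \<open>game_norm S w k x - norm x\<close>, at most \<open>c\<close> and so at most c / k in
        the mean. The other c / k is the tolerance granted to \<open>game_norm_step\<close>.\<close>
      also have "(\<Sum>j<k. game_norm S w (Suc j) x) = (\<Sum>j<k. game_norm S w j x) + game_norm S w k x - norm x"
        using sum.lessThan_Suc_shift[of "\<lambda>j. game_norm S w j x" k] by simp
      also have "\<dots> \<le> (\<Sum>j<k. game_norm S w j x) + c"
        using top[of k x] by simp
      finally have "(\<Sum>j<k. game_norm S w j (x + s *\<^sub>R u)) \<le> (\<Sum>j<k. game_norm S w j x) + c + real k * (w s + c / k)"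
        by simp
      then have "G (x + s *\<^sub>R u) \<le> ((\<Sum>j<k. game_norm S w j x) + c + real k * (w s + c / k)) / k"
        unfolding G_def using k0 by (intro divide_right_mono) auto
      also have "\<dots> = G x + w s + 2 * c / k"
        using k0 by (simp add: G_def add_divide_distrib)
      finally show "G (x + s *\<^sub>R u) \<le> G x + w s + 2 * c / k" .
    qed
  qed
  define C where "C = {v. G v \<le> 2 * c}"
  show ?thesis
  proof (intro exI[of _ C] conjI ballI)
    have "G x \<le> 2 * c" if "norm x \<le> c" for x
      using G_le[of x] that by linarith
    then show "cball 0 c \<subseteq> C" by (auto simp: C_def)
    have "norm x \<le> 2 * c" if "G x \<le> 2 * c" for x
      using G_ge[of x] that by linarith
    then show "C \<subseteq> cball 0 (2 * c)" by (auto simp: C_def)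
    fix v s assume v: "v \<in> C" and s: "s \<in> S"
    define d where "d = w s / c + 2 / k"
    have d: "d \<ge> 0" "c * d = w s + 2 * c / k"
      using c w[OF s] k0 by (auto simp: d_def field_simps)
    from G_step[OF s, of v] show "eventually (\<lambda>u. (1 / (1 + (w s / c + 2 / k))) *\<^sub>R (v + s *\<^sub>R u) \<in> C) weak0"
    proof (rule eventually_mono)
      fix u assume "G (v + s *\<^sub>R u) \<le> G v + w s + 2 * c / k"
      then have u: "G (v + s *\<^sub>R u) \<le> 2 * c + c * d" using v d(2) by (simp add: C_def)
      \<comment> \<open>\<open>C\<close> is the level set at 2 c, whereas \<open>G 0\<close> is at
        most c. Mixing with 0 exploits this room and turns the additive increase c d into the factor
        1 + d.\<close>
      have "G ((1 / (1 + d)) *\<^sub>R (v + s *\<^sub>R u) + (d / (1 + d)) *\<^sub>R 0)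
          \<le> (1 / (1 + d)) * G (v + s *\<^sub>R u) + (d / (1 + d)) * G 0"
        by (rule G_convex) (use d(1) in \<open>auto simp: add_divide_distrib[symmetric]\<close>)
      also have "\<dots> \<le> (1 / (1 + d)) * (2 * c + c * d) + (d / (1 + d)) * c"
        using u d(1) G_le[of 0] by (intro add_mono mult_left_mono) auto
      also have "\<dots> = (1 + d) * (2 * c) / (1 + d)"
        by (simp add: add_divide_distrib[symmetric] algebra_simps)
      also have "\<dots> = 2 * c" using d(1) by (intro nonzero_mult_div_cancel_left) linarith
      finally show "(1 / (1 + (w s / c + 2 / k))) *\<^sub>R (v + s *\<^sub>R u) \<in> C"
        by (simp add: C_def d_def)
    qed
  qed
qed

end

section \<open>The Gorelik principle\<close>

lemma weighted_mean_close:
  fixes x :: "'i \<Rightarrow> 'a::real_normed_vector"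
  assumes "finite I" "\<And>i. i \<in> I \<Longrightarrow> 0 \<le> w i" "(\<Sum>i\<in>I. w i) = 1"
    and "\<And>i. i \<in> I \<Longrightarrow> w i \<noteq> 0 \<Longrightarrow> norm (x i - z) \<le> r"
  shows "norm ((\<Sum>i\<in>I. w i *\<^sub>R x i) - z) \<le> r"
proof -
  have "(\<Sum>i\<in>I. w i *\<^sub>R x i) - z = (\<Sum>i\<in>I. w i *\<^sub>R (x i - z))"
    by (simp add: scaleR_diff_right sum_subtractf scaleR_sum_left[symmetric] assms(3))
  also have "norm \<dots> \<le> (\<Sum>i\<in>I. w i * r)"
  proof (rule sum_norm_le)
    fix i assume i: "i \<in> I"
    show "norm (w i *\<^sub>R (x i - z)) \<le> w i * r"
      using assms(2)[OF i] assms(4)[OF i] by (cases "w i = 0") (auto intro: mult_left_mono)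
  qed
  finally show ?thesis using assms(3) by (simp add: sum_distrib_right[symmetric])
qed

text \<open>Pigeonhole: the integer parts of \<open>h z / e\<close> for \<open>h \<in> H\<close>
  take only finitely many values on the ball, and points with equal integer parts cannot be told
  apart up to \<open>e\<close>. This reduces the ball to finitely many points before Brouwer's
  theorem is applied.\<close>

lemma bounded_functionals_net:
  fixes H :: "('a::real_normed_vector \<Rightarrow> real) set"
  assumes "finite H" "\<forall>h\<in>H. bounded_linear h" "e > 0"
  shows "\<exists>Z. finite Z \<and> Z \<subseteq> cball 0 r \<and> (\<forall>z\<in>cball 0 r. \<exists>v\<in>Z. \<forall>h\<in>H. \<bar>h z - h v\<bar> < e)"
proof -
  define \<kappa> where "\<kappa> z = (\<lambda>h\<in>H. \<lfloor>h z / e\<rfloor>)" for z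
  have "\<exists>B. \<forall>h\<in>H. \<forall>z\<in>cball 0 r. \<lfloor>h z / e\<rfloor> \<in> {-B..B}"
  proof -
    have "\<forall>h\<in>H. \<exists>B. \<forall>z\<in>cball 0 r. \<bar>h z / e\<bar> \<le> B"
    proof
      fix h assume "h \<in> H"
      then obtain K where K: "K \<ge> 0" "\<And>z. \<bar>h z\<bar> \<le> norm z * K"
        using bounded_linear.nonneg_bounded assms(2) by (metis real_norm_def)
      have "\<bar>h z / e\<bar> \<le> r * K / e" if "z \<in> cball 0 r" for z
        using K(2)[of z] mult_right_mono[of "norm z" r K] that K(1) assms(3) by (simp add: divide_right_mono)
      then show "\<exists>B. \<forall>z\<in>cball 0 r. \<bar>h z / e\<bar> \<le> B" by blast
    qed
    then obtain B where B: "\<And>h z. h \<in> H \<Longrightarrow> z \<in> cball 0 r \<Longrightarrow> \<bar>h z / e\<bar> \<le> B h"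
      by metis
    define M where "M = (\<Sum>h\<in>H. \<bar>B h\<bar>)"
    have "\<lfloor>h z / e\<rfloor> \<in> {- \<lceil>M\<rceil>..\<lceil>M\<rceil>}" if "h \<in> H" "z \<in> cball 0 r" for h z
    proof -
      have "\<bar>B h\<bar> \<le> M" unfolding M_def using assms(1) that(1) by (intro member_le_sum) auto
      then have "\<bar>h z / e\<bar> \<le> M" using B[OF that] by linarith
      then have "- M \<le> h z / e" "h z / e \<le> M" by linarith+
      then have "- real_of_int \<lceil>M\<rceil> \<le> h z / e" "h z / e < real_of_int \<lceil>M\<rceil> + 1"
        using le_of_int_ceiling[of M] by linarith+
      then show ?thesis by (simp add: floor_le_iff le_floor_iff)
    qed
    then show ?thesis by blast
  qed
  then obtain B where "\<And>h z. h \<in> H \<Longrightarrow> z \<in> cball 0 r \<Longrightarrow> \<lfloor>h z / e\<rfloor> \<in> {-B..B}" by blast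
  then have "\<kappa> ` cball 0 r \<subseteq> PiE H (\<lambda>_. {-B..B})"
    by (auto simp: \<kappa>_def)
  then have "finite (\<kappa> ` cball 0 r)"
    using finite_PiE[OF assms(1)] by (rule finite_subset) auto
  then obtain Z where Z: "Z \<subseteq> cball 0 r" "finite Z" "\<kappa> ` cball 0 r = \<kappa> ` Z"
    using finite_subset_image[of "\<kappa> ` cball 0 r" \<kappa> "cball 0 r"] by auto
  have "\<exists>v\<in>Z. \<forall>h\<in>H. \<bar>h z - h v\<bar> < e" if "z \<in> cball 0 r" for z
  proof -
    obtain v where v: "v \<in> Z" "\<kappa> z = \<kappa> v" using Z(3) \<open>z \<in> cball 0 r\<close> by blast
    have "\<bar>h z - h v\<bar> < e" if "h \<in> H" for h
    proof -
      have "\<lfloor>h z / e\<rfloor> = \<lfloor>h v / e\<rfloor>" using fun_cong[OF v(2), of h] that by (simp add: \<kappa>_def)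
      then have "\<bar>h z / e - h v / e\<bar> < 1" by linarith
      then show ?thesis using assms(3) by (simp add: diff_divide_distrib[symmetric] abs_divide)
    qed
    then show ?thesis using v(1) by blast
  qed
  then show ?thesis using Z by blast
qed

text \<open>The points \<open>g (f (m + a) + y) - m\<close> are at distance at most \<open>b / 2\<close>
  from \<open>a\<close>, so by Brouwer some of them, or rather a small mean of them, is almost annihilated by
  finitely many functionals. As \<open>f\<close> and \<open>g\<close> need not be continuous, their displacement is first averaged
  over a net of mesh 1.\<close>

lemma gorelik_principle:
  fixes f :: "'a::real_normed_vector \<Rightarrow> 'b::real_normed_vector" and g :: "'b \<Rightarrow> 'a"
  assumes L: "0 \<le> L"
    and f: "\<And>x x'. norm (f x - f x') \<le> L * norm (x - x') + L"
    and g: "\<And>y y'. norm (g y - g y') \<le> L * norm (y - y') + L"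
    and b: "0 \<le> b"
    and H: "finite H" "\<forall>h\<in>H. bounded_linear (h :: 'a \<Rightarrow> real)"
    and disp: "\<And>a y. norm a \<le> b / 2 \<Longrightarrow> norm y \<le> \<rho> \<Longrightarrow> norm (g (f (m + a) + y) - (m + a)) \<le> b / 2"
  shows "\<exists>K. finite K \<and> (\<forall>y. norm y \<le> \<rho> \<longrightarrow>
    (\<exists>u a. norm u \<le> b \<and> (\<forall>h\<in>H. \<bar>h u\<bar> < 1) \<and> norm a \<le> b / 2 \<and> f (m + a) \<in> K \<and>
      norm (u - (g (f (m + a) + y) - m)) \<le> 3 * L\<^sup>2 + L + 3))"
proof -
  obtain Z where Z: "finite Z" "Z \<subseteq> cball 0 (b / 2)"
      "\<And>z. z \<in> cball 0 (b / 2) \<Longrightarrow> \<exists>v\<in>Z. \<forall>h\<in>H. \<bar>h z - h v\<bar> < 1 / 2"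
    using bounded_functionals_net[OF H, of "1 / 2" "b / 2"] by auto
  \<comment> \<open>A finite-dimensional compact convex set that still sees every possible
    displacement: up to 1 / 2, the functionals in \<open>H\<close> do not distinguish a point of the
    ball of radius b / 2 from some point of \<open>Z\<close>.\<close>
  define A where "A = convex hull (insert 0 Z)"
  have "convex A" "0 \<in> A" "Z \<subseteq> A"
    unfolding A_def using hull_subset[of "insert 0 Z" convex] by auto
  have "compact A"
    unfolding A_def using Z(1) by (intro finite_imp_compact_convex_hull) simp
  have "A \<subseteq> cball 0 (b / 2)"
    unfolding A_def using Z(2) b by (intro hull_minimal convex_cball) auto
  then have A_le: "norm a \<le> b / 2" if "a \<in> A" for a
    using that by auto
  obtain P where P: "finite P" "P \<subseteq> A" "A \<subseteq> (\<Union>p\<in>P. ball p 1)"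
    using compactE_image[OF \<open>compact A\<close>, of A "\<lambda>p. ball p 1"] by (metis (no_types, lifting) UN_I centre_in_ball open_ball subsetI zero_less_one)
  obtain v N where v: "Z = v ` {..<(N::nat)}"
    using Z(1) finite_imp_nat_seg_image_inj_on[of Z] by (metis lessThan_def)
  \<comment> \<open>A partition of unity subordinate to the unit balls around the net
    \<open>P\<close>. As \<open>P\<close> is chosen before \<open>y\<close>, the finite set of
    values \<open>f (m + p)\<close> is the same for all \<open>y\<close>.\<close>
  define \<mu> where "\<mu> p a = max 0 (1 - norm (a - p)) / (\<Sum>q\<in>P. max 0 (1 - norm (a - q)))" for p a
  have denom: "(\<Sum>q\<in>P. max 0 (1 - norm (a - q))) > 0" if "a \<in> A" for a
  proof -
    obtain p where "p \<in> P" "norm (a - p) < 1"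
      using P(3) \<open>a \<in> A\<close> by (auto simp: dist_norm norm_minus_commute)
    then show ?thesis by (intro sum_pos2[of _ p] P(1)) auto
  qed
  have \<mu>0: "0 \<le> \<mu> p a" for p a
    by (simp add: \<mu>_def sum_nonneg)
  have \<mu>1: "(\<Sum>p\<in>P. \<mu> p a) = 1" if "a \<in> A" for a
    using denom[OF that] by (simp add: \<mu>_def sum_divide_distrib[symmetric])
  have \<mu>_near: "norm (a - p) \<le> 1" if "\<mu> p a \<noteq> 0" for p a
    using that by (auto simp: \<mu>_def max_def split: if_splits)
  have "\<exists>u a. norm u \<le> b \<and> (\<forall>h\<in>H. \<bar>h u\<bar> < 1) \<and> norm a \<le> b / 2 \<and> f (m + a) \<in> (\<lambda>p. f (m + p)) ` P \<and>
      norm (u - (g (f (m + a) + y) - m)) \<le> 3 * L\<^sup>2 + L + 3" if y: "norm y \<le> \<rho>" for y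
  proof -
    define \<phi> where "\<phi> a = g (f (m + a) + y) - m" for a
    \<comment> \<open>The continuous substitute for the displacement \<open>a - \<phi> a\<close>.
      Below, \<open>a\<close> will be a mean of those points of \<open>Z\<close> that look like
      \<open>d a\<close> to the functionals in \<open>H\<close>; then \<open>u = a - d a\<close> is
      almost annihilated by \<open>H\<close>.\<close>
    define d where "d a = (\<Sum>p\<in>P. \<mu> p a *\<^sub>R (p - \<phi> p))" for a
    have d_le: "norm (d a) \<le> b / 2" if "a \<in> A" for a
    proof -
      have "norm (p - \<phi> p) \<le> b / 2" if "p \<in> P" for p
        using disp[OF A_le y, of p] P(2) that norm_minus_commute[of p "\<phi> p"]
        by (auto simp: \<phi>_def algebra_simps)
      then show ?thesis
        using weighted_mean_close[of P "\<lambda>p. \<mu> p a" "\<lambda>p. p - \<phi> p" 0 "b / 2"] P(1) \<mu>0 \<mu>1[OF that]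
        by (simp add: d_def)
    qed
    have cont_d: "continuous_on A d"
      unfolding d_def \<mu>_def by (intro continuous_intros) (use denom in force)
    define \<nu> where "\<nu> l a = (\<Prod>h\<in>H. max 0 (1 / 2 - \<bar>h (d a) - h (v l)\<bar>))" for l a
    define w where "w l a = \<nu> l a / (\<Sum>l<N. \<nu> l a)" for l a
    have \<nu>0: "0 \<le> \<nu> l a" for l a
      unfolding \<nu>_def by (intro prod_nonneg) auto
    have \<nu>_sum: "(\<Sum>l<N. \<nu> l a) > 0" if aA: "a \<in> A" for a
    proof -
      obtain l where l: "l < N" "\<forall>h\<in>H. \<bar>h (d a) - h (v l)\<bar> < 1 / 2"
        using Z(3)[of "d a"] d_le[OF aA] v by auto
      then have "\<nu> l a > 0" unfolding \<nu>_def by (intro prod_pos) auto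
      then show ?thesis using l(1) \<nu>0 by (intro sum_pos2[of _ l]) auto
    qed
    have cont_h: "continuous_on A (\<lambda>a. h (d a))" if "h \<in> H" for h
      using bounded_linear.continuous_on[OF _ cont_d] H(2) that by blast
    have "\<exists>a\<in>A. a = (\<Sum>l<N. w l a *\<^sub>R v l)"
    proof (rule convex_weights_fixed_point[OF \<open>convex A\<close> \<open>0 \<in> A\<close>])
      show "v l \<in> A" if "l < N" for l using v that \<open>Z \<subseteq> A\<close> by auto
      show "continuous_on A (w l)" for l
        unfolding w_def[abs_def] \<nu>_def[abs_def]
        by (intro continuous_intros continuous_on_prod cont_h) (use \<nu>_sum in \<open>force simp: \<nu>_def\<close>)+
      show "0 \<le> w l a" for l a by (simp add: w_def \<nu>0 sum_nonneg)
      show "(\<Sum>l<N. w l a) = 1" if "a \<in> A" for a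
        using \<nu>_sum[OF that] by (simp add: w_def sum_divide_distrib[symmetric])
    qed
    then obtain a where a: "a \<in> A" "a = (\<Sum>l<N. w l a *\<^sub>R v l)" by blast
    have w1: "(\<Sum>l<N. w l a) = 1"
      using \<nu>_sum[OF a(1)] by (simp add: w_def sum_divide_distrib[symmetric])
    define u where "u = a - d a"
    have "norm u \<le> b"
      using norm_triangle_ineq4[of a "d a"] A_le[OF a(1)] d_le[OF a(1)] by (simp add: u_def)
    moreover have "\<bar>h u\<bar> < 1" if h: "h \<in> H" for h
    proof -
      have "bounded_linear h" using H(2) h by blast
      then interpret bounded_linear h .
      have "h a = (\<Sum>l<N. w l a *\<^sub>R h (v l))"
        by (subst a(2)) (simp add: sum scaleR)
      moreover have "norm ((\<Sum>l<N. w l a *\<^sub>R h (v l)) - h (d a)) \<le> 1 / 2"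
      proof (rule weighted_mean_close)
        fix l assume "w l a \<noteq> 0"
        then have "max 0 (1 / 2 - \<bar>h (d a) - h (v l)\<bar>) \<noteq> 0"
          using h H(1) by (auto simp: w_def \<nu>_def)
        then show "norm (h (v l) - h (d a)) \<le> 1 / 2"
          by (auto simp: max_def abs_minus_commute split: if_splits)
      qed (use w1 \<nu>0 in \<open>auto simp: w_def sum_nonneg\<close>)
      ultimately show ?thesis by (simp add: u_def diff)
    qed
    moreover
    have "\<not> (\<forall>p\<in>P. \<mu> p a = 0)"
    proof
      assume "\<forall>p\<in>P. \<mu> p a = 0"
      then have "(\<Sum>p\<in>P. \<mu> p a) = 0" by simp
      then show False using \<mu>1[OF a(1)] by simp
    qed
    then obtain p where p: "p \<in> P" "\<mu> p a \<noteq> 0" by blast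
    \<comment> \<open>Any net point of positive weight at \<open>a\<close> can be the witness. Two
      such points are at distance at most 2, so \<open>\<phi>\<close> differs between them by at
      most L (2 L + L) + L and the displacement by at most 2 more; \<open>a - p\<close> adds the
      last 1.\<close>
    have "norm (u - \<phi> p) \<le> 3 * L\<^sup>2 + L + 3"
    proof -
      have near: "norm ((p - \<phi> p) - (q - \<phi> q)) \<le> 3 * L\<^sup>2 + L + 2" if "q \<in> P" "\<mu> q a \<noteq> 0" for q
      proof -
        have pq: "norm (p - q) \<le> 2"
          using norm_triangle_ineq4[of "a - q" "a - p"] \<mu>_near[OF p(2)] \<mu>_near[OF that(2)] by simp
        have "norm (\<phi> p - \<phi> q) \<le> L * norm (f (m + p) - f (m + q)) + L"
          using g[of "f (m + p) + y" "f (m + q) + y"] by (simp add: \<phi>_def)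
        also have "norm (f (m + p) - f (m + q)) \<le> L * 2 + L"
          using f[of "m + p" "m + q"] mult_left_mono[OF pq L] by simp
        finally have "norm (\<phi> p - \<phi> q) \<le> L * (L * 2 + L) + L" using L by (simp add: mult_left_mono)
        moreover have "L * (L * 2 + L) = 3 * L\<^sup>2" by (simp add: power2_eq_square algebra_simps)
        ultimately show ?thesis
          using norm_triangle_ineq4[of "p - q" "\<phi> p - \<phi> q"] pq by (simp add: algebra_simps)
      qed
      have "norm (d a - (p - \<phi> p)) \<le> 3 * L\<^sup>2 + L + 2"
        unfolding d_def using near P(1) \<mu>0 \<mu>1[OF a(1)]
        by (intro weighted_mean_close) (auto simp: norm_minus_commute)
      moreover have eq: "u - \<phi> p = (a - p) - (d a - (p - \<phi> p))" by (simp add: u_def)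
      have "norm (u - \<phi> p) \<le> norm (a - p) + norm (d a - (p - \<phi> p))"
        unfolding eq by (rule norm_triangle_ineq4)
      ultimately show ?thesis using \<mu>_near[OF p(2)] by linarith
    qed
    moreover have "norm p \<le> b / 2" using A_le p(1) P(2) by blast
    ultimately show ?thesis
      using p(1) unfolding \<phi>_def by blast
  qed
  then show ?thesis using P(1) by (meson finite_imageI)
qed

section \<open>Slopes of functionals along a coarse Lipschitz map\<close>

definition bounded_functional :: "real \<Rightarrow> ('b::real_normed_vector \<Rightarrow> real) \<Rightarrow> bool" where
  "bounded_functional B \<phi> \<longleftrightarrow> linear \<phi> \<and> (\<forall>v. \<bar>\<phi> v\<bar> \<le> B * norm v)"

lemma bounded_functional_bounded_linear:
  assumes "bounded_functional B \<phi>" shows "bounded_linear \<phi>"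
  using assms unfolding bounded_functional_def
  by (intro bounded_linear.intro bounded_linear_axioms.intro) (auto simp: mult.commute intro!: exI[of _ B])

locale coarse_inverses =
  fixes f :: "'a::real_normed_vector \<Rightarrow> 'b::real_normed_vector" and g :: "'b \<Rightarrow> 'a" and L :: real
  assumes L: "1 \<le> L"
    and f_lip: "\<And>x x'. norm (f x - f x') \<le> L * norm (x - x') + L"
    and g_lip: "\<And>y y'. norm (g y - g y') \<le> L * norm (y - y') + L"
    and gf: "\<And>e. 0 < e \<Longrightarrow> \<exists>R\<ge>0. \<forall>x. norm (g (f x) - x) \<le> e * norm x + R"
    and fg: "\<And>e. 0 < e \<Longrightarrow> \<exists>R\<ge>0. \<forall>y. norm (f (g y) - y) \<le> e * norm y + R"
begin

text \<open>What \<open>f\<close> can make of the error 3 L^2 + L + 3 in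
  \<open>gorelik_principle\<close>.\<close>

definition mesh_error :: real where "mesh_error = L * (3 * L\<^sup>2 + L + 3) + L"

text \<open>The displacement hypothesis of \<open>gorelik_principle\<close> around \<open>m\<close>,
  with \<open>b = \<bar>s\<bar> * D / 2\<close> and radius
  \<open>\<bar>s\<bar> * D / (16 * L)\<close>, together with an error of at most
  \<open>e * D\<close> once its points are mapped back by \<open>f\<close>; all this uniformly in
  the scales \<open>D\<close> that are large against \<open>r\<close> and against
  \<open>\<eta> * norm m\<close>.\<close>

definition admissible_scale :: "real \<Rightarrow> real \<Rightarrow> real \<Rightarrow> real \<Rightarrow> bool" where
  "admissible_scale \<eta> r e s \<longleftrightarrow> (\<forall>D m a y. r \<le> D \<longrightarrow> \<eta> * norm m \<le> D \<longrightarrow>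
     norm a \<le> \<bar>s\<bar> * D / 4 \<longrightarrow> norm y \<le> \<bar>s\<bar> * D / (16 * L) \<longrightarrow>
     norm (g (f (m + a) + y) - (m + a)) \<le> \<bar>s\<bar> * D / 4 \<and>
     mesh_error + norm (f (g (f (m + a) + y)) - (f (m + a) + y)) \<le> e * D)"

text \<open>The displacement has three sources, each at most \<bar>s\<bar> D / 16: the shift
  \<open>y\<close>, stretched by \<open>g\<close> up to the factor L (hence 16 L), the sublinear
  error of \<open>g (f x)\<close>, and the additive constants. The threshold \<open>r\<close>
  depends on the lower bound \<sigma> for \<bar>s\<bar>; a finite set of nonzero coefficients has
  one.\<close>

lemma admissible_scale_exists:
  assumes \<eta>: "0 < \<eta>" and e: "0 < e" and \<sigma>: "0 < \<sigma>"
  shows "\<exists>r\<ge>1. \<forall>s. \<sigma> \<le> \<bar>s\<bar> \<longrightarrow> \<bar>s\<bar> \<le> 1 \<longrightarrow> admissible_scale \<eta> r e s"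
proof -
  \<comment> \<open>\<open>q * D\<close> will bound the norm of \<open>m + a\<close>, and
    \<open>p * D\<close> that of \<open>f (m + a) + y\<close> up to a constant; the relative
    precisions \<open>e1\<close> and \<open>e2\<close> are chosen against these two.\<close>
  define q where "q = 1 / \<eta> + 1"
  have q: "q > 0" using \<eta> by (simp add: q_def add_pos_pos)
  define e1 where "e1 = \<sigma> / (16 * q)"
  define p where "p = L * q + 1"
  define e2 where "e2 = e / (2 * p)"
  have p: "p > 0" using L q by (simp add: p_def add_pos_pos)
  have e12: "e1 > 0" "e2 > 0" using \<sigma> e q p by (auto simp: e1_def e2_def)
  obtain R1 where R1: "R1 \<ge> 0" "\<And>x. norm (g (f x) - x) \<le> e1 * norm x + R1" using gf[OF e12(1)] by blast
  obtain R2 where R2: "R2 \<ge> 0" "\<And>y. norm (f (g y) - y) \<le> e2 * norm y + R2" using fg[OF e12(2)] by blast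
  define c2 where "c2 = mesh_error + R2 + e2 * (norm (f 0) + L)"
  have me: "mesh_error \<ge> 0" using L by (simp add: mesh_error_def)
  have c2: "c2 \<ge> 0" using me R2(1) e12 L by (simp add: c2_def)
  define r where "r = 1 + 16 * (L + R1) / \<sigma> + 2 * c2 / e"
  have r1: "r \<ge> 1" using L R1(1) \<sigma> c2 e by (simp add: r_def)
  have ra: "L + R1 \<le> \<sigma> * r / 16"
  proof -
    have "16 * (L + R1) / \<sigma> \<le> r" using c2 e by (simp add: r_def)
    then show ?thesis using \<sigma> by (simp add: field_simps)
  qed
  have rb: "c2 \<le> e * r / 2"
  proof -
    have "2 * c2 / e \<le> r" using L R1(1) \<sigma> by (simp add: r_def)
    then show ?thesis using e by (simp add: field_simps)
  qed
  have "admissible_scale \<eta> r e s" if s: "\<sigma> \<le> \<bar>s\<bar>" "\<bar>s\<bar> \<le> 1" for s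
    unfolding admissible_scale_def
  proof (intro allI impI)
    fix D :: real and m a :: 'a and y :: 'b
    assume D: "r \<le> D" and m: "\<eta> * norm m \<le> D" and a: "norm a \<le> \<bar>s\<bar> * D / 4"
      and y: "norm y \<le> \<bar>s\<bar> * D / (16 * L)"
    have D0: "D > 0" using r1 D by linarith
    have sD: "\<bar>s\<bar> * D \<le> D" using s(2) D0 by simp
    have \<sigma>D: "\<sigma> * D \<le> \<bar>s\<bar> * D" using s(1) D0 by simp
    have "norm m \<le> D / \<eta>" using m \<eta> by (simp add: field_simps)
    moreover have "norm a \<le> D" using a sD D0 by linarith
    moreover have "q * D = D / \<eta> + D" by (simp add: q_def algebra_simps)
    ultimately have ma: "norm (m + a) \<le> q * D"
      using norm_triangle_ineq[of m a] by linarith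
    have Ly: "L * norm y \<le> \<bar>s\<bar> * D / 16"
      using mult_left_mono[OF y, of L] L by simp
    have yD: "norm y \<le> D"
    proof -
      have "norm y \<le> L * norm y" using mult_right_mono[OF L norm_ge_zero[of y]] by simp
      then show ?thesis using Ly sD D0 by linarith
    qed
    have "norm (g (f (m + a) + y) - (m + a)) \<le> norm (g (f (m + a) + y) - g (f (m + a))) + norm (g (f (m + a)) - (m + a))"
      using dist_triangle[of "g (f (m + a) + y)" "m + a" "g (f (m + a))"] unfolding dist_norm .
    also have "\<dots> \<le> (L * norm y + L) + (e1 * norm (m + a) + R1)"
      using g_lip[of "f (m + a) + y" "f (m + a)"] R1(2)[of "m + a"] by (intro add_mono) auto
    also have "e1 * norm (m + a) \<le> \<sigma> * D / 16"
      using mult_left_mono[OF ma, of e1] e12 q by (simp add: e1_def)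
    also have "(L * norm y + L) + (\<sigma> * D / 16 + R1) \<le> \<bar>s\<bar> * D / 4"
      using Ly ra \<sigma>D mult_left_mono[OF D less_imp_le[OF \<sigma>]] mult_pos_pos[OF \<sigma> D0] by linarith
    finally have 1: "norm (g (f (m + a) + y) - (m + a)) \<le> \<bar>s\<bar> * D / 4" by simp
    have "norm (f (m + a)) \<le> norm (f 0) + (L * norm (m + a) + L)"
      using f_lip[of "m + a" 0] norm_triangle_ineq2[of "f (m + a)" "f 0"] by simp
    moreover have "L * norm (m + a) \<le> L * q * D"
      using mult_left_mono[OF ma, of L] L by simp
    ultimately have "norm (f (m + a) + y) \<le> norm (f 0) + L + p * D"
      using norm_triangle_ineq[of "f (m + a)" y] yD by (simp add: p_def algebra_simps)
    then have "e2 * norm (f (m + a) + y) \<le> e2 * (norm (f 0) + L + p * D)"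
      using e12 by (intro mult_left_mono) auto
    also have "\<dots> = e2 * (norm (f 0) + L) + e * D / 2"
      using p by (simp add: e2_def distrib_left)
    finally have "mesh_error + norm (f (g (f (m + a) + y)) - (f (m + a) + y)) \<le> c2 + e * D / 2"
      using R2(2)[of "f (m + a) + y"] by (simp add: c2_def)
    also have "\<dots> \<le> e * D"
      using rb mult_left_mono[OF D less_imp_le[OF e]] by linarith
    finally show "norm (g (f (m + a) + y) - (m + a)) \<le> \<bar>s\<bar> * D / 4 \<and>
      mesh_error + norm (f (g (f (m + a) + y)) - (f (m + a) + y)) \<le> e * D"
      using 1 by simp
  qed
  then show ?thesis using r1 by blast
qed

end

text \<open>\<open>slope j\<close> measures how far a functional stretches along \<open>f\<close> at scales above
  \<open>2 ^ j * (r + \<eta> * norm x)\<close>; the term \<open>\<eta> * norm x\<close> absorbs the sublinear error in \<open>g (f x) \<approx> x\<close>.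
  Averaging over \<open>j < J\<close> makes the loss from halving the scale negligible.\<close>

locale coarse_inverses_body = coarse_inverses f g L
  for f :: "'a::real_normed_vector \<Rightarrow> 'b::real_normed_vector" and g :: "'b \<Rightarrow> 'a" and L :: real +
  fixes C :: "'a set" and c r \<eta> :: real and J :: nat
  assumes c: "0 < c" and C: "cball 0 c \<subseteq> C" "C \<subseteq> cball 0 (2 * c)"
    and J: "1 \<le> J" and r: "1 \<le> r" and \<eta>: "0 < \<eta>" "2 ^ J * \<eta> \<le> 1"
begin

text \<open>\<open>D\<close> plays the role of the gauge of \<open>x - x'\<close> with respect to
  \<open>C\<close> but need not equal it: as \<open>C\<close> contains \<open>cball 0 c\<close>,
  every D \<ge> norm (x - x') / c will do, so points close to each other can be compared at a large
  scale.\<close>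

definition quotients :: "nat \<Rightarrow> 'b set" where
  "quotients j = {w. \<exists>x x' D. 0 < D \<and> (1 / D) *\<^sub>R (x - x') \<in> C \<and>
     2 ^ j * (r + \<eta> * norm x) \<le> D \<and> 2 ^ j * (r + \<eta> * norm x') \<le> D \<and> w = (1 / D) *\<^sub>R (f x - f x')}"

definition slope :: "nat \<Rightarrow> ('b \<Rightarrow> real) \<Rightarrow> real" where
  "slope j \<phi> = Sup (\<phi> ` quotients j)"

text \<open>\<open>lip\<close> bounds the norms of all quotients, \<open>colip\<close> the norm of a
  functional whose slope at level \<open>J\<close> is at most 1. Both depend on \<open>c\<close> and
  \<open>L\<close> only, which keeps the body, \<open>r\<close>, \<eta> and \<open>J\<close> out of
  the final constant.\<close>

definition lip :: real where "lip = 2 * c * L + L"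
definition colip :: real where "colip = L * (1 / c + 1)"

lemma lip_pos: "lip > 0" and colip_pos: "colip > 0"
  using L c by (auto simp: lip_def colip_def add_pos_pos)

lemma scale_ge_1:
  assumes "2 ^ j * (r + \<eta> * norm (x :: 'a)) \<le> D" shows "r \<le> D" "1 \<le> D"
proof -
  have "r \<le> r + \<eta> * norm x" using \<eta> by simp
  also have "\<dots> = 1 * (r + \<eta> * norm x)" by simp
  also have "\<dots> \<le> 2 ^ j * (r + \<eta> * norm x)"
    using r \<eta> by (intro mult_right_mono) (auto simp: add_nonneg_nonneg)
  also note assms
  finally show "r \<le> D" .
  then show "1 \<le> D" using r by linarith
qed

lemma zero_in_quotients: "0 \<in> quotients j"
proof -
  have "(0::'a) \<in> C" using C(1) c by auto
  then show ?thesis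
    unfolding quotients_def using r by (intro CollectI exI[of _ 0] exI[of _ "2 ^ j * r"]) auto
qed

lemma norm_quotients:
  assumes "w \<in> quotients j" shows "norm w \<le> lip"
proof -
  obtain x x' D where w: "0 < D" "(1 / D) *\<^sub>R (x - x') \<in> C" "2 ^ j * (r + \<eta> * norm x) \<le> D"
      "w = (1 / D) *\<^sub>R (f x - f x')"
    using assms unfolding quotients_def by blast
  have "norm ((1 / D) *\<^sub>R (x - x')) \<le> 2 * c" using w(2) C(2) by auto
  then have "norm (x - x') / D \<le> 2 * c" using w(1) by simp
  then have "norm (x - x') \<le> 2 * c * D" using w(1) by (simp add: pos_divide_le_eq)
  then have "L * norm (x - x') \<le> L * (2 * c * D)" using L by (intro mult_left_mono) auto
  moreover have "L * 1 \<le> L * D" using scale_ge_1[OF w(3)] L by (intro mult_left_mono) auto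
  ultimately have "norm (f x - f x') \<le> lip * D"
    using f_lip[of x x'] by (simp add: lip_def algebra_simps)
  then have "norm (f x - f x') / D \<le> lip" using w(1) by (simp add: pos_divide_le_eq)
  then show ?thesis using w(1) by (simp add: w(4))
qed

lemma quotients_Suc: "quotients (Suc j) \<subseteq> quotients j"
proof -
  have "2 ^ j * (r + \<eta> * norm x) \<le> D" if "2 ^ Suc j * (r + \<eta> * norm x) \<le> D" for x :: 'a and D
  proof -
    have "0 \<le> 2 ^ j * (r + \<eta> * norm x)" using r \<eta> by (simp add: add_nonneg_nonneg)
    then show ?thesis using that by simp
  qed
  then show ?thesis unfolding quotients_def by blast
qed

lemma bdd_above_quotients:
  assumes "bounded_functional B \<phi>" "0 \<le> B"
  shows "bdd_above (\<phi> ` quotients j)" "w \<in> quotients j \<Longrightarrow> \<phi> w \<le> B * lip"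
proof -
  have *: "\<phi> w \<le> B * lip" if "w \<in> quotients j" for w
  proof -
    have "\<bar>\<phi> w\<bar> \<le> B * norm w" using assms(1) by (auto simp: bounded_functional_def)
    also have "\<dots> \<le> B * lip" using norm_quotients[OF that] assms(2) by (rule mult_left_mono)
    finally show ?thesis by simp
  qed
  then show "bdd_above (\<phi> ` quotients j)" by (auto simp: bdd_above_def)
  show "w \<in> quotients j \<Longrightarrow> \<phi> w \<le> B * lip" by (rule *)
qed

context
  fixes \<phi> :: "'b \<Rightarrow> real" and B :: real
  assumes \<phi>: "bounded_functional B \<phi>" and B: "0 \<le> B"
begin

lemma le_slope: "w \<in> quotients j \<Longrightarrow> \<phi> w \<le> slope j \<phi>"
  unfolding slope_def by (rule cSUP_upper[OF _ bdd_above_quotients(1)[OF \<phi> B]])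

lemma slope_le: "(\<And>w. w \<in> quotients j \<Longrightarrow> \<phi> w \<le> t) \<Longrightarrow> slope j \<phi> \<le> t"
  unfolding slope_def by (rule cSUP_least) (use zero_in_quotients in auto)

lemma slope_nonneg: "0 \<le> slope j \<phi>"
  using le_slope[OF zero_in_quotients] \<phi> by (simp add: bounded_functional_def linear_0)

lemma slope_le_lip: "slope j \<phi> \<le> B * lip"
  using bdd_above_quotients(2)[OF \<phi> B] by (rule slope_le)

lemma slope_Suc: "slope (Suc j) \<phi> \<le> slope j \<phi>"
  using quotients_Suc le_slope by (intro slope_le) blast

lemma slope_antimono: "i \<le> j \<Longrightarrow> slope j \<phi> \<le> slope i \<phi>"
  by (rule lift_Suc_antimono_le[of "\<lambda>j. slope j \<phi>", OF slope_Suc])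

lemma slope_approx:
  assumes "0 < e" shows "\<exists>w\<in>quotients j. slope j \<phi> - e < \<phi> w"
  using less_cSUP_iff[OF _ bdd_above_quotients(1)[OF \<phi> B], of j "slope j \<phi> - e"]
    zero_in_quotients[of j] assms unfolding slope_def by auto

text \<open>Follow the direction \<open>y\<close> to infinity:
  \<open>f (g (\<tau> *\<^sub>R y))\<close> is \<tau> y + o(\<tau>), and the pair of
  \<open>g (\<tau> *\<^sub>R y)\<close> and \<open>g 0\<close> can be compared at a scale of at most
  \<tau> colip (norm y) plus a constant, as 2^J \<eta> \<le> 1. Division by a large \<tau> removes
  the constants gathered in \<open>M\<close>.\<close>

lemma functional_le_slope: "\<phi> y \<le> slope J \<phi> * (colip * norm y)"
proof -
  have lin: "linear \<phi>" and bd: "\<And>v. \<bar>\<phi> v\<bar> \<le> B * norm v"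
    using \<phi> by (auto simp: bounded_functional_def)
  define t where "t = slope J \<phi>"
  have t0: "t \<ge> 0" unfolding t_def by (rule slope_nonneg)
  have "\<phi> y \<le> t * (colip * norm y) + e" if e: "e > 0" for e
  proof -
    define e' where "e' = e / (B * norm y + 1)"
    have By: "B * norm y \<ge> 0" using B by simp
    have e': "e' > 0" "B * (e' * norm y) \<le> e"
    proof -
      show "e' > 0" using e By by (simp add: e'_def add_nonneg_pos)
      have "B * (e' * norm y) = e * (B * norm y / (B * norm y + 1))" by (simp add: e'_def)
      also have "\<dots> \<le> e * 1" using e By by (intro mult_left_mono) (auto simp: divide_le_eq_1)
      finally show "B * (e' * norm y) \<le> e" by simp
    qed
    obtain R where R: "R \<ge> 0" "\<And>y. norm (f (g y) - y) \<le> e' * norm y + R" using fg[OF e'(1)] by blast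
    define M where "M = t * (L * (1 / c + 1) + 2 * 2 ^ J * r + 2 * norm (g 0)) + B * (norm (f (g 0)) + R)"
    have main: "\<tau> * \<phi> y \<le> \<tau> * (t * (colip * norm y) + e) + M" if \<tau>: "\<tau> > 0" for \<tau>
    proof -
      define x where "x = g (\<tau> *\<^sub>R y)"
      \<comment> \<open>The first summand brings the rescaled pair into \<open>cball 0 c\<close>,
        hence into \<open>C\<close>; the other two put both points at level
        \<open>J\<close>.\<close>
      define D where "D = norm (x - g 0) / c + 2 ^ J * (r + \<eta> * norm x) + 2 ^ J * (r + \<eta> * norm (g 0))"
      have pos: "2 ^ J * (r + \<eta> * norm z) > 0" for z :: 'a
        using r \<eta> by (intro mult_pos_pos add_pos_nonneg) auto
      have xc: "norm (x - g 0) / c \<ge> 0" using c by simp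
      have D0: "D > 0" using pos[of x] pos[of "g 0"] xc by (simp add: D_def)
      have "norm (x - g 0) / c \<le> D" using pos[of x] pos[of "g 0"] by (simp add: D_def)
      then have "norm (x - g 0) / D \<le> c" using D0 c by (simp add: field_simps)
      then have "norm ((1 / D) *\<^sub>R (x - g 0)) \<le> c" using D0 by simp
      then have "(1 / D) *\<^sub>R (x - g 0) \<in> C" using C(1) by auto
      then have "(1 / D) *\<^sub>R (f x - f (g 0)) \<in> quotients J"
        unfolding quotients_def using D0 pos[of x] pos[of "g 0"] xc
        by (intro CollectI exI[of _ x] exI[of _ "g 0"] exI[of _ D] conjI) (auto simp: D_def)
      then have "\<phi> ((1 / D) *\<^sub>R (f x - f (g 0))) \<le> t" unfolding t_def by (rule le_slope)
      then have "\<phi> (f x - f (g 0)) / D \<le> t" using linear_cmul[OF lin, of "1 / D" "f x - f (g 0)"] by simp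
      then have 1: "\<phi> (f x - f (g 0)) \<le> t * D" using D0 by (simp add: pos_divide_le_eq)
      have xg: "norm (x - g 0) \<le> L * (\<tau> * norm y) + L" using g_lip[of "\<tau> *\<^sub>R y" 0] \<tau> by (simp add: x_def)
      have \<eta>x: "2 ^ J * \<eta> * norm z \<le> norm z" for z :: 'a
        using mult_right_mono[OF \<eta>(2) norm_ge_zero[of z]] by simp
      have "D \<le> norm (x - g 0) / c + 2 * 2 ^ J * r + norm x + norm (g 0)"
        using \<eta>x[of x] \<eta>x[of "g 0"] by (simp add: D_def algebra_simps)
      also have "norm x \<le> norm (x - g 0) + norm (g 0)" using norm_triangle_ineq2[of x "g 0"] by simp
      also have "norm (x - g 0) / c + 2 * 2 ^ J * r + (norm (x - g 0) + norm (g 0)) + norm (g 0)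
          = norm (x - g 0) * (1 / c + 1) + 2 * 2 ^ J * r + 2 * norm (g 0)" by (simp add: algebra_simps)
      also have "norm (x - g 0) * (1 / c + 1) \<le> (L * (\<tau> * norm y) + L) * (1 / c + 1)"
        using xg c by (intro mult_right_mono) auto
      finally have D_le: "D \<le> \<tau> * (colip * norm y) + (L * (1 / c + 1) + 2 * 2 ^ J * r + 2 * norm (g 0))"
        by (simp add: colip_def algebra_simps)
      have "norm (f x - \<tau> *\<^sub>R y) \<le> e' * (\<tau> * norm y) + R"
        using R(2)[of "\<tau> *\<^sub>R y"] \<tau> by (simp add: x_def)
      then have "B * norm (f x - \<tau> *\<^sub>R y) \<le> B * (e' * (\<tau> * norm y) + R)"
        using B by (rule mult_left_mono)
      also have "\<dots> = \<tau> * (B * (e' * norm y)) + B * R" by (simp add: algebra_simps)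
      also have "\<tau> * (B * (e' * norm y)) \<le> \<tau> * e" using e'(2) \<tau> by (intro mult_left_mono) auto
      finally have 2: "\<bar>\<phi> (f x - \<tau> *\<^sub>R y)\<bar> \<le> \<tau> * e + B * R" using bd[of "f x - \<tau> *\<^sub>R y"] by linarith
      have "\<tau> * \<phi> y = \<phi> (f x - f (g 0)) + \<phi> (f (g 0)) - \<phi> (f x - \<tau> *\<^sub>R y)"
        using lin by (simp add: linear_diff linear_cmul)
      also have "\<dots> \<le> t * D + B * norm (f (g 0)) + (\<tau> * e + B * R)"
        using 1 2 bd[of "f (g 0)"] by linarith
      also have "t * D \<le> t * (\<tau> * (colip * norm y) + (L * (1 / c + 1) + 2 * 2 ^ J * r + 2 * norm (g 0)))"
        using D_le t0 by (rule mult_left_mono)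
      finally show ?thesis by (simp add: M_def algebra_simps)
    qed
    show ?thesis
    proof (rule ccontr)
      assume "\<not> ?thesis"
      then have d: "\<phi> y - (t * (colip * norm y) + e) > 0" by simp
      define \<tau> where "\<tau> = (\<bar>M\<bar> + 1) / (\<phi> y - (t * (colip * norm y) + e))"
      have "\<tau> > 0" using d by (simp add: \<tau>_def)
      from main[OF this] have "\<tau> * (\<phi> y - (t * (colip * norm y) + e)) \<le> M" by (simp add: algebra_simps)
      moreover have "\<tau> * (\<phi> y - (t * (colip * norm y) + e)) = \<bar>M\<bar> + 1" using d by (simp add: \<tau>_def)
      ultimately show False by linarith
    qed
  qed
  then show ?thesis unfolding t_def by (rule field_le_epsilon)
qed

lemma abs_functional_le_slope: "\<bar>\<phi> y\<bar> \<le> slope J \<phi> * colip * norm y"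
  using functional_le_slope[of y] functional_le_slope[of "- y"] \<phi>
  by (simp add: bounded_functional_def linear_neg mult.assoc)

end

section \<open>The predual norm defined by the mean slope\<close>

definition dual_ball :: "('b \<Rightarrow> real) set" where
  "dual_ball = {\<phi>. (\<exists>B\<ge>0. bounded_functional B \<phi>) \<and> (\<Sum>j<J. slope j \<phi>) \<le> J}"

text \<open>Slopes decrease with the level, so the slope at level \<open>J\<close> is at most the
  mean over the lower levels, hence at most 1, and \<open>abs_functional_le_slope\<close>
  applies.\<close>

lemma dual_ball_bounded:
  assumes "\<phi> \<in> dual_ball" shows "bounded_functional colip \<phi>"
proof -
  obtain B where B: "B \<ge> 0" "bounded_functional B \<phi>" and s: "(\<Sum>j<J. slope j \<phi>) \<le> J"
    using assms by (auto simp: dual_ball_def)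
  have "(\<Sum>j<J. slope J \<phi>) \<le> (\<Sum>j<J. slope j \<phi>)"
    by (intro sum_mono slope_antimono[OF B(2,1)]) auto
  then have "real J * slope J \<phi> \<le> real J * 1" using s by simp
  then have "slope J \<phi> \<le> 1" using J by (simp only: mult_le_cancel_left_pos)
  then have "slope J \<phi> * colip * norm y \<le> 1 * colip * norm y" for y
    using colip_pos by (intro mult_right_mono) auto
  then show ?thesis
    using abs_functional_le_slope[OF B(2,1)] B(2) unfolding bounded_functional_def
    by (metis mult_1 order_trans)
qed

lemma scaled_in_dual_ball:
  assumes \<phi>: "bounded_functional B \<phi>" "0 \<le> B" and a: "0 \<le> a"
    and sum: "a * (\<Sum>j<J. slope j \<phi>) \<le> J"
  shows "(\<lambda>v. a * \<phi> v) \<in> dual_ball"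
proof -
  have b: "bounded_functional (a * B) (\<lambda>v. a * \<phi> v)"
    unfolding bounded_functional_def
  proof (intro conjI allI)
    show "linear (\<lambda>v. a * \<phi> v)"
      using \<phi>(1) by (auto simp: bounded_functional_def linear_add linear_cmul algebra_simps intro!: linearI)
    fix v have "\<bar>\<phi> v\<bar> \<le> B * norm v" using \<phi>(1) by (auto simp: bounded_functional_def)
    then show "\<bar>a * \<phi> v\<bar> \<le> a * B * norm v" using a by (simp add: abs_mult mult.assoc mult_left_mono)
  qed
  have aB: "0 \<le> a * B" using a \<phi>(2) by simp
  have "slope j (\<lambda>v. a * \<phi> v) \<le> a * slope j \<phi>" for j
    by (rule slope_le[OF b aB]) (use le_slope[OF \<phi>] a in \<open>auto intro: mult_left_mono\<close>)
  then have "(\<Sum>j<J. slope j (\<lambda>v. a * \<phi> v)) \<le> (\<Sum>j<J. a * slope j \<phi>)" by (intro sum_mono)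
  then show ?thesis
    using b aB sum by (auto simp: dual_ball_def sum_distrib_left[symmetric])
qed

definition predual_norm :: "'b \<Rightarrow> real" where
  "predual_norm y = Sup ((\<lambda>\<phi>. \<phi> y) ` dual_ball)"

lemma le_predual_norm:
  assumes "\<phi> \<in> dual_ball" shows "\<phi> y \<le> predual_norm y"
  unfolding predual_norm_def
proof (rule cSUP_upper[OF assms])
  have "\<psi> y \<le> colip * norm y" if "\<psi> \<in> dual_ball" for \<psi>
    using dual_ball_bounded[OF that] unfolding bounded_functional_def by (metis abs_le_D1)
  then show "bdd_above ((\<lambda>\<phi>. \<phi> y) ` dual_ball)" by (auto simp: bdd_above_def)
qed

lemma zero_in_dual_ball: "(\<lambda>_. 0) \<in> dual_ball"
  using scaled_in_dual_ball[of 0 "\<lambda>_. 0" 0] by (simp add: bounded_functional_def linear_zero)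

lemma predual_norm_zero: "predual_norm 0 = 0"
proof -
  have "(\<lambda>\<phi>. \<phi> 0) ` dual_ball = {0 :: real}"
    using zero_in_dual_ball dual_ball_bounded by (force simp: bounded_functional_def linear_0)
  then show ?thesis by (simp add: predual_norm_def)
qed

lemma less_predual_norm:
  assumes "t < predual_norm y" shows "\<exists>\<phi>\<in>dual_ball. t < \<phi> y"
proof (rule ccontr)
  assume "\<not> ?thesis"
  then have "predual_norm y \<le> t"
    unfolding predual_norm_def using zero_in_dual_ball by (intro cSUP_least) (auto simp: not_less)
  then show False using assms by simp
qed

text \<open>A norming functional of norm 1 has all slopes at most \<open>lip\<close>, so it lies in
  \<open>dual_ball\<close> after division by \<open>lip\<close>.\<close>

lemma norm_le_predual_norm: "norm y \<le> lip * predual_norm y"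
proof -
  obtain \<psi> :: "'b \<Rightarrow> real" where \<psi>: "linear \<psi>" "\<And>v. \<bar>\<psi> v\<bar> \<le> norm v" "\<psi> y = norm y"
    using norming_functional by blast
  then have b: "bounded_functional 1 \<psi>" by (simp add: bounded_functional_def)
  have "(\<Sum>j<J. slope j \<psi>) \<le> (\<Sum>j<J. lip)"
    using slope_le_lip[OF b] by (intro sum_mono) simp
  then have "(1 / lip) * (\<Sum>j<J. slope j \<psi>) \<le> J" using lip_pos by (simp add: field_simps)
  then have "(\<lambda>v. (1 / lip) * \<psi> v) \<in> dual_ball"
    using lip_pos by (intro scaled_in_dual_ball[OF b]) auto
  from le_predual_norm[OF this, of y] show ?thesis
    using lip_pos \<psi>(3) by (simp add: field_simps)
qed

text \<open>Homogeneity: a functional of mean slope t > 0 is t times an element of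
  \<open>dual_ball\<close>, and one of mean slope 0 vanishes. The slack 1 - t that this leaves will
  pay for the perturbation in \<open>predual_norm_step\<close>.\<close>

lemma functional_le_predual_norm:
  assumes "\<phi> \<in> dual_ball"
  shows "\<phi> z \<le> (\<Sum>j<J. slope j \<phi>) / J * predual_norm z"
proof -
  have b: "bounded_functional colip \<phi>" using assms by (rule dual_ball_bounded)
  have K: "0 \<le> colip" using colip_pos by simp
  define T where "T = (\<Sum>j<J. slope j \<phi>)"
  have "T \<ge> 0" unfolding T_def by (intro sum_nonneg slope_nonneg[OF b K])
  show ?thesis
  proof (cases "T = 0")
    case True
    have "(\<Sum>j<J. slope J \<phi>) \<le> T" unfolding T_def
      by (intro sum_mono slope_antimono[OF b K]) auto
    then have "slope J \<phi> \<le> 0" using True J by (simp add: mult_le_0_iff)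
    then have "slope J \<phi> = 0" using slope_nonneg[OF b K, of J] by simp
    then show ?thesis using abs_functional_le_slope[OF b K, of z] True by (simp add: T_def[symmetric])
  next
    case False
    then have T: "T > 0" using \<open>T \<ge> 0\<close> by simp
    then have "(\<lambda>v. (J / T) * \<phi> v) \<in> dual_ball"
      by (intro scaled_in_dual_ball[OF b K]) (auto simp: T_def[symmetric])
    from le_predual_norm[OF this, of z] show ?thesis
      unfolding T_def[symmetric] using T J by (simp add: field_simps)
  qed
qed

text \<open>Splitting an almost norming pair at its midpoint \<open>m\<close> shows that \<open>\<phi>\<close> is almost constant on
  the \<open>f (m + u)\<close> for small, weakly small \<open>u\<close>; by the Gorelik principle these points cover a ball
  around \<open>f m\<close> up to a finite set, on which \<open>\<psi> - \<phi>\<close> is negligible.\<close>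

lemma slope_gain:
  fixes s \<delta> :: real
  assumes \<phi>: "bounded_functional colip \<phi>" and j: "j < J"
    and s: "s \<noteq> 0" "\<bar>s\<bar> \<le> 1" and \<delta>: "0 < \<delta>" "2 ^ J * \<eta> \<le> \<delta>"
    and smooth: "\<And>v. v \<in> C \<Longrightarrow> eventually (\<lambda>u. (1 / (1 + \<delta>)) *\<^sub>R (v + s *\<^sub>R u) \<in> C) weak0"
    and scale: "admissible_scale \<eta> r (\<delta> / (8 * colip)) s"
  shows "\<exists>Z e. finite Z \<and> 0 < e \<and> (\<forall>\<psi> y. bounded_functional colip \<psi> \<longrightarrow> norm y \<le> 1 \<longrightarrow>
    (\<forall>v\<in>Z. \<bar>\<psi> v - \<phi> v\<bar> \<le> e) \<longrightarrow>
    2 * slope (Suc j) \<phi> - slope j \<phi> + (\<psi> (s *\<^sub>R y) - \<phi> (s *\<^sub>R y)) / (8 * L) - \<delta> * (2 * (colip * lip) + 1)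
      \<le> slope j \<psi>)"
proof -
  have K: "0 \<le> colip" using colip_pos by simp
  have lin: "linear \<phi>" and bd: "\<And>v. \<bar>\<phi> v\<bar> \<le> colip * norm v"
    using \<phi> by (auto simp: bounded_functional_def)
  \<comment> \<open>The pair is almost norming at level \<open>Suc j\<close>, so that its two
    halves, at scales of at least D / 2, are still admissible at level \<open>j\<close>.\<close>
  obtain w where w: "w \<in> quotients (Suc j)" "slope (Suc j) \<phi> - \<delta> / 8 < \<phi> w"
    using slope_approx[OF \<phi> K, of "\<delta> / 8" "Suc j"] \<delta>(1) by auto
  obtain x x' D where D: "0 < D" "(1 / D) *\<^sub>R (x - x') \<in> C" "2 ^ Suc j * (r + \<eta> * norm x) \<le> D"
      "2 ^ Suc j * (r + \<eta> * norm x') \<le> D" "w = (1 / D) *\<^sub>R (f x - f x')"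
    using w(1) unfolding quotients_def by blast
  define v where "v = (1 / D) *\<^sub>R (x - x')"
  define m where "m = (1 / 2) *\<^sub>R (x + x')"
  have xm: "x - m = (D / 2) *\<^sub>R v" "m - x' = (D / 2) *\<^sub>R v"
  proof -
    have v: "(D / 2) *\<^sub>R v = (1 / 2) *\<^sub>R (x - x')" using D(1) by (simp add: v_def)
    show "x - m = (D / 2) *\<^sub>R v" unfolding v
      by (rule scaleR_left_imp_eq[of 2]) (simp_all add: m_def scaleR_right_diff_distrib scaleR_2)
    show "m - x' = (D / 2) *\<^sub>R v" unfolding v
      by (rule scaleR_left_imp_eq[of 2]) (simp_all add: m_def scaleR_right_diff_distrib scaleR_2)
  qed
  have norm_m: "norm m \<le> max (norm x) (norm x')"
    using norm_triangle_ineq[of x x'] by (simp add: m_def)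
  have m_scale: "2 ^ j * (r + \<eta> * norm m) \<le> D / 2"
  proof -
    have "2 ^ j * (r + \<eta> * norm m) \<le> 2 ^ j * (r + \<eta> * max (norm x) (norm x'))"
      using norm_m \<eta> by (intro mult_left_mono add_left_mono) auto
    also have "\<dots> \<le> D / 2" using D(3,4) by (auto simp: max_def)
    finally show ?thesis .
  qed
  have "eventually (\<lambda>u. (1 / (1 + \<delta>)) *\<^sub>R (v + s *\<^sub>R u) \<in> C \<and> (1 / (1 + \<delta>)) *\<^sub>R (v + s *\<^sub>R (- u)) \<in> C) weak0"
    using smooth[OF D(2)[folded v_def]] eventually_weak0_uminus[OF smooth[OF D(2)[folded v_def]]]
    by (rule eventually_conj)
  then obtain H where H: "finite H" "\<forall>h\<in>H. bounded_linear h"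
    and HC: "\<And>u. norm u \<le> 1 \<Longrightarrow> (\<forall>h\<in>H. \<bar>h u :: real\<bar> < 1) \<Longrightarrow>
      (1 / (1 + \<delta>)) *\<^sub>R (v + s *\<^sub>R u) \<in> C \<and> (1 / (1 + \<delta>)) *\<^sub>R (v + s *\<^sub>R (- u)) \<in> C"
    unfolding eventually_weak0 by blast
  \<comment> \<open>A step \<open>s *\<^sub>R u'\<close> from the rescaled vector \<open>v\<close>
    is a step \<open>q *\<^sub>R u'\<close> from the midpoint. Accordingly the functionals are
    divided by \<open>q\<close> before they enter the Gorelik principle.\<close>
  define q where "q = s * D / 2"
  have q: "q \<noteq> 0" "\<bar>q\<bar> = \<bar>s\<bar> * D / 2" using s(1) D(1) by (auto simp: q_def abs_mult)
  define b where "b = \<bar>s\<bar> * D / 2"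
  define \<rho> where "\<rho> = \<bar>s\<bar> * D / (16 * L)"
  have b2: "b / 2 = \<bar>s\<bar> * D / 4" by (simp add: b_def)
  have "r \<le> D" using scale_ge_1(1)[OF D(3)] .
  have m_D: "\<eta> * norm m \<le> D"
  proof -
    have "1 * (\<eta> * norm m) \<le> 2 ^ j * (r + \<eta> * norm m)"
      using r \<eta> by (intro mult_mono) auto
    then show ?thesis using m_scale D(1) by simp
  qed
  have adm: "norm (g (f (m + a) + y) - (m + a)) \<le> b / 2"
    "mesh_error + norm (f (g (f (m + a) + y)) - (f (m + a) + y)) \<le> \<delta> / (8 * colip) * D"
    if "norm a \<le> b / 2" "norm y \<le> \<rho>" for a y
    using scale[unfolded admissible_scale_def, rule_format, OF \<open>r \<le> D\<close> m_D] that
    unfolding b2 \<rho>_def by blast+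
  define H' where "H' = (\<lambda>h u. h u / q) ` H"
  have H': "finite H'" "\<forall>h\<in>H'. bounded_linear h"
    unfolding H'_def using H bounded_linear_divide[THEN bounded_linear_compose] by auto
  have "\<exists>Kf. finite Kf \<and> (\<forall>y. norm y \<le> \<rho> \<longrightarrow>
      (\<exists>u a. norm u \<le> b \<and> (\<forall>h\<in>H'. \<bar>h u\<bar> < 1) \<and> norm a \<le> b / 2 \<and> f (m + a) \<in> Kf \<and>
        norm (u - (g (f (m + a) + y) - m)) \<le> 3 * L\<^sup>2 + L + 3))"
    using L D(1) by (intro gorelik_principle f_lip g_lip H' adm(1)) (auto simp: b_def)
  then obtain Kf where Kf: "finite Kf" and gor: "\<And>y. norm y \<le> \<rho> \<Longrightarrow>
      \<exists>u a. norm u \<le> b \<and> (\<forall>h\<in>H'. \<bar>h u\<bar> < 1) \<and> norm a \<le> b / 2 \<and> f (m + a) \<in> Kf \<and>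
        norm (u - (g (f (m + a) + y) - m)) \<le> 3 * L\<^sup>2 + L + 3"
    by blast
  define e where "e = \<delta> * D / 16"
  have "2 * slope (Suc j) \<phi> - slope j \<phi> + (\<psi> (s *\<^sub>R y) - \<phi> (s *\<^sub>R y)) / (8 * L) - \<delta> * (2 * (colip * lip) + 1)
      \<le> slope j \<psi>"
    if \<psi>: "bounded_functional colip \<psi>" and y: "norm y \<le> 1"
      and near: "\<forall>v\<in>insert (f x') Kf. \<bar>\<psi> v - \<phi> v\<bar> \<le> e" for \<psi> y
  proof -
    have lin\<psi>: "linear \<psi>" and bd\<psi>: "\<And>v. \<bar>\<psi> v\<bar> \<le> colip * norm v"
      using \<psi> by (auto simp: bounded_functional_def)
    define y' where "y' = (D / (16 * L)) *\<^sub>R (s *\<^sub>R y)"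
    have "norm y' \<le> \<rho>"
    proof -
      have "norm y' = \<rho> * norm y" using L D(1) by (simp add: y'_def \<rho>_def abs_mult)
      also have "\<dots> \<le> \<rho> * 1" using y L D(1) by (intro mult_left_mono) (auto simp: \<rho>_def)
      finally show ?thesis by simp
    qed
    then obtain u a where u: "norm u \<le> b" "\<forall>h\<in>H'. \<bar>h u\<bar> < 1" and a: "norm a \<le> b / 2" "f (m + a) \<in> Kf"
        and ua: "norm (u - (g (f (m + a) + y') - m)) \<le> 3 * L\<^sup>2 + L + 3"
      using gor by blast
    define u' where "u' = (1 / q) *\<^sub>R u"
    have qu': "q *\<^sub>R u' = u" using q(1) by (simp add: u'_def)
    have "norm u' \<le> 1"
      using u(1) q by (simp add: u'_def b_def divide_le_eq)
    moreover have "\<forall>h\<in>H. \<bar>h u'\<bar> < 1"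
    proof
      fix h assume h: "h \<in> H"
      have "h u' = h u / q" using linear_cmul[OF bounded_linear.linear, of h "1 / q" u] H(2) h by (simp add: u'_def)
      then show "\<bar>h u'\<bar> < 1" using u(2) h by (auto simp: H'_def)
    qed
    ultimately have inC: "(1 / (1 + \<delta>)) *\<^sub>R (v + s *\<^sub>R u') \<in> C" "(1 / (1 + \<delta>)) *\<^sub>R (v + s *\<^sub>R (- u')) \<in> C"
      using HC by blast+
    \<comment> \<open>The scale at which both halves fit into \<open>C\<close> once the midpoint has
      moved by \<open>u\<close>. One half changes by \<open>s *\<^sub>R u'\<close>, the other by its
      negative, which is why smoothness was required for both signs.\<close>
    define D' where "D' = (1 + \<delta>) * (D / 2)"
    have D'_eq: "D' = D / 2 + \<delta> * D / 2" by (simp add: D'_def algebra_simps)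
    have "\<delta> * D > 0" using D(1) \<delta>(1) by simp
    then have D': "D' > 0" "D / 2 \<le> D'" using D'_eq D(1) by linarith+
    have half: "(1 / D') *\<^sub>R ((D / 2) *\<^sub>R z) = (1 / (1 + \<delta>)) *\<^sub>R z" for z :: 'a
    proof -
      have "1 / D' * (D / 2) = 1 * (D / 2) / ((1 + \<delta>) * (D / 2))" by (simp add: D'_def)
      also have "\<dots> = 1 / (1 + \<delta>)" using D(1) by (intro nonzero_mult_divide_mult_cancel_right) simp
      finally show ?thesis by (simp only: scaleR_scaleR)
    qed
    have su: "u = (D / 2) *\<^sub>R (s *\<^sub>R u')" unfolding qu'[symmetric] by (simp add: q_def mult.commute)
    have "x - (m + u) = (D / 2) *\<^sub>R (v + s *\<^sub>R (- u'))" "(m + u) - x' = (D / 2) *\<^sub>R (v + s *\<^sub>R u')"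
      using xm su by (simp_all add: algebra_simps)
    then have dC: "(1 / D') *\<^sub>R (x - (m + u)) \<in> C" "(1 / D') *\<^sub>R ((m + u) - x') \<in> C"
      using inC by (simp_all only: half)
    have mu_scale: "2 ^ j * (r + \<eta> * norm (m + u)) \<le> D'"
    proof -
      have "norm u \<le> D / 2"
      proof -
        have "\<bar>s\<bar> * D \<le> 1 * D" using s(2) D(1) by (intro mult_right_mono) auto
        then show ?thesis using u(1) unfolding b_def by linarith
      qed
      then have "2 ^ j * (\<eta> * norm u) \<le> 2 ^ J * \<eta> * (D / 2)"
        using \<eta> j by (simp only: mult.assoc[symmetric]) (intro mult_mono, auto simp: power_increasing)
      also have "\<dots> \<le> \<delta> * (D / 2)" using \<delta>(2) D(1) by (intro mult_right_mono) auto
      finally have "2 ^ j * (\<eta> * norm u) \<le> \<delta> * D / 2" by simp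
      moreover have "2 ^ j * (\<eta> * norm (m + u)) \<le> 2 ^ j * (\<eta> * (norm m + norm u))"
        using \<eta> norm_triangle_ineq by (intro mult_left_mono) auto
      ultimately show ?thesis using m_scale D'_eq by (simp add: distrib_left)
    qed
    have x_scale: "2 ^ j * (r + \<eta> * norm x) \<le> D'" "2 ^ j * (r + \<eta> * norm x') \<le> D'"
      using D(3,4) D'(2) by simp_all
    \<comment> \<open>The two halves are tested with different functionals: \<open>\<phi>\<close> on
      the first bounds \<open>\<phi> (f (m + u))\<close> from below, \<open>\<psi>\<close> on the
      second bounds \<open>\<psi> (f (m + u))\<close> from above. What separates the two values is
      \<open>\<psi> - \<phi>\<close> at \<open>y'\<close>, up to small errors.\<close>
    have "(1 / D') *\<^sub>R (f x - f (m + u)) \<in> quotients j"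
      unfolding quotients_def using D'(1) dC(1) x_scale(1) mu_scale by blast
    then have "\<phi> ((1 / D') *\<^sub>R (f x - f (m + u))) \<le> slope j \<phi>" by (rule le_slope[OF \<phi> K])
    then have "\<phi> (f x - f (m + u)) / D' \<le> slope j \<phi>"
      using linear_cmul[OF lin, of "1 / D'" "f x - f (m + u)"] by simp
    then have 1: "\<phi> (f x) - \<phi> (f (m + u)) \<le> slope j \<phi> * D'"
      using D'(1) lin by (simp add: pos_divide_le_eq linear_diff)
    have "(1 / D') *\<^sub>R (f (m + u) - f x') \<in> quotients j"
      unfolding quotients_def using D'(1) dC(2) x_scale(2) mu_scale by blast
    then have "\<psi> ((1 / D') *\<^sub>R (f (m + u) - f x')) \<le> slope j \<psi>" by (rule le_slope[OF \<psi> K])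
    then have "\<psi> (f (m + u) - f x') / D' \<le> slope j \<psi>"
      using linear_cmul[OF lin\<psi>, of "1 / D'" "f (m + u) - f x'"] by simp
    then have 2: "\<psi> (f (m + u)) - \<psi> (f x') \<le> slope j \<psi> * D'"
      using D'(1) lin\<psi> by (simp add: pos_divide_le_eq linear_diff)
    have "slope (Suc j) \<phi> - \<delta> / 8 < \<phi> (f x - f x') / D"
      using w(2) linear_cmul[OF lin, of "1 / D" "f x - f x'"] by (simp add: D(5))
    then have 3: "(slope (Suc j) \<phi> - \<delta> / 8) * D \<le> \<phi> (f x) - \<phi> (f x')"
      using D(1) lin by (simp add: pos_less_divide_eq linear_diff)
    define err where "err = f (m + u) - (f (m + a) + y')"
    have "norm err \<le> \<delta> / (8 * colip) * D"
    proof -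
      have eq: "m + u - g (f (m + a) + y') = u - (g (f (m + a) + y') - m)" by (simp add: algebra_simps)
      have "norm (m + u - g (f (m + a) + y')) \<le> 3 * L\<^sup>2 + L + 3" unfolding eq by (rule ua)
      then have "L * norm (m + u - g (f (m + a) + y')) \<le> L * (3 * L\<^sup>2 + L + 3)"
        using L by (intro mult_left_mono) auto
      then have "norm (f (m + u) - f (g (f (m + a) + y'))) \<le> mesh_error"
        using f_lip[of "m + u" "g (f (m + a) + y')"] by (simp add: mesh_error_def)
      moreover have "norm err \<le> norm (f (m + u) - f (g (f (m + a) + y'))) + norm (f (g (f (m + a) + y')) - (f (m + a) + y'))"
        using dist_triangle[of "f (m + u)" "f (m + a) + y'" "f (g (f (m + a) + y'))"]
        unfolding err_def dist_norm .
      ultimately show ?thesis using adm(2)[OF a(1) \<open>norm y' \<le> \<rho>\<close>] by linarith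
    qed
    then have "colip * norm err \<le> colip * (\<delta> / (8 * colip) * D)" using K by (rule mult_left_mono)
    also have "\<dots> = \<delta> * D / 8" using colip_pos by simp
    finally have err: "\<bar>\<phi> err\<bar> \<le> \<delta> * D / 8" "\<bar>\<psi> err\<bar> \<le> \<delta> * D / 8"
      using bd[of err] bd\<psi>[of err] by linarith+
    have "f (m + u) = f (m + a) + y' + err" by (simp add: err_def)
    then have split: "\<phi> (f (m + u)) = \<phi> (f (m + a)) + \<phi> y' + \<phi> err"
        "\<psi> (f (m + u)) = \<psi> (f (m + a)) + \<psi> y' + \<psi> err"
      using lin lin\<psi> by (simp_all add: linear_add)
    have near': "\<bar>\<psi> (f (m + a)) - \<phi> (f (m + a))\<bar> \<le> e" "\<bar>\<psi> (f x') - \<phi> (f x')\<bar> \<le> e"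
      using near a(2) by auto
    define G where "G = \<psi> (s *\<^sub>R y) - \<phi> (s *\<^sub>R y)"
    have y'G: "\<psi> y' - \<phi> y' = D / (16 * L) * G"
      using linear_cmul[OF lin, of "D / (16 * L)" "s *\<^sub>R y"] linear_cmul[OF lin\<psi>, of "D / (16 * L)" "s *\<^sub>R y"]
      by (simp add: y'_def G_def right_diff_distrib)
    \<comment> \<open>The errors are \<delta> D / 8 from the choice of the pair, 2 e = \<delta> D /
      8 from the finite set and \<delta> D / 4 from \<open>err\<close>. Division by D / 2 makes them
      \<delta>; replacing \<open>D'\<close> by D / 2 costs at most 2 \<delta> colip lip
      more.\<close>
    have "slope j \<psi> * D' \<ge> (slope (Suc j) \<phi> - \<delta> / 8) * D - slope j \<phi> * D' + D / (16 * L) * G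
        - 2 * e - 2 * (\<delta> * D / 8)"
      using 1 2 3 split near' err y'G by linarith
    then have "slope j \<psi> * (1 + \<delta>) * (D / 2) \<ge>
        (2 * slope (Suc j) \<phi> - \<delta> / 4 - slope j \<phi> * (1 + \<delta>) + G / (8 * L) - \<delta> / 4 - \<delta> / 2) * (D / 2)"
      using L by (simp add: D'_def e_def field_simps)
    then have "slope j \<psi> * (1 + \<delta>) \<ge>
        2 * slope (Suc j) \<phi> - \<delta> / 4 - slope j \<phi> * (1 + \<delta>) + G / (8 * L) - \<delta> / 4 - \<delta> / 2"
      by (rule mult_right_le_imp_le) (use D(1) in simp)
    moreover have "slope j \<psi> * \<delta> \<le> colip * lip * \<delta>" "slope j \<phi> * \<delta> \<le> colip * lip * \<delta>"
      using slope_le_lip[OF \<psi> K] slope_le_lip[OF \<phi> K] \<delta>(1) by (auto intro!: mult_right_mono)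
    ultimately show ?thesis unfolding G_def[symmetric] by (simp add: algebra_simps)
  qed
  moreover have "0 < e" using \<delta>(1) D(1) by (simp add: e_def)
  ultimately show ?thesis using Kf by (intro exI[of _ "insert (f x') Kf"] exI[of _ e]) blast
qed


text \<open>\<open>colip\<close> bounds the whole dual ball, so the Banach-Alaoglu argument applies.
  Each slope is a supremum of evaluations, hence lower semicontinuous for pointwise convergence, and
  the constraint on the mean slope passes to the cluster point.\<close>

lemma dual_ball_cluster_point:
  assumes F: "F \<noteq> bot" and \<Phi>: "eventually (\<lambda>y. \<Phi> y \<in> dual_ball) F"
  shows "\<exists>\<phi>\<in>dual_ball. \<forall>Z e. finite Z \<longrightarrow> 0 < e \<longrightarrow> frequently (\<lambda>y. \<forall>v\<in>Z. \<bar>\<Phi> y v - \<phi> v\<bar> < e) F"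
proof -
  have K: "0 \<le> colip" using colip_pos by simp
  have "eventually (\<lambda>y. linear (\<Phi> y) \<and> (\<forall>v. \<bar>\<Phi> y v\<bar> \<le> colip * norm v)) F"
    using \<Phi> by (rule eventually_mono) (use dual_ball_bounded in \<open>auto simp: bounded_functional_def\<close>)
  from functionals_cluster_point[OF F this] obtain \<phi> where "bounded_functional colip \<phi>"
    and near: "\<And>Z e. finite Z \<Longrightarrow> 0 < e \<Longrightarrow> frequently (\<lambda>y. \<forall>v\<in>Z. \<bar>\<Phi> y v - \<phi> v\<bar> < e) F"
    unfolding bounded_functional_def by blast
  note \<phi> = this(1)
  have "(\<Sum>j<J. slope j \<phi>) \<le> real J"
  proof (rule field_le_epsilon)
    fix e :: real assume e: "0 < e"
    define d where "d = e / (2 * real J)"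
    have d: "0 < d" "real J * (2 * d) = e" using e J by (simp_all add: d_def)
    obtain w where w: "\<And>j. w j \<in> quotients j" "\<And>j. slope j \<phi> - d < \<phi> (w j)"
      using slope_approx[OF \<phi> K d(1)] by metis
    have "frequently (\<lambda>y. \<forall>v\<in>w ` {..<J}. \<bar>\<Phi> y v - \<phi> v\<bar> < d) F"
      by (rule near) (use d in auto)
    from frequently_ex[OF frequently_eventually_conj[OF this \<Phi>]] obtain \<psi>
      where \<psi>: "\<psi> \<in> dual_ball" "\<And>j. j < J \<Longrightarrow> \<bar>\<psi> (w j) - \<phi> (w j)\<bar> < d" by auto
    have "(\<Sum>j<J. slope j \<phi>) \<le> (\<Sum>j<J. slope j \<psi> + 2 * d)"
    proof (rule sum_mono)
      fix j assume "j \<in> {..<J}"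
      then have "\<bar>\<psi> (w j) - \<phi> (w j)\<bar> < d" using \<psi>(2) by simp
      moreover have "\<psi> (w j) \<le> slope j \<psi>" by (rule le_slope[OF dual_ball_bounded[OF \<psi>(1)] K w(1)])
      ultimately show "slope j \<phi> \<le> slope j \<psi> + 2 * d" using w(2)[of j] by linarith
    qed
    also have "\<dots> = (\<Sum>j<J. slope j \<psi>) + e" using d(2) by (simp add: sum.distrib)
    also have "(\<Sum>j<J. slope j \<psi>) \<le> real J" using \<psi>(1) by (simp add: dual_ball_def)
    finally show "(\<Sum>j<J. slope j \<phi>) \<le> real J + e" by simp
  qed
  then have "\<phi> \<in> dual_ball" using \<phi> K by (auto simp: dual_ball_def)
  then show ?thesis using near by blast
qed

text \<open>8 L times the error 2 colip lip + 2 of the averaged gain, plus 1 for two deviations of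
  \<delta> / 2: that of \<open>\<psi> z\<close> from \<open>\<phi> z\<close> and that of
  \<open>\<phi> (s *\<^sub>R y)\<close> from 0.\<close>

definition step_cost :: real where "step_cost = 16 * L * (colip * lip + 1) + 1"

text \<open>If bad \<open>y\<close> occurred frequently, the functionals that almost norm
  \<open>z + s *\<^sub>R y\<close> would cluster at some \<open>\<phi>\<close> in the dual ball. One
  of them, \<open>\<psi>\<close>, is so close to \<open>\<phi>\<close> on the finite sets of
  \<open>slope_gain\<close> that every level gains (\<psi> - \<phi>)(s y) / (8 L) over
  \<open>\<phi>\<close>, up to the loss from halving. As the mean slope of \<open>\<psi>\<close> is
  at most 1, the mean slope of \<open>\<phi>\<close> limits this gain, and \<open>\<psi>\<close> is
  too small at \<open>z + s *\<^sub>R y\<close>.\<close>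

lemma predual_norm_step:
  fixes s \<delta> :: real
  assumes s: "s \<noteq> 0" "\<bar>s\<bar> \<le> 1" and \<delta>: "0 < \<delta>" "2 ^ J * \<eta> \<le> \<delta>" "2 * (colip * lip) \<le> real J * \<delta>"
    and smooth: "\<And>v. v \<in> C \<Longrightarrow> eventually (\<lambda>u. (1 / (1 + \<delta>)) *\<^sub>R (v + s *\<^sub>R u) \<in> C) weak0"
    and scale: "admissible_scale \<eta> r (\<delta> / (8 * colip)) s"
  shows "eventually (\<lambda>y. max (predual_norm (z + s *\<^sub>R y)) (8 * L) \<le>
    max (predual_norm z) (8 * L) + step_cost * \<delta>) weak0"
proof (rule ccontr)
  have K: "0 \<le> colip" using colip_pos by simp
  define M where "M = max (predual_norm z) (8 * L)"
  have cost: "step_cost * \<delta> \<ge> 0"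
    using L \<delta>(1) colip_pos lip_pos by (simp add: step_cost_def)
  define bad where "bad y \<longleftrightarrow> M + step_cost * \<delta> < predual_norm (z + s *\<^sub>R y)" for y
  assume "\<not> ?thesis"
  moreover have "max (predual_norm (z + s *\<^sub>R y)) (8 * L) \<le> M + step_cost * \<delta> \<longleftrightarrow> \<not> bad y" for y
    using cost by (auto simp: bad_def M_def)
  ultimately have "frequently bad weak0"
    unfolding M_def[symmetric] by (simp add: frequently_def)
  define F where "F = inf weak0 (principal {y. bad y})"
  have F: "F \<noteq> bot"
  proof
    assume "F = bot"
    then have "eventually (\<lambda>_. False) F" by simp
    then have "eventually (\<lambda>y. \<not> bad y) weak0"
      unfolding F_def eventually_inf_principal by simp
    then show False using \<open>frequently bad weak0\<close> by (simp add: frequently_def)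
  qed
  have evF: "eventually P F" if "eventually P weak0" for P
    unfolding F_def eventually_inf_principal using that by (rule eventually_mono) simp
  have "\<forall>y. \<exists>\<phi>. bad y \<longrightarrow> \<phi> \<in> dual_ball \<and> M + step_cost * \<delta> < \<phi> (z + s *\<^sub>R y)"
    using less_predual_norm unfolding bad_def by blast
  from choice[OF this] obtain \<Phi> where \<Phi>: "\<And>y. bad y \<Longrightarrow> \<Phi> y \<in> dual_ball"
    "\<And>y. bad y \<Longrightarrow> M + step_cost * \<delta> < \<Phi> y (z + s *\<^sub>R y)" by blast
  have badF: "eventually bad F"
    unfolding F_def eventually_inf_principal by simp
  have "eventually (\<lambda>y. \<Phi> y \<in> dual_ball) F"
    using badF by (rule eventually_mono) (rule \<Phi>(1))
  from dual_ball_cluster_point[OF F this] obtain \<phi> where \<phi>D: "\<phi> \<in> dual_ball"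
    and near: "\<And>Z e. finite Z \<Longrightarrow> 0 < e \<Longrightarrow> frequently (\<lambda>y. \<forall>v\<in>Z. \<bar>\<Phi> y v - \<phi> v\<bar> < e) F"
    by blast
  have \<phi>: "bounded_functional colip \<phi>" using \<phi>D by (rule dual_ball_bounded)
  define gain where "gain j \<psi> y \<longleftrightarrow>
    2 * slope (Suc j) \<phi> - slope j \<phi> + (\<psi> (s *\<^sub>R y) - \<phi> (s *\<^sub>R y)) / (8 * L) - \<delta> * (2 * (colip * lip) + 1)
      \<le> slope j \<psi>" for j \<psi> y
  have "\<forall>j. \<exists>Z e. j < J \<longrightarrow> finite Z \<and> 0 < e \<and> (\<forall>\<psi> y. bounded_functional colip \<psi> \<longrightarrow> norm y \<le> 1 \<longrightarrow>
      (\<forall>v\<in>Z. \<bar>\<psi> v - \<phi> v\<bar> \<le> e) \<longrightarrow> gain j \<psi> y)"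
    unfolding gain_def using slope_gain[OF \<phi> _ s \<delta>(1,2) smooth scale] by blast
  from choice[OF this] obtain Z where "\<forall>j. \<exists>e. j < J \<longrightarrow> finite (Z j) \<and> 0 < e \<and>
      (\<forall>\<psi> y. bounded_functional colip \<psi> \<longrightarrow> norm y \<le> 1 \<longrightarrow> (\<forall>v\<in>Z j. \<bar>\<psi> v - \<phi> v\<bar> \<le> e) \<longrightarrow> gain j \<psi> y)"
    by blast
  from choice[OF this] obtain e where Z: "\<And>j. j < J \<Longrightarrow> finite (Z j)" and e: "\<And>j. j < J \<Longrightarrow> 0 < e j"
    and gain: "\<And>j \<psi> y. j < J \<Longrightarrow> bounded_functional colip \<psi> \<Longrightarrow> norm y \<le> 1 \<Longrightarrow>
      (\<forall>v\<in>Z j. \<bar>\<psi> v - \<phi> v\<bar> \<le> e j) \<Longrightarrow> gain j \<psi> y"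
    by blast
  define Z' where "Z' = insert z (\<Union>j<J. Z j)"
  define e' where "e' = Min (insert (\<delta> / 2) (e ` {..<J}))"
  have "0 < e'" unfolding e'_def using e \<delta>(1) by (subst Min_gr_iff) auto
  moreover have "e' \<le> \<delta> / 2" unfolding e'_def by (intro Min_le) auto
  moreover have "e' \<le> e j" if "j < J" for j unfolding e'_def using that by (intro Min_le) auto
  ultimately have e': "0 < e'" "e' \<le> \<delta> / 2" "\<And>j. j < J \<Longrightarrow> e' \<le> e j" by blast+
  have "finite Z'" unfolding Z'_def using Z by auto
  from near[OF this e'(1)] have "frequently (\<lambda>y. \<forall>v\<in>Z'. \<bar>\<Phi> y v - \<phi> v\<bar> < e') F" .
  moreover have "eventually (\<lambda>y. norm y \<le> 1 \<and> \<bar>\<phi> y\<bar> < \<delta> / 2 \<and> bad y) F"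
    using evF[OF eventually_weak0_norm] badF
      evF[OF eventually_weak0_functional[OF bounded_functional_bounded_linear[OF \<phi>], of "\<delta> / 2"]] \<delta>(1)
    by (auto intro: eventually_conj)
  ultimately obtain y where y: "\<forall>v\<in>Z'. \<bar>\<Phi> y v - \<phi> v\<bar> < e'" "norm y \<le> 1" "\<bar>\<phi> y\<bar> < \<delta> / 2" "bad y"
    using frequently_ex[OF frequently_eventually_conj] by blast
  define \<psi> where "\<psi> = \<Phi> y"
  have \<psi>D: "\<psi> \<in> dual_ball" unfolding \<psi>_def by (rule \<Phi>(1)[OF y(4)])
  have \<psi>: "bounded_functional colip \<psi>" using \<psi>D by (rule dual_ball_bounded)
  have big: "M + step_cost * \<delta> < \<psi> (z + s *\<^sub>R y)" unfolding \<psi>_def by (rule \<Phi>(2)[OF y(4)])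
  define q where "q = \<psi> (s *\<^sub>R y) - \<phi> (s *\<^sub>R y)"
  define T where "T = (\<Sum>j<J. slope j \<phi>)"
  have J0: "real J > 0" using J by simp
  have T: "T \<le> real J" using \<phi>D by (simp add: dual_ball_def T_def)
  have "gain j \<psi> y" if "j < J" for j
  proof (rule gain[OF that \<psi> y(2)], intro ballI)
    fix v assume "v \<in> Z j"
    then have "\<bar>\<psi> v - \<phi> v\<bar> < e'" using y(1) that by (auto simp: Z'_def \<psi>_def)
    then show "\<bar>\<psi> v - \<phi> v\<bar> \<le> e j" using e'(3)[OF that] by linarith
  qed
  then have gj: "(2 * slope (Suc j) \<phi> - slope j \<phi>) + (q / (8 * L) - \<delta> * (2 * (colip * lip) + 1)) \<le> slope j \<psi>"
    if "j < J" for j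
    using that unfolding gain_def q_def by (simp only: add_diff_eq)
  then have "(\<Sum>j<J. (2 * slope (Suc j) \<phi> - slope j \<phi>) + (q / (8 * L) - \<delta> * (2 * (colip * lip) + 1))) \<le> (\<Sum>j<J. slope j \<psi>)"
    by (intro sum_mono) simp
  also have "\<dots> \<le> real J" using \<psi>D by (simp add: dual_ball_def)
  finally have "(\<Sum>j<J. 2 * slope (Suc j) \<phi> - slope j \<phi>) + real J * (q / (8 * L) - \<delta> * (2 * (colip * lip) + 1)) \<le> real J"
    by (simp add: sum.distrib)
  moreover have "(\<Sum>j<J. 2 * slope (Suc j) \<phi> - slope j \<phi>) = T + 2 * (slope J \<phi> - slope 0 \<phi>)"
  proof -
    have "(\<Sum>j<J. slope (Suc j) \<phi>) = T + slope J \<phi> - slope 0 \<phi>"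
      using sum.lessThan_Suc_shift[of "\<lambda>j. slope j \<phi>" J] by (simp add: T_def)
    then show ?thesis by (simp add: sum_subtractf sum_distrib_left[symmetric] T_def)
  qed
  \<comment> \<open>What remains of the halving losses after telescoping is at most twice the slope
    at level 0, thus at most 2 colip lip; spread over \<open>J\<close> levels this is at most
    \<delta>.\<close>
  moreover have "- (real J * \<delta>) \<le> 2 * (slope J \<phi> - slope 0 \<phi>)"
  proof -
    have "- (real J * \<delta>) \<le> - (2 * (colip * lip))" using \<delta>(3) by simp
    also have "\<dots> \<le> - (2 * slope 0 \<phi>)" using slope_le_lip[OF \<phi> K, of 0] by simp
    also have "\<dots> \<le> 2 * (slope J \<phi> - slope 0 \<phi>)" using slope_nonneg[OF \<phi> K, of J] by simp
    finally show ?thesis .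
  qed
  ultimately have "T - real J * \<delta> + real J * (q / (8 * L) - \<delta> * (2 * (colip * lip) + 1)) \<le> real J" by linarith
  then have "real J * (q / (8 * L) - \<delta> * (2 * (colip * lip) + 2)) \<le> real J - T" by (simp add: algebra_simps)
  then have "q / (8 * L) - \<delta> * (2 * (colip * lip) + 2) \<le> (real J - T) / real J"
    using J0 by (simp add: pos_le_divide_eq mult.commute)
  also have "\<dots> = 1 - T / real J" using J0 by (simp add: diff_divide_distrib)
  finally have "q / (8 * L) \<le> 1 - T / real J + \<delta> * (2 * (colip * lip) + 2)" by simp
  then have "q \<le> (1 - T / real J + \<delta> * (2 * (colip * lip) + 2)) * (8 * L)"
    using L by (simp only: pos_divide_le_eq)
  then have qle: "q \<le> 8 * L * (1 - T / real J) + \<delta> * (16 * L * (colip * lip + 1))"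
    by (simp add: algebra_simps)
  have "\<bar>s * \<phi> y\<bar> \<le> 1 * \<bar>\<phi> y\<bar>" unfolding abs_mult using s(2) by (intro mult_right_mono) auto
  then have "\<phi> (s *\<^sub>R y) \<le> \<delta> / 2"
    using y(3) \<phi> by (simp add: bounded_functional_def linear_cmul abs_less_iff abs_le_iff)
  moreover have "\<psi> z \<le> \<phi> z + \<delta> / 2" using y(1) e'(2) by (force simp: Z'_def \<psi>_def abs_less_iff)
  moreover have "\<psi> (z + s *\<^sub>R y) = \<psi> z + q + \<phi> (s *\<^sub>R y)"
    using \<psi> by (simp add: bounded_functional_def linear_add q_def)
  moreover have "\<phi> z + 8 * L * (1 - T / real J) \<le> M"
  proof -
    have T01: "0 \<le> T / real J" "T / real J \<le> 1"
      using T J0 by (auto simp: T_def intro!: divide_nonneg_nonneg sum_nonneg slope_nonneg[OF \<phi> K])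
    have "\<phi> z \<le> T / real J * predual_norm z"
      unfolding T_def by (rule functional_le_predual_norm[OF \<phi>D])
    also have "\<dots> \<le> T / real J * M" using T01 by (intro mult_left_mono) (auto simp: M_def)
    finally have "\<phi> z \<le> T / real J * M" .
    moreover have "(1 - T / real J) * (8 * L) \<le> (1 - T / real J) * M"
      using T01 by (intro mult_left_mono) (auto simp: M_def)
    moreover have "T / real J * M + (1 - T / real J) * M = M" by (simp add: algebra_simps)
    ultimately show ?thesis by (simp add: mult.commute)
  qed
  moreover have "step_cost * \<delta> = \<delta> * (16 * L * (colip * lip + 1)) + \<delta>"
    by (simp add: step_cost_def algebra_simps)
  ultimately show False using big qle by linarith
qed

end

section \<open>Transfer of upper estimates\<close>

text \<open>All constants of the conclusion depend on \<open>c\<close> and \<open>L\<close> only, while the body \<open>C\<close>, the number of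
  scales and the norm of the target are chosen depending on \<open>S\<close>, \<open>w\<close> and \<open>k\<close>.\<close>

lemma (in coarse_inverses) transfer_upper_estimates:
  fixes c :: real
  assumes c: "0 < c"
  shows "\<exists>\<Lambda>>0. \<forall>S w k ss. finite S \<longrightarrow> S \<subseteq> {-1..1} \<longrightarrow> (\<forall>s\<in>S. 0 \<le> w s) \<longrightarrow> 1 \<le> k \<longrightarrow>
    (\<forall>j\<le>k. nested_eventually weak0 j (\<lambda>us :: 'a list.
      \<forall>ts. length ts = j \<longrightarrow> set ts \<subseteq> S \<longrightarrow> norm (lincomb ts us) \<le> c + sum_list (map w ts))) \<longrightarrow>
    length ss = k \<longrightarrow> set ss \<subseteq> S \<longrightarrow> sum_list (map w ss) \<le> c \<longrightarrow>
    nested_eventually weak0 k (\<lambda>ys :: 'b list. norm (lincomb ss ys) \<le> \<Lambda>)"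
proof -
  define lp where "lp = 2 * c * L + L"
  define cl where "cl = L * (1 / c + 1)"
  define cost where "cost = 16 * L * (cl * lp + 1) + 1"
  have pos: "0 < lp" "0 < cl" using L c by (auto simp: lp_def cl_def add_pos_pos)
  have cost0: "0 < cost" using pos L by (simp add: cost_def add_nonneg_pos)
  \<comment> \<open>8 L is the value followed at the origin, 3 bounds the total charge (at most 1
    from the weights divided by \<open>c\<close>, and k times 2 / k), and \<open>lp\<close> leads
    from the predual norm back to the norm.\<close>
  define \<Lambda> where "\<Lambda> = lp * (8 * L + cost * 3)"
  have "0 < \<Lambda>" using pos(1) cost0 L by (simp add: \<Lambda>_def add_pos_pos)
  moreover have "nested_eventually weak0 k (\<lambda>ys :: 'b list. norm (lincomb ss ys) \<le> \<Lambda>)"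
    if S: "finite S" "S \<subseteq> {-1..1}" and w: "\<forall>s\<in>S. 0 \<le> w s" and k: "1 \<le> k"
      and upper: "\<forall>j\<le>k. nested_eventually weak0 j (\<lambda>us :: 'a list.
        \<forall>ts. length ts = j \<longrightarrow> set ts \<subseteq> S \<longrightarrow> norm (lincomb ts us) \<le> c + sum_list (map w ts))"
      and ss: "length ss = k" "set ss \<subseteq> S" "sum_list (map w ss) \<le> c" for S w k ss
  proof -
    define \<delta> where "\<delta> s = w s / c + 2 / real k" for s
    define \<delta>0 where "\<delta>0 = 2 / real k"
    have \<delta>0: "0 < \<delta>0" using k by (simp add: \<delta>0_def)
    have \<delta>: "\<delta>0 \<le> \<delta> s" if "s \<in> S" for s using w c that by (simp add: \<delta>_def \<delta>0_def)
    have "\<exists>C :: 'a set. cball 0 c \<subseteq> C \<and> C \<subseteq> cball 0 (2 * c) \<and>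
        (\<forall>v\<in>C. \<forall>s\<in>S. eventually (\<lambda>u. (1 / (1 + (w s / c + 2 / real k))) *\<^sub>R (v + s *\<^sub>R u) \<in> C) weak0)"
      using w c k upper by (intro asymptotically_smooth_body[OF S]) blast+
    then obtain C :: "'a set" where C: "cball 0 c \<subseteq> C" "C \<subseteq> cball 0 (2 * c)"
        "\<And>v s. v \<in> C \<Longrightarrow> s \<in> S \<Longrightarrow> eventually (\<lambda>u. (1 / (1 + \<delta> s)) *\<^sub>R (v + s *\<^sub>R u) \<in> C) weak0"
      unfolding \<delta>_def by blast
    \<comment> \<open>The order of choice is essential: \<open>J\<close> is taken against the
      smallest charge \<open>\<delta>0\<close>, then \<eta> small enough for \<open>J\<close>
      doublings of the scale, and last \<open>r\<close>, which depends on \<eta> and on the least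
      nonzero modulus \<sigma> in \<open>S\<close>.\<close>
    obtain J :: nat where J: "2 * (cl * lp) / \<delta>0 < real J" "1 \<le> J"
      using reals_Archimedean2[of "max 1 (2 * (cl * lp) / \<delta>0)"] by (metis less_imp_le max_less_iff_conj of_nat_1 of_nat_le_iff)
    define \<eta> where "\<eta> = min 1 \<delta>0 / 2 ^ J"
    have \<eta>: "0 < \<eta>" "2 ^ J * \<eta> \<le> 1" "2 ^ J * \<eta> \<le> \<delta>0" using \<delta>0 by (auto simp: \<eta>_def)
    have "\<exists>\<sigma>>0. \<forall>s\<in>S. s \<noteq> 0 \<longrightarrow> \<sigma> \<le> \<bar>s\<bar>"
    proof (intro exI[of _ "Min (insert 1 (abs ` (S - {0})))"] conjI ballI impI)
      show "0 < Min (insert 1 (abs ` (S - {0})))" using S(1) by (subst Min_gr_iff) auto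
      show "Min (insert 1 (abs ` (S - {0}))) \<le> \<bar>s\<bar>" if "s \<in> S" "s \<noteq> 0" for s
        using S(1) that by (intro Min_le) auto
    qed
    then obtain \<sigma> where \<sigma>: "0 < \<sigma>" "\<And>s. s \<in> S \<Longrightarrow> s \<noteq> 0 \<Longrightarrow> \<sigma> \<le> \<bar>s\<bar>" by blast
    have "0 < \<delta>0 / (8 * cl)" using \<delta>0 pos by simp
    then obtain r where r: "1 \<le> r" "\<And>s. \<sigma> \<le> \<bar>s\<bar> \<Longrightarrow> \<bar>s\<bar> \<le> 1 \<Longrightarrow> admissible_scale \<eta> r (\<delta>0 / (8 * cl)) s"
      using admissible_scale_exists[OF \<eta>(1) _ \<sigma>(1)] by blast
    interpret B: coarse_inverses_body f g L C c r \<eta> J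
      by unfold_locales (use c C(1,2) J(2) r(1) \<eta>(1,2) in auto)
    have constants: "B.lip = lp" "B.colip = cl" "B.step_cost = cost"
      unfolding B.lip_def B.colip_def B.step_cost_def lp_def cl_def cost_def by auto
    define G where "G z = max (B.predual_norm z) (8 * L)" for z
    have step: "eventually (\<lambda>y. G (z + s *\<^sub>R y) \<le> G z + cost * \<delta> s) weak0" if s: "s \<in> S" for s z
    proof (cases "s = 0")
      case True
      then show ?thesis using cost0 \<delta>[OF s] \<delta>0 by simp
    next
      case False
      have "s \<in> {-1..1}" using S(2) s by blast
      then have s1: "\<bar>s\<bar> \<le> 1" by auto
      have d: "0 < \<delta> s" "\<delta>0 \<le> \<delta> s" using \<delta>[OF s] \<delta>0 by auto
      have "2 * (cl * lp) \<le> real J * \<delta>0" using J(1) \<delta>0 by (simp add: pos_divide_less_eq)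
      also have "\<dots> \<le> real J * \<delta> s" using d by (intro mult_left_mono) auto
      finally have Jd: "2 * (cl * lp) \<le> real J * \<delta> s" .
      have scale: "admissible_scale \<eta> r (\<delta> s / (8 * cl)) s"
        unfolding admissible_scale_def
      proof (intro allI impI)
        fix D :: real and m a :: 'a and y :: 'b
        assume *: "r \<le> D" "\<eta> * norm m \<le> D" "norm a \<le> \<bar>s\<bar> * D / 4" "norm y \<le> \<bar>s\<bar> * D / (16 * L)"
        have "\<delta>0 / (8 * cl) * D \<le> \<delta> s / (8 * cl) * D"
          using d(2) pos(2) r(1) *(1) by (intro mult_right_mono divide_right_mono) auto
        with r(2)[OF \<sigma>(2)[OF s False] s1, unfolded admissible_scale_def, rule_format, OF *]
        show "norm (g (f (m + a) + y) - (m + a)) \<le> \<bar>s\<bar> * D / 4 \<and>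
            mesh_error + norm (f (g (f (m + a) + y)) - (f (m + a) + y)) \<le> \<delta> s / (8 * cl) * D"
          by linarith
      qed
      have "eventually (\<lambda>y. max (B.predual_norm (z + s *\<^sub>R y)) (8 * L) \<le>
          max (B.predual_norm z) (8 * L) + B.step_cost * \<delta> s) weak0"
        by (rule B.predual_norm_step) (use False s1 d \<eta>(3) Jd scale C(3)[OF _ s] in \<open>auto simp: constants\<close>)
      then show ?thesis unfolding G_def constants .
    qed
    \<comment> \<open>The bound in \<open>step\<close> holds from every point and in the same
      quantity \<open>G\<close> on both sides, so charges of successive steps simply add up.\<close>
    have walk: "nested_eventually weak0 (length ts) (\<lambda>ys. G (z + lincomb ts ys) \<le> G z + cost * sum_list (map \<delta> ts))"
      if "set ts \<subseteq> S" for ts z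
      using that
    proof (induction ts arbitrary: z)
      case (Cons s ts)
      from Cons.prems have s: "s \<in> S" and ts: "set ts \<subseteq> S" by auto
      have "eventually (\<lambda>y. nested_eventually weak0 (length ts)
          (\<lambda>ys. G (z + lincomb (s # ts) (y # ys)) \<le> G z + cost * sum_list (map \<delta> (s # ts)))) weak0"
        using step[OF s, of z]
      proof (rule eventually_mono)
        fix y assume y: "G (z + s *\<^sub>R y) \<le> G z + cost * \<delta> s"
        show "nested_eventually weak0 (length ts)
          (\<lambda>ys. G (z + lincomb (s # ts) (y # ys)) \<le> G z + cost * sum_list (map \<delta> (s # ts)))"
          using Cons.IH[OF ts, of "z + s *\<^sub>R y"]
          by (rule nested_eventually_mono) (use y in \<open>simp add: add.assoc distrib_left\<close>)
      qed
      then show ?case by simp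
    qed simp
    have "sum_list (map \<delta> ss) = sum_list (map w ss) / c + real (length ss) * (2 / real k)"
      by (induction ss) (simp_all add: \<delta>_def add_divide_distrib distrib_right)
    also have "\<dots> \<le> 1 + 2"
      using ss k c by (intro add_mono) (auto simp: divide_le_eq)
    finally have "cost * sum_list (map \<delta> ss) \<le> cost * 3" using cost0 by simp
    moreover have "G 0 = 8 * L" using L by (simp add: G_def B.predual_norm_zero)
    ultimately show ?thesis
      using walk[OF ss(2), of 0] unfolding ss(1)
    proof (elim nested_eventually_mono)
      fix ys assume *: "cost * sum_list (map \<delta> ss) \<le> cost * 3" "G 0 = 8 * L"
        "G (0 + lincomb ss ys) \<le> G 0 + cost * sum_list (map \<delta> ss)"
      then have "B.predual_norm (lincomb ss ys) \<le> 8 * L + cost * 3" by (simp add: G_def)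
      then have "lp * B.predual_norm (lincomb ss ys) \<le> \<Lambda>"
        unfolding \<Lambda>_def using pos(1) by (intro mult_left_mono) auto
      then show "norm (lincomb ss ys) \<le> \<Lambda>"
        using B.norm_le_predual_norm[of "lincomb ss ys"] unfolding constants by linarith
    qed
  qed
  ultimately show ?thesis by blast
qed

section \<open>Asymptotic coarse Lipschitz equivalence\<close>

text \<open>Far from \<open>x0\<close> the bound is the limit itself; on the remaining ball the
  coarse Lipschitz bound for \<open>h\<close> keeps \<open>h x - x\<close> bounded. If the whole
  space is bounded, a constant suffices.\<close>

lemma asymptotically_close_id_bound:
  fixes h :: "'a::real_normed_vector \<Rightarrow> 'a"
  assumes M: "0 \<le> M" "\<And>x x'. norm (h x - h x') \<le> M * norm (x - x') + M"
    and close: "asymptotically_close h id" and e: "0 < e"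
  shows "\<exists>R\<ge>0. \<forall>x. norm (h x - x) \<le> e * norm x + R"
  using close unfolding asymptotically_close_def
proof
  assume "bounded (UNIV :: 'a set)"
  then obtain B where B: "\<And>x::'a. norm x \<le> B" by (auto simp: bounded_iff)
  have "norm (h x - x) \<le> e * norm x + 2 * B" for x
    using norm_triangle_ineq4[of "h x" x] B[of x] B[of "h x"] mult_nonneg_nonneg[OF less_imp_le[OF e] norm_ge_zero[of x]]
    by linarith
  moreover have "0 \<le> 2 * B" using B[of 0] by simp
  ultimately show ?thesis by blast
next
  assume "\<exists>x0. ((\<lambda>x. dist (h x) (id x) / dist x x0) \<longlongrightarrow> 0) (filtercomap (\<lambda>x. dist x x0) at_top)"
  then obtain x0 where "((\<lambda>x. dist (h x) x / dist x x0) \<longlongrightarrow> 0) (filtercomap (\<lambda>x. dist x x0) at_top)" by auto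
  then have "eventually (\<lambda>x. dist (dist (h x) x / dist x x0) 0 < e) (filtercomap (\<lambda>x. dist x x0) at_top)"
    using e by (rule tendstoD)
  then obtain R0 where R0: "\<And>x. R0 \<le> dist x x0 \<Longrightarrow> dist (h x) x / dist x x0 < e"
    unfolding eventually_filtercomap_at_top_linorder by fastforce
  define R1 where "R1 = max R0 1"
  define R where "R = e * norm x0 + ((M + 1) * R1 + M + norm (h x0 - x0))"
  have R1: "R1 \<ge> 1" by (simp add: R1_def)
  have tail: "0 \<le> (M + 1) * R1 + M + norm (h x0 - x0)" using M(1) R1 by (intro add_nonneg_nonneg mult_nonneg_nonneg) auto
  have "norm (h x - x) \<le> e * norm x + R" for x
  proof (cases "R1 \<le> dist x x0")
    case True
    then have "dist x x0 > 0" "R0 \<le> dist x x0" using R1 by (auto simp: R1_def)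
    then have "dist (h x) x \<le> e * dist x x0" using R0[of x] by (simp add: pos_divide_less_eq)
    also have "\<dots> \<le> e * (norm x + norm x0)"
      using e norm_triangle_ineq4[of x x0] by (intro mult_left_mono) (auto simp: dist_norm)
    finally show ?thesis using tail by (simp add: R_def dist_norm distrib_left)
  next
    case False
    then have d: "norm (x - x0) \<le> R1" by (simp add: dist_norm)
    have "h x - x = (h x - h x0) + (h x0 - x0) - (x - x0)" by simp
    then have "norm (h x - x) \<le> norm (h x - h x0) + norm (h x0 - x0) + norm (x - x0)"
      by (metis norm_triangle_ineq norm_triangle_ineq4 order_trans add_right_mono)
    also have "\<dots> \<le> (M * R1 + M) + norm (h x0 - x0) + R1"
      using M(2)[of x x0] mult_left_mono[OF d M(1)] d by linarith
    also have "\<dots> \<le> e * norm x + R"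
      using e by (simp add: R_def algebra_simps)
    finally show ?thesis .
  qed
  moreover have "0 \<le> R" using tail e by (simp add: R_def)
  ultimately show ?thesis by blast
qed

lemma coarse_lipschitz_comp_bound:
  fixes f :: "'a::real_normed_vector \<Rightarrow> 'b::real_normed_vector" and g :: "'b \<Rightarrow> 'c::real_normed_vector"
  assumes L: "0 \<le> L"
    and f: "\<And>x x'. norm (f x - f x') \<le> L * norm (x - x') + L"
    and g: "\<And>y y'. norm (g y - g y') \<le> L * norm (y - y') + L"
  shows "norm (g (f x) - g (f x')) \<le> (L * L + L) * norm (x - x') + (L * L + L)"
proof -
  have "norm (g (f x) - g (f x')) \<le> L * norm (f x - f x') + L" by (rule g)
  also have "\<dots> \<le> L * (L * norm (x - x') + L) + L" using f[of x x'] L by (intro add_right_mono mult_left_mono)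
  also have "\<dots> \<le> (L * L + L) * norm (x - x') + (L * L + L)" using L by (simp add: algebra_simps)
  finally show ?thesis .
qed

lemma coarse_lipschitzE:
  fixes f :: "'a::real_normed_vector \<Rightarrow> 'b::real_normed_vector"
  assumes "coarse_lipschitz f"
  obtains L0 where "\<And>L x x'. L0 \<le> L \<Longrightarrow> norm (f x - f x') \<le> L * norm (x - x') + L"
proof -
  obtain L0 where L0: "\<And>x x'. norm (f x - f x') \<le> L0 * norm (x - x') + L0"
    using assms unfolding coarse_lipschitz_def dist_norm by blast
  have "norm (f x - f x') \<le> L * norm (x - x') + L" if "L0 \<le> L" for L x x'
    using L0[of x x'] mult_right_mono[OF that norm_ge_zero[of "x - x'"]] that by linarith
  then show ?thesis using that by blast
qed

lemma coarse_inverses_exist: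
  assumes "asymptotically_coarse_lipschitz_equivalent TYPE('a::banach) TYPE('b::banach)"
  shows "\<exists>(f :: 'a \<Rightarrow> 'b) g L. coarse_inverses f g L"
proof -
  obtain f :: "'a \<Rightarrow> 'b" and g :: "'b \<Rightarrow> 'a" where fg: "coarse_lipschitz f" "coarse_lipschitz g"
      "asymptotically_close (g \<circ> f) id" "asymptotically_close (f \<circ> g) id"
    using assms unfolding asymptotically_coarse_lipschitz_equivalent_def by blast
  obtain L1 where L1: "\<And>L x x'. L1 \<le> L \<Longrightarrow> norm (f x - f x') \<le> L * norm (x - x') + L"
    using coarse_lipschitzE[OF fg(1)] by blast
  obtain L2 where L2: "\<And>L y y'. L2 \<le> L \<Longrightarrow> norm (g y - g y') \<le> L * norm (y - y') + L"
    using coarse_lipschitzE[OF fg(2)] by blast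
  define L where "L = max 1 (max L1 L2)"
  have L: "1 \<le> L" "L1 \<le> L" "L2 \<le> L" by (auto simp: L_def)
  note f = L1[OF L(2)] and g = L2[OF L(3)]
  have M: "0 \<le> L * L + L" using L(1) by simp
  have "coarse_inverses f g L"
  proof
    show "1 \<le> L" by (rule L(1))
    show "norm (f x - f x') \<le> L * norm (x - x') + L" for x x' by (rule f)
    show "norm (g y - g y') \<le> L * norm (y - y') + L" for y y' by (rule g)
    show "\<exists>R\<ge>0. \<forall>x. norm (g (f x) - x) \<le> e * norm x + R" if "0 < e" for e
      using asymptotically_close_id_bound[OF M _ fg(3) that] coarse_lipschitz_comp_bound[OF _ f g] L(1) by simp
    show "\<exists>R\<ge>0. \<forall>y. norm (f (g y) - y) \<le> e * norm y + R" if "0 < e" for e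
      using asymptotically_close_id_bound[OF M _ fg(4) that] coarse_lipschitz_comp_bound[OF _ g f] L(1) by simp
  qed
  then show ?thesis by blast
qed

section \<open>Coefficients, weights and the l_p norm\<close>

definition lp_weight :: "ereal \<Rightarrow> real \<Rightarrow> real" where
  "lp_weight p s = (if p = \<infinity> then 0 else \<bar>s\<bar> powr real_of_ereal p)"

lemma lp_weight_nonneg: "0 \<le> lp_weight p s"
  by (simp add: lp_weight_def)

lemma ereal_gt_1_cases:
  assumes "1 < (p :: ereal)"
  obtains "p = \<infinity>" | r where "p = ereal r" "1 < r"
  using assms by (cases p) auto

lemma lp_weight_mono: "1 < p \<Longrightarrow> \<bar>s\<bar> \<le> \<bar>t\<bar> \<Longrightarrow> lp_weight p s \<le> lp_weight p t"
  by (erule ereal_gt_1_cases) (auto simp: lp_weight_def intro: powr_mono2)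

lemma lp_norm_nonneg:
  assumes "1 < p" "1 \<le> k" shows "0 \<le> lp_norm p k a"
  using assms(1)
proof (cases p rule: ereal_gt_1_cases)
  case 1
  have "\<bar>a 1\<bar> \<le> Max ((\<lambda>i. \<bar>a i\<bar>) ` {1..k})" using assms(2) by (intro Max_ge) auto
  then show ?thesis using 1 by (simp add: lp_norm_def)
qed (simp add: lp_norm_def)

lemma abs_le_lp_norm:
  assumes "1 < p" "i \<in> {1..k}" shows "\<bar>a i\<bar> \<le> lp_norm p k a"
  using assms(1)
proof (cases p rule: ereal_gt_1_cases)
  case 1
  have "\<bar>a i\<bar> \<le> Max ((\<lambda>i. \<bar>a i\<bar>) ` {1..k})" using assms(2) by (intro Max_ge) auto
  then show ?thesis using 1 by (simp add: lp_norm_def)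
next
  case (2 r)
  have "\<bar>a i\<bar> powr r \<le> (\<Sum>i=1..k. \<bar>a i\<bar> powr r)"
    using assms(2) by (intro member_le_sum) auto
  then have "(\<bar>a i\<bar> powr r) powr (1 / r) \<le> (\<Sum>i=1..k. \<bar>a i\<bar> powr r) powr (1 / r)"
    using 2 by (intro powr_mono2) auto
  then show ?thesis using 2 by (simp add: lp_norm_def powr_powr)
qed

text \<open>For finite p this is the inequality t powr (1 / r) \<le> 1 + t for t \<ge> 0; for p =
  \<infinity> the weights vanish and the bound 1 on the coefficients remains.\<close>

lemma lp_norm_le_weights:
  assumes "1 < p" "1 \<le> k" "\<And>i. i \<in> {1..k} \<Longrightarrow> \<bar>a i\<bar> \<le> 1"
  shows "lp_norm p k a \<le> 1 + (\<Sum>i=1..k. lp_weight p (a i))"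
  using assms(1)
proof (cases p rule: ereal_gt_1_cases)
  case 1
  have "Max ((\<lambda>i. \<bar>a i\<bar>) ` {1..k}) \<le> 1" using assms(2,3) by (subst Max_le_iff) auto
  then show ?thesis using 1 by (simp add: lp_norm_def lp_weight_def)
next
  case (2 r)
  define T where "T = (\<Sum>i=1..k. \<bar>a i\<bar> powr r)"
  have T0: "0 \<le> T" unfolding T_def by (intro sum_nonneg) simp
  have "T powr (1 / r) \<le> 1 + T"
  proof (cases "T \<le> 1")
    case True
    then have "T powr (1 / r) \<le> 1" using T0 2 by (intro powr_le1) auto
    then show ?thesis using T0 by simp
  next
    case False
    then have "T powr (1 / r) \<le> T powr 1" using 2 by (intro powr_mono) auto
    then show ?thesis using T0 by simp
  qed
  then show ?thesis using 2 by (simp add: lp_norm_def lp_weight_def T_def)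
qed

lemma sum_lp_weight_normalized:
  assumes "1 < p" "0 < lp_norm p k a"
  shows "(\<Sum>i=1..k. lp_weight p (a i / lp_norm p k a)) \<le> 1"
  using assms(1)
proof (cases p rule: ereal_gt_1_cases)
  case 1
  then show ?thesis by (simp add: lp_weight_def)
next
  case (2 r)
  define T where "T = (\<Sum>i=1..k. \<bar>a i\<bar> powr r)"
  have n: "lp_norm p k a = T powr (1 / r)" using 2 by (simp add: lp_norm_def T_def)
  have T0: "0 \<le> T" unfolding T_def by (intro sum_nonneg) simp
  have "T \<noteq> 0" using assms(2) n by auto
  have "lp_weight p (a i / T powr (1 / r)) = \<bar>a i\<bar> powr r / T" for i
    using 2 T0 by (simp add: lp_weight_def abs_divide powr_divide powr_powr)
  then have "(\<Sum>i=1..k. lp_weight p (a i / lp_norm p k a)) = (\<Sum>i=1..k. \<bar>a i\<bar> powr r / T)"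
    unfolding n by simp
  also have "\<dots> = 1" using \<open>T \<noteq> 0\<close> by (simp add: sum_divide_distrib[symmetric] T_def)
  finally show ?thesis by simp
qed

lemma lincomb_scale: "lincomb (map (\<lambda>s. t * s) ss) ys = t *\<^sub>R lincomb ss ys"
proof (induction ss arbitrary: ys)
  case (Cons s ss)
  then show ?case by (cases ys) (simp_all add: scaleR_add_right)
qed simp

lemma lincomb_replicate: "length us = j \<Longrightarrow> lincomb (replicate j t) us = t *\<^sub>R sum_list us"
  by (induction j arbitrary: us) (auto simp: length_Suc_conv scaleR_add_right)

lemma norm_lincomb_diff:
  fixes ys :: "'a::real_normed_vector list"
  assumes "\<And>s. s \<in> set ss \<Longrightarrow> \<bar>s - \<rho> s\<bar> \<le> d" "\<forall>y\<in>set ys. norm y \<le> 1" "0 \<le> d"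
  shows "norm (lincomb ss ys - lincomb (map \<rho> ss) ys) \<le> real (length ss) * d"
  using assms(1,2)
proof (induction ss arbitrary: ys)
  case (Cons s ss)
  show ?case
  proof (cases ys)
    case Nil
    then show ?thesis using assms(3) by simp
  next
    case (Cons y zs)
    have "norm ((s - \<rho> s) *\<^sub>R y) \<le> d * 1"
      unfolding norm_scaleR using Cons.prems Cons assms(3) by (intro mult_mono) auto
    moreover have "norm (lincomb ss zs - lincomb (map \<rho> ss) zs) \<le> real (length ss) * d"
      using Cons.prems Cons by (intro Cons.IH) auto
    moreover have "lincomb (s # ss) ys - lincomb (map \<rho> (s # ss)) ys
        = (s - \<rho> s) *\<^sub>R y + (lincomb ss zs - lincomb (map \<rho> ss) zs)"
      using Cons by (simp add: algebra_simps)
    ultimately show ?thesis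
      using norm_triangle_ineq[of "(s - \<rho> s) *\<^sub>R y" "lincomb ss zs - lincomb (map \<rho> ss) zs"]
      by (simp add: distrib_right)
  qed
qed simp

text \<open>Rounding is toward 0, so that weights do not grow and the rounded coefficients stay
  within the charge allowed to the original ones.\<close>

lemma grid_rounding:
  assumes "1 \<le> (k::nat)" "\<bar>s\<bar> \<le> 1"
  shows "\<exists>t\<in>(\<lambda>i. real_of_int i / k) ` {- int k..int k}. \<bar>t\<bar> \<le> \<bar>s\<bar> \<and> \<bar>s - t\<bar> \<le> 1 / k"
proof -
  define n where "n = \<lfloor>\<bar>s\<bar> * k\<rfloor>"
  have k: "real k > 0" using assms(1) by simp
  have n: "0 \<le> n" "real_of_int n \<le> \<bar>s\<bar> * k" "\<bar>s\<bar> * k - n \<le> 1"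
    unfolding n_def by (auto simp: less_imp_le) linarith+
  have "\<bar>s\<bar> * k \<le> 1 * real k" using assms by (intro mult_right_mono) auto
  then have nk: "n \<le> int k" using n(2) by linarith
  have q: "real_of_int n / k \<le> \<bar>s\<bar>" "\<bar>s\<bar> - real_of_int n / k \<le> 1 / k" "0 \<le> real_of_int n / k"
    using n k by (simp_all add: pos_divide_le_eq le_divide_eq left_diff_distrib)
  show ?thesis
  proof (cases "s \<ge> 0")
    case True
    then show ?thesis using q n(1) nk by (intro bexI[of _ "real_of_int n / k"]) auto
  next
    case False
    then have "\<bar>- (real_of_int n / k)\<bar> \<le> \<bar>s\<bar>" "\<bar>s - (- (real_of_int n / k))\<bar> \<le> 1 / k" using q by linarith+
    moreover have "- (real_of_int n / k) \<in> (\<lambda>i. real_of_int i / k) ` {- int k..int k}"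
      using n(1) nk by (intro image_eqI[of _ _ "- n"]) auto
    ultimately show ?thesis by blast
  qed
qed

text \<open>The branch in property \<open>A\<^sub>p\<close> must work for all coefficients at once; finitely many of them
  suffice up to an error of norm at most 1, as all vectors are in the unit ball.\<close>

lemma all_coefficients:
  assumes p: "1 < p" and k: "1 \<le> k" and c: "0 < c" and \<Lambda>: "0 \<le> \<Lambda>"
    and each: "\<And>ss. length ss = k \<Longrightarrow> set ss \<subseteq> {-1..1} \<Longrightarrow> sum_list (map (\<lambda>s. c * lp_weight p s) ss) \<le> c \<Longrightarrow>
      nested_eventually weak0 k (\<lambda>ys :: 'b::real_normed_vector list. norm (lincomb ss ys) \<le> \<Lambda>)"
  shows "nested_eventually weak0 k (\<lambda>ys :: 'b list. \<forall>a. norm (lincomb (map a [1..<Suc k]) ys) \<le> (\<Lambda> + 1) * lp_norm p k a)"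
proof -
  define grid where "grid = (\<lambda>i. real_of_int i / k) ` {- int k..int k}"
  define I where "I = {ss. set ss \<subseteq> grid \<and> length ss = k \<and> sum_list (map (\<lambda>s. c * lp_weight p s) ss) \<le> c}"
  have k0: "real k > 0" using k by simp
  have "finite I"
    unfolding I_def by (rule finite_subset[OF _ finite_lists_length_eq[of grid k]]) (auto simp: grid_def)
  have "grid \<subseteq> {-1..1}" using k0 by (auto simp: grid_def divide_le_eq le_divide_eq)
  have "nested_eventually weak0 k (\<lambda>ys :: 'b list. \<forall>ss\<in>I. norm (lincomb ss ys) \<le> \<Lambda>)"
  proof (rule nested_eventually_Ball[OF \<open>finite I\<close>])
    fix ss assume "ss \<in> I"
    then show "nested_eventually weak0 k (\<lambda>ys :: 'b list. norm (lincomb ss ys) \<le> \<Lambda>)"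
      using \<open>grid \<subseteq> {-1..1}\<close> by (intro each) (auto simp: I_def)
  qed
  from nested_eventually_conj[OF this nested_eventually_all_elements[OF eventually_weak0_norm]]
  show ?thesis
  proof (rule nested_eventually_mono, intro allI)
    fix ys :: "'b list" and a :: "nat \<Rightarrow> real"
    assume ys: "(\<forall>ss\<in>I. norm (lincomb ss ys) \<le> \<Lambda>) \<and> (\<forall>y\<in>set ys. norm y \<le> 1)"
    define as where "as = map a [1..<Suc k]"
    have as: "length as = k" "\<And>s. s \<in> set as \<Longrightarrow> \<bar>s\<bar> \<le> lp_norm p k a"
      using abs_le_lp_norm[OF p] by (auto simp: as_def less_Suc_eq_le simp del: upt_Suc)
    define t where "t = lp_norm p k a"
    show "norm (lincomb (map a [1..<Suc k]) ys) \<le> (\<Lambda> + 1) * lp_norm p k a"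
    proof (cases "t = 0")
      case True
      then have "map (\<lambda>s. 0 * s) as = as" using as(2) by (intro map_idI) (auto simp: t_def)
      then have "lincomb as ys = 0" using lincomb_scale[of 0 as ys] by simp
      then show ?thesis using True by (simp add: as_def t_def)
    next
      case False
      then have t: "0 < t" using lp_norm_nonneg[OF p k, of a] by (simp add: t_def)
      \<comment> \<open>After normalisation the coefficients lie in [-1, 1] and their total charge
        is at most \<open>c\<close>. Rounding each of the \<open>k\<close> coefficients by at most 1
        / k, against vectors of norm at most 1, costs at most 1 in total.\<close>
      define bs where "bs = map (\<lambda>s. s / t) as"
      have bs1: "\<bar>s\<bar> \<le> 1" if "s \<in> set bs" for s
        using that as(2) t by (auto simp: bs_def t_def[symmetric] abs_divide)
      have "\<forall>s. \<exists>u. s \<in> set bs \<longrightarrow> u \<in> grid \<and> \<bar>u\<bar> \<le> \<bar>s\<bar> \<and> \<bar>s - u\<bar> \<le> 1 / k"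
        using grid_rounding[OF k] bs1 unfolding grid_def by blast
      from choice[OF this] obtain \<rho> where \<rho>: "\<And>s. s \<in> set bs \<Longrightarrow> \<rho> s \<in> grid \<and> \<bar>\<rho> s\<bar> \<le> \<bar>s\<bar> \<and> \<bar>s - \<rho> s\<bar> \<le> 1 / k"
        by blast
      have "sum_list (map (\<lambda>s. c * lp_weight p s) (map \<rho> bs)) \<le> sum_list (map (\<lambda>s. c * lp_weight p s) bs)"
        unfolding map_map o_def using \<rho> c by (intro sum_list_mono mult_left_mono lp_weight_mono[OF p]) auto
      also have "\<dots> = c * (\<Sum>i=1..k. lp_weight p (a i / t))"
        unfolding bs_def as_def map_map o_def sum_list_map_upt sum_distrib_left ..
      also have "\<dots> \<le> c * 1"
        using sum_lp_weight_normalized[OF p t[unfolded t_def]] c unfolding t_def by (intro mult_left_mono) auto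
      finally have "map \<rho> bs \<in> I" using \<rho> as(1) by (auto simp: I_def bs_def)
      then have "norm (lincomb (map \<rho> bs) ys) \<le> \<Lambda>" using ys by blast
      moreover have "norm (lincomb bs ys - lincomb (map \<rho> bs) ys) \<le> real (length bs) * (1 / k)"
        by (rule norm_lincomb_diff) (use \<rho> ys in auto)
      moreover have "real (length bs) * (1 / k) = 1" using k0 as(1) by (simp add: bs_def)
      ultimately have "norm (lincomb bs ys) \<le> \<Lambda> + 1"
        using norm_triangle_ineq2[of "lincomb bs ys" "lincomb (map \<rho> bs) ys"] by linarith
      moreover have "lincomb as ys = t *\<^sub>R lincomb bs ys"
        using lincomb_scale[of t bs ys] t by (simp add: bs_def o_def)
      ultimately have "norm (lincomb as ys) \<le> t * (\<Lambda> + 1)" using t by simp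
      then show ?thesis by (simp add: as_def t_def mult.commute)
    qed
  qed
qed

text \<open>Each coefficient list is transferred with its own finite set \<open>S = set ss\<close>,
  hence with its own renorming; only because \<Lambda> is common to all of them can
  \<open>all_coefficients\<close> collect them.\<close>

lemma property_A_transfer:
  assumes p: "1 < p" and eq: "asymptotically_coarse_lipschitz_equivalent TYPE('a::banach) TYPE('b::banach)"
    and A: "property_A p TYPE('a)"
  shows "property_A p TYPE('b)"
proof -
  obtain f :: "'a \<Rightarrow> 'b" and g L where "coarse_inverses f g L" using coarse_inverses_exist[OF eq] by blast
  then interpret coarse_inverses f g L .
  obtain c where c: "0 < c" and Ac: "\<And>k. 1 \<le> k \<Longrightarrow> nested_eventually weak0 k
      (\<lambda>us :: 'a list. \<forall>a. norm (lincomb (map a [1..<Suc k]) us) \<le> c * lp_norm p k a)"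
    using A unfolding property_A_iff by blast
  obtain \<Lambda> where \<Lambda>: "0 < \<Lambda>" and tr: "\<And>S w k ss. finite S \<Longrightarrow> S \<subseteq> {-1..1} \<Longrightarrow> \<forall>s\<in>S. 0 \<le> w s \<Longrightarrow> 1 \<le> k \<Longrightarrow>
    \<forall>j\<le>k. nested_eventually weak0 j (\<lambda>us :: 'a list.
      \<forall>ts. length ts = j \<longrightarrow> set ts \<subseteq> S \<longrightarrow> norm (lincomb ts us) \<le> c + sum_list (map w ts)) \<Longrightarrow>
    length ss = k \<Longrightarrow> set ss \<subseteq> S \<Longrightarrow> sum_list (map w ss) \<le> c \<Longrightarrow>
    nested_eventually weak0 k (\<lambda>ys :: 'b list. norm (lincomb ss ys) \<le> \<Lambda>)"
    using transfer_upper_estimates[OF c] by blast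
  define w where "w s = c * lp_weight p s" for s
  have upper: "nested_eventually weak0 j (\<lambda>us :: 'a list.
      \<forall>ts. length ts = j \<longrightarrow> set ts \<subseteq> S \<longrightarrow> norm (lincomb ts us) \<le> c + sum_list (map w ts))"
    if S: "S \<subseteq> {-1..1}" for S j
  proof (cases "j = 0")
    case True
    then show ?thesis using c by simp
  next
    case False
    then have j: "1 \<le> j" by simp
    show ?thesis
      using Ac[OF j]
    proof (rule nested_eventually_mono, intro allI impI)
      fix us :: "'a list" and ts :: "real list"
      assume us: "\<forall>a. norm (lincomb (map a [1..<Suc j]) us) \<le> c * lp_norm p j a"
        and ts: "length ts = j" "set ts \<subseteq> S"
      define a where "a i = ts ! (i - 1)" for i
      have ts_eq: "ts = map a [1..<Suc j]"
        by (rule nth_equalityI) (auto simp: ts(1) a_def simp del: upt_Suc)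
      have "\<bar>a i\<bar> \<le> 1" if "i \<in> {1..j}" for i
      proof -
        have "a i \<in> set ts" using that ts(1) by (auto simp: a_def)
        then have "a i \<in> {-1..1}" using ts(2) S by blast
        then show ?thesis by auto
      qed
      from lp_norm_le_weights[OF p j this]
      have "c * lp_norm p j a \<le> c * (1 + (\<Sum>i=1..j. lp_weight p (a i)))"
        using c by (intro mult_left_mono) auto
      also have "\<dots> = c + sum_list (map w ts)"
        unfolding ts_eq map_map o_def sum_list_map_upt w_def by (simp add: distrib_left sum_distrib_left)
      finally show "norm (lincomb ts us) \<le> c + sum_list (map w ts)"
        using us[rule_format, of a] unfolding ts_eq[symmetric] by linarith
    qed
  qed
  have "nested_eventually weak0 k (\<lambda>ys :: 'b list. \<forall>a. norm (lincomb (map a [1..<Suc k]) ys) \<le> (\<Lambda> + 1) * lp_norm p k a)"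
    if k: "1 \<le> k" for k
  proof (rule all_coefficients[OF p k c])
    show "0 \<le> \<Lambda>" using \<Lambda> by simp
    fix ss assume ss: "length ss = k" "set ss \<subseteq> {-1..1}" "sum_list (map (\<lambda>s. c * lp_weight p s) ss) \<le> c"
    show "nested_eventually weak0 k (\<lambda>ys :: 'b list. norm (lincomb ss ys) \<le> \<Lambda>)"
      by (rule tr[of "set ss" w]) (use ss k c upper[OF ss(2)] in \<open>auto simp: w_def[abs_def] lp_weight_nonneg\<close>)
  qed
  moreover have "0 < \<Lambda> + 1" using \<Lambda> by simp
  ultimately show ?thesis unfolding property_A_iff by blast
qed

text \<open>A single coefficient \<open>\<sigma> = real k powr (- q)\<close> with weight 0 suffices:
  \<sigma> times a sum of j \<le> k vectors is bounded by \<open>c\<close> on the source, since j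
  powr q \<le> k powr q. Multiplying the transferred bound by k powr q restores the growth
  rate.\<close>

lemma property_N_transfer:
  assumes p: "1 < p" and eq: "asymptotically_coarse_lipschitz_equivalent TYPE('a::banach) TYPE('b::banach)"
    and N: "property_N p TYPE('a)"
  shows "property_N p TYPE('b)"
proof -
  obtain f :: "'a \<Rightarrow> 'b" and g L where "coarse_inverses f g L" using coarse_inverses_exist[OF eq] by blast
  then interpret coarse_inverses f g L .
  define q where "q = real_of_ereal (1 / p)"
  have q: "0 \<le> q" using p by (cases p rule: ereal_gt_1_cases) (auto simp: q_def one_ereal_def)
  obtain c where c: "0 < c" and Nc: "\<And>k. 1 \<le> k \<Longrightarrow> nested_eventually weak0 k
      (\<lambda>us :: 'a list. norm (sum_list us) \<le> c * real k powr q)"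
    using N unfolding property_N_iff q_def by blast
  obtain \<Lambda> where \<Lambda>: "0 < \<Lambda>" and tr: "\<And>S w k ss. finite S \<Longrightarrow> S \<subseteq> {-1..1} \<Longrightarrow> \<forall>s\<in>S. 0 \<le> w s \<Longrightarrow> 1 \<le> k \<Longrightarrow>
    \<forall>j\<le>k. nested_eventually weak0 j (\<lambda>us :: 'a list.
      \<forall>ts. length ts = j \<longrightarrow> set ts \<subseteq> S \<longrightarrow> norm (lincomb ts us) \<le> c + sum_list (map w ts)) \<Longrightarrow>
    length ss = k \<Longrightarrow> set ss \<subseteq> S \<Longrightarrow> sum_list (map w ss) \<le> c \<Longrightarrow>
    nested_eventually weak0 k (\<lambda>ys :: 'b list. norm (lincomb ss ys) \<le> \<Lambda>)"
    using transfer_upper_estimates[OF c] by blast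
  have "nested_eventually weak0 k (\<lambda>ys :: 'b list. norm (sum_list ys) \<le> \<Lambda> * real k powr q)" if k: "1 \<le> k" for k
  proof -
    define \<sigma> where "\<sigma> = real k powr (- q)"
    have \<sigma>: "0 < \<sigma>" "\<sigma> * real k powr q = 1"
      using k by (simp_all add: \<sigma>_def powr_add[symmetric])
    have "real k powr q \<ge> 1" using k q by (simp add: ge_one_powr_ge_zero)
    then have \<sigma>1: "\<sigma> \<le> 1" using \<sigma> mult_left_mono[of 1 "real k powr q" \<sigma>] by simp
    have upper: "nested_eventually weak0 j (\<lambda>us :: 'a list.
        \<forall>ts. length ts = j \<longrightarrow> set ts \<subseteq> {\<sigma>} \<longrightarrow> norm (lincomb ts us) \<le> c + sum_list (map (\<lambda>_. 0) ts))"
      if "j \<le> k" for j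
    proof (cases "j = 0")
      case True
      then show ?thesis using c by simp
    next
      case False
      then have "1 \<le> j" by simp
      from Nc[OF this] show ?thesis
      proof (rule nested_eventually_mono, intro allI impI)
        fix us :: "'a list" and ts :: "real list"
        assume us: "length us = j" "norm (sum_list us) \<le> c * real j powr q" and ts: "length ts = j" "set ts \<subseteq> {\<sigma>}"
        have "ts = replicate j \<sigma>" using ts by (auto intro: replicate_eqI)
        then have "norm (lincomb ts us) = \<sigma> * norm (sum_list us)"
          using lincomb_replicate[OF us(1)] \<sigma>(1) by simp
        also have "\<dots> \<le> \<sigma> * (c * real k powr q)"
        proof (rule mult_left_mono)
          have "real j powr q \<le> real k powr q" using \<open>j \<le> k\<close> q by (intro powr_mono2) auto
          then have "c * real j powr q \<le> c * real k powr q" using c by (intro mult_left_mono) auto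
          then show "norm (sum_list us) \<le> c * real k powr q" using us(2) by linarith
        qed (use \<sigma> in simp)
        also have "\<dots> = c" using \<sigma>(2) by (simp add: mult.left_commute)
        finally show "norm (lincomb ts us) \<le> c + sum_list (map (\<lambda>_. 0) ts)" by simp
      qed
    qed
    have "nested_eventually weak0 k (\<lambda>ys :: 'b list. norm (lincomb (replicate k \<sigma>) ys) \<le> \<Lambda>)"
      by (rule tr[of "{\<sigma>}" "\<lambda>_. 0"]) (use \<sigma> \<sigma>1 k c upper in \<open>auto simp: sum_list_replicate\<close>)
    then show ?thesis
    proof (rule nested_eventually_mono)
      fix ys :: "'b list" assume "length ys = k" "norm (lincomb (replicate k \<sigma>) ys) \<le> \<Lambda>"
      then have "\<sigma> * norm (sum_list ys) \<le> \<Lambda>" using lincomb_replicate[of ys k \<sigma>] \<sigma>(1) by simp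
      then have "(\<sigma> * norm (sum_list ys)) * real k powr q \<le> \<Lambda> * real k powr q" by (intro mult_right_mono) auto
      moreover have "(\<sigma> * norm (sum_list ys)) * real k powr q = norm (sum_list ys)"
        using \<sigma>(2) by (simp add: mult.commute mult.left_commute)
      ultimately show "norm (sum_list ys) \<le> \<Lambda> * real k powr q" by simp
    qed
  qed
  then show ?thesis using \<Lambda> unfolding property_N_iff q_def by blast
qed

theorem theorem5p7:
  fixes p :: ereal
  assumes "1 < p"
    and "asymptotically_coarse_lipschitz_equivalent TYPE('a::banach) TYPE('b::banach)"
  shows "(property_A p TYPE('a) \<longrightarrow> property_A p TYPE('b)) \<and>
         (property_N p TYPE('a) \<longrightarrow> property_N p TYPE('b))"
  using property_A_transfer[OF assms] property_N_transfer[OF assms] by blast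

end
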